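(* Suppose $F,q,\phi$ satisfy hypothesis (H) of the context. Let $W_1\in C^0(\Lambda)$ (resp. $W_2\in C^0(\Lambda)$) be a viscosity subsolution (resp. supersolution) of $$\partial_t V(\gamma_t)+\mathbf H(\gamma_t,\partial_xV(\gamma_t))=0,\quad (t,\gamma_t)\in[0,T)\times\Lambda;\qquad V(\gamma_T)=\phi(\gamma_T),\quad \gamma_T\in\Lambda_T,$$ where $\mathbf H(\gamma_t,p)=\inf_{u\in U}[(p,F(\gamma_t,u))_{R^d}+q(\gamma_t,u)]$. Suppose there exists a constant $K>0$ such that for all $(t,\gamma_t),(s,\eta_s)\in[0,T]\times\Lambda$, $$|W_1(\gamma_t)|\vee|W_2(\gamma_t)|\le K(1+\|\gamma_t\|_0),$$ $$|W_1(\gamma_t)-W_1(\eta_s)|\vee|W_2(\gamma_t)-W_2(\eta_s)|\le K(1+\|\gamma_t\|_0\vee\|\eta_s\|_0)\,d_\infty(\gamma_t,\eta_s).$$ Then $W_1\le W_2$ on $\Lambda$.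
   Context: Paths. Fix $T>0$ and $d\ge1$. For $t\in[0,T]$, $\hat\Lambda_t$ is the set of càdlàg functions $[0,t]\to R^d$ and $\Lambda_t=C([0,t];R^d)$; $\hat\Lambda^t=\bigcup_{s\in[t,T]}\hat\Lambda_s$, $\Lambda^t=\bigcup_{s\in[t,T]}\Lambda_s$, $\hat\Lambda=\hat\Lambda^0$, $\Lambda=\Lambda^0$. A path in $\hat\Lambda_t$ is written $\gamma_t$ (the subscript is the final time), with value $\gamma_t(s)$ at $s\le t$; $(s,\gamma_s)\in[t,T]\times\Lambda^t$ means $s\in[t,T]$, $\gamma_s\in\Lambda_s$ (similarly for $\hat\Lambda^t$). For $t\le\bar t\le T$, $\gamma_{t,\bar t}\in\hat\Lambda_{\bar t}$ equals $\gamma_t$ on $[0,t]$ and $\gamma_t(t)$ on $(t,\bar t]$; for $x\in R^d$, $\gamma_t^x$ equals $\gamma_t$ on $[0,t)$ and $\gamma_t(t)+x$ at $t$. $\|\gamma_t\|_0=\sup_{0\le s\le t}|\gamma_t(s)|$ and, for $t\le\bar t$, $d_\infty(\gamma_t,\bar\gamma_{\bar t})=|t-\bar t|+\sup_{0\le s\le\bar t}|\gamma_{t,\bar t}(s)-\bar\gamma_{\bar t}(s)|$ (extended symmetrically). Derivatives. For $f:\hat\Lambda^t\to R$: the horizontal derivative is $\partial_tf(\gamma_s)=\lim_{h\downarrow0}\frac1h[f(\gamma_{s,s+h})-f(\gamma_s)]$ for $s<T$, and $\partial_tf(\gamma_T)=\lim_{s\uparrow T,\,s<T}\partial_tf(\gamma_T|_{[0,s]})$;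 the vertical derivative is $\partial_xf=(\partial_{x_1}f,\dots,\partial_{x_d}f)$, $\partial_{x_i}f(\gamma_s)=\lim_{h\to0}\frac1h[f(\gamma_s^{he_i})-f(\gamma_s)]$, $e_i$ the standard basis. $C^0(\hat\Lambda^t)$, $C^0(\Lambda^t)$ are the $d_\infty$-continuous real functionals. $C^1(\hat\Lambda^t)$ is the set of $f\in C^0(\hat\Lambda^t)$ such that $\partial_tf,\partial_{x_1}f,\dots,\partial_{x_d}f$ exist on all of $\hat\Lambda^t$ and lie in $C^0(\hat\Lambda^t)$. $f\in C^1(\Lambda^t)$ means $f$ is the restriction to $\Lambda^t$ of some $\hat f\in C^1(\hat\Lambda^t)$; then $\partial_tf:=\partial_t\hat f$, $\partial_xf:=\partial_x\hat f$ on $\Lambda^t$ (independent of the choice of $\hat f$). Hypothesis (H). $(U,d)$ is a metric space. $F:\Lambda\times U\to R^d$, $q:\Lambda\times U\to R$, $\phi:\Lambda_T\to R$ are continuous and for some $L>0$, for all $t\in[0,T]$, $\gamma_t,\gamma'_t\in\Lambda_t$, $u\in U$, $\eta_T,\eta'_T\in\Lambda_T$: $|F(\gamma_t,u)-F(\gamma'_t,u)|\vee|q(\gamma_t,u)-q(\gamma'_t,u)|\le L\|\gamma_t-\gamma'_t\|_0$; $|F(\gamma_t,u)|\vee|q(\gamma_t,u)|\le L(1+\|\gamma_t\|_0)$; $|\phi(\eta_T)-\phi(\eta'_T)|\le L\|\eta_T-\eta'_T\|_0$; $|\phi(\eta_T)|\le L(1+\|\eta_T\|_0)$. Viscosity solutions.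 For $\mu,M_0>0$, $\mathcal C^\mu_{t,M_0}=\{\gamma_s\in\Lambda^t:\|\gamma_s\|_0\le M_0,\ \sup_{0\le l<r\le s}\frac{|\gamma_s(l)-\gamma_s(r)|}{|l-r|}\le\mu(1+M_0)\}$, $\mathcal C^\mu_{M_0}=\mathcal C^\mu_{0,M_0}$. For $w\in C^0(\Lambda)$, $J^+_{\mu,M_0}(\gamma_t,w)=\{\varphi\in C^1(\Lambda^t):0=(w-\varphi)(\gamma_t)=\sup_{\eta_s\in\mathcal C^\mu_{t,M_0}}(w-\varphi)(\eta_s)\}$ and $J^-_{\mu,M_0}(\gamma_t,w)=\{\varphi\in C^1(\Lambda^t):0=(w+\varphi)(\gamma_t)=\inf_{\eta_s\in\mathcal C^\mu_{t,M_0}}(w+\varphi)(\eta_s)\}$. $w\in C^0(\Lambda)$ is a viscosity $\mu$-subsolution (resp. $\mu$-supersolution) if $w(\gamma_T)\le\phi(\gamma_T)$ (resp. $\ge$) for all $\gamma_T\in\Lambda_T$ and, for every $M_0>0$, whenever $\varphi\in J^+_{\mu,M_0}(\gamma_s,w)$ (resp. $J^-_{\mu,M_0}(\gamma_s,w)$) with $s\in[0,T)$, $\gamma_s\in\mathcal C^\mu_{M_0}$, $|\gamma_s(s)|<M_0$, one has $\partial_t\varphi(\gamma_s)+\mathbf H(\gamma_s,\partial_x\varphi(\gamma_s))\ge0$ (resp. $-\partial_t\varphi(\gamma_s)+\mathbf H(\gamma_s,-\partial_x\varphi(\gamma_s))\le0$). $w$ is a viscosity subsolution (supersolution) if there is $\mu_0>0$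 such that $w$ is a viscosity $\mu$-subsolution ($\mu$-supersolution) for all $\mu\ge\mu_0$. *)

theory Defs
  imports "HOL-Analysis.Analysis"
begin

section \<open>Paths\<close>

definition cadlag_on :: "real \<Rightarrow> (real \<Rightarrow> real ^ 'n) \<Rightarrow> bool" where
  "cadlag_on t \<gamma> \<longleftrightarrow>
     (\<forall>s\<in>{0..<t}. (\<gamma> \<longlongrightarrow> \<gamma> s) (at_right s)) \<and>
     (\<forall>s\<in>{0<..t}. \<exists>l. (\<gamma> \<longlongrightarrow> l) (at_left s))"

lemma cadlag_on_cong:
  fixes f g :: "real \<Rightarrow> real ^ 'n"
  assumes "\<And>s. s \<in> {0..t} \<Longrightarrow> f s = g s"
  shows "cadlag_on t f \<longleftrightarrow> cadlag_on t g"
proof -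
  have "cadlag_on t g" if c: "cadlag_on t f" and e: "\<And>s. s \<in> {0..t} \<Longrightarrow> f s = g s" for f g :: "real \<Rightarrow> real ^ 'n"
    unfolding cadlag_on_def
  proof (intro conjI ballI)
    fix s assume s: "s \<in> {0..<t}"
    then have "(f \<longlongrightarrow> f s) (at_right s)" using c by (auto simp: cadlag_on_def)
    moreover have "\<forall>\<^sub>F r in at_right s. f r = g r"
      using s e unfolding eventually_at_right_field by (intro exI[of _ t]) auto
    ultimately show "(g \<longlongrightarrow> g s) (at_right s)"
      using s e[of s] by (auto intro: Lim_transform_eventually)
  next
    fix s assume s: "s \<in> {0<..t}"
    then obtain l where "(f \<longlongrightarrow> l) (at_left s)"
      using c unfolding cadlag_on_def by blast
    moreover have "\<forall>\<^sub>F r in at_left s. f r = g r"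
      using s e unfolding eventually_at_left_field by (intro exI[of _ 0]) auto
    ultimately show "\<exists>l. (g \<longlongrightarrow> l) (at_left s)"
      by (auto intro: Lim_transform_eventually)
  qed
  from this[of f g] this[of g f] show ?thesis using assms by auto
qed

lemma continuous_on_imp_cadlag_on:
  assumes c: "continuous_on {0..t} \<gamma>"
  shows "cadlag_on t \<gamma>"
  unfolding cadlag_on_def
proof (intro conjI ballI)
  fix s assume s: "s \<in> {0..<t}"
  have "(\<gamma> \<longlongrightarrow> \<gamma> s) (at s within {0..t})"
    using c s by (auto simp: continuous_on)
  then have "(\<gamma> \<longlongrightarrow> \<gamma> s) (at s within {s..t})"
    by (rule tendsto_within_subset) (use s in auto)
  then show "(\<gamma> \<longlongrightarrow> \<gamma> s) (at_right s)"
    using s by (simp add: at_within_Icc_at_right)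
next
  fix s assume s: "s \<in> {0<..t}"
  have "(\<gamma> \<longlongrightarrow> \<gamma> s) (at s within {0..t})"
    using c s by (auto simp: continuous_on)
  then have "(\<gamma> \<longlongrightarrow> \<gamma> s) (at s within {0..s})"
    by (rule tendsto_within_subset) (use s in auto)
  then show "\<exists>l. (\<gamma> \<longlongrightarrow> l) (at_left s)"
    using s by (auto simp: at_within_Icc_at_left)
qed

lemma cadlag_on_min:
  assumes c: "cadlag_on t \<gamma>" and t: "0 \<le> t"
  shows "cadlag_on t' (\<lambda>r. \<gamma> (min r t))"
  unfolding cadlag_on_def
proof (intro conjI ballI)
  fix s assume s: "s \<in> {0..<t'}"
  show "((\<lambda>r. \<gamma> (min r t)) \<longlongrightarrow> \<gamma> (min s t)) (at_right s)"
  proof (cases "s < t")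
    case True
    then have "(\<gamma> \<longlongrightarrow> \<gamma> s) (at_right s)" using c s by (auto simp: cadlag_on_def)
    moreover have "\<forall>\<^sub>F r in at_right s. \<gamma> r = \<gamma> (min r t)"
      using True unfolding eventually_at_right_field by (intro exI[of _ t]) auto
    ultimately show ?thesis using True by (auto intro: Lim_transform_eventually)
  next
    case False
    then have "\<forall>\<^sub>F r in at_right s. \<gamma> t = \<gamma> (min r t)"
      unfolding eventually_at_right_field by (intro exI[of _ "s + 1"]) (auto simp: min_def)
    then show ?thesis using False
      by (auto simp: min_def intro: Lim_transform_eventually[OF tendsto_const])
  qed
next
  fix s assume s: "s \<in> {0<..t'}"
  show "\<exists>l. ((\<lambda>r. \<gamma> (min r t)) \<longlongrightarrow> l) (at_left s)"
  proof (cases "s \<le> t")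
    case True
    then obtain l where "(\<gamma> \<longlongrightarrow> l) (at_left s)"
      using c s unfolding cadlag_on_def by (meson greaterThanAtMost_iff)
    moreover have "\<forall>\<^sub>F r in at_left s. \<gamma> r = \<gamma> (min r t)"
      using True unfolding eventually_at_left_field by (intro exI[of _ "s - 1"]) auto
    ultimately show ?thesis by (auto intro: Lim_transform_eventually)
  next
    case False
    then have "\<forall>\<^sub>F r in at_left s. \<gamma> t = \<gamma> (min r t)"
      unfolding eventually_at_left_field by (intro exI[of _ t]) (auto simp: min_def)
    then show ?thesis
      by (auto intro: Lim_transform_eventually[OF tendsto_const])
  qed
qed

lemma cadlag_on_upd:
  assumes c: "cadlag_on t \<gamma>"
  shows "cadlag_on t (\<gamma>(t := x))"
  unfolding cadlag_on_def
proof (intro conjI ballI)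
  fix s assume s: "s \<in> {0..<t}"
  then have "(\<gamma> \<longlongrightarrow> \<gamma> s) (at_right s)" using c by (auto simp: cadlag_on_def)
  moreover have "\<forall>\<^sub>F r in at_right s. \<gamma> r = (\<gamma>(t := x)) r"
    using s unfolding eventually_at_right_field by (intro exI[of _ t]) auto
  ultimately show "(\<gamma>(t := x) \<longlongrightarrow> (\<gamma>(t := x)) s) (at_right s)"
    using s by (auto intro: Lim_transform_eventually)
next
  fix s assume s: "s \<in> {0<..t}"
  then obtain l where "(\<gamma> \<longlongrightarrow> l) (at_left s)"
    using c unfolding cadlag_on_def by blast
  moreover have "\<forall>\<^sub>F r in at_left s. \<gamma> r = (\<gamma>(t := x)) r"
    using s unfolding eventually_at_left_field by (intro exI[of _ 0]) auto
  ultimately show "\<exists>l. (\<gamma>(t := x) \<longlongrightarrow> l) (at_left s)"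
    using Lim_transform_eventually by blast
qed

lemma bounded_cadlag:
  assumes "cadlag_on t \<gamma>"
  shows "bounded (\<gamma> ` {0..t})"
proof (cases "0 \<le> t")
  case True
  define P where "P a b \<longleftrightarrow> bounded (\<gamma> ` ({a..b} \<inter> {0..t}))" for a b
  have "P 0 t"
    using True
  proof (induction rule: Bolzano)
    case (trans a b c)
    have "bounded (\<gamma> ` ({a..b} \<inter> {0..t}) \<union> \<gamma> ` ({b..c} \<inter> {0..t}))"
      using trans by (simp add: P_def)
    then show ?case
      unfolding P_def image_Un[symmetric] by (rule bounded_subset) (rule image_mono, auto)
  next
    case (local x)
    have R: "\<exists>d>0. \<exists>B. \<forall>y. x < y \<and> y < x + d \<and> y \<le> t \<longrightarrow> norm (\<gamma> y) \<le> B"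
    proof (cases "x < t")
      case True
      then have "(\<gamma> \<longlongrightarrow> \<gamma> x) (at_right x)"
        using assms local by (auto simp: cadlag_on_def)
      then have "\<forall>\<^sub>F y in at_right x. dist (\<gamma> y) (\<gamma> x) < 1"
        by (rule tendstoD) simp
      then obtain b where b: "b > x" "\<And>y. x < y \<Longrightarrow> y < b \<Longrightarrow> dist (\<gamma> y) (\<gamma> x) < 1"
        unfolding eventually_at_right_field by blast
      have "norm (\<gamma> y) \<le> 1 + norm (\<gamma> x)" if "x < y" "y < b" for y
        using b(2)[OF that] norm_triangle_ineq2[of "\<gamma> y" "\<gamma> x"] by (simp add: dist_norm)
      then show ?thesis
        using b(1) by (intro exI[of _ "b - x"]) auto
    next
      case False
      then show ?thesis by (intro exI[of _ 1]) auto
    qed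
    have L: "\<exists>d>0. \<exists>B. \<forall>y. x - d < y \<and> y < x \<and> 0 \<le> y \<longrightarrow> norm (\<gamma> y) \<le> B"
    proof (cases "0 < x")
      case True
      then obtain l where "(\<gamma> \<longlongrightarrow> l) (at_left x)"
        using assms local unfolding cadlag_on_def by (meson greaterThanAtMost_iff)
      then have "\<forall>\<^sub>F y in at_left x. dist (\<gamma> y) l < 1"
        by (rule tendstoD) simp
      then obtain b where b: "b < x" "\<And>y. b < y \<Longrightarrow> y < x \<Longrightarrow> dist (\<gamma> y) l < 1"
        unfolding eventually_at_left_field by blast
      have "norm (\<gamma> y) \<le> 1 + norm l" if "b < y" "y < x" for y
        using b(2)[OF that] norm_triangle_ineq2[of "\<gamma> y" l] by (simp add: dist_norm)
      then show ?thesis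
        using b(1) by (intro exI[of _ "x - b"]) auto
    next
      case False
      then show ?thesis by (intro exI[of _ 1]) auto
    qed
    obtain d1 B1 where 1: "d1 > 0" "\<And>y. x < y \<Longrightarrow> y < x + d1 \<Longrightarrow> y \<le> t \<Longrightarrow> norm (\<gamma> y) \<le> B1"
      using R by auto
    obtain d2 B2 where 2: "d2 > 0" "\<And>y. x - d2 < y \<Longrightarrow> y < x \<Longrightarrow> 0 \<le> y \<Longrightarrow> norm (\<gamma> y) \<le> B2"
      using L by auto
    have "P a b" if ab: "a \<le> x" "x \<le> b" "b - a < min d1 d2" for a b
    proof -
      have "norm (\<gamma> y) \<le> max (norm (\<gamma> x)) (max B1 B2)" if "y \<in> {a..b} \<inter> {0..t}" for y
        using 1(2)[of y] 2(2)[of y] ab that by (cases y x rule: linorder_cases) auto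
      then show ?thesis
        unfolding P_def bounded_iff by blast
    qed
    then show ?case
      using 1(1) 2(1) by (intro exI[of _ "min d1 d2"]) auto
  qed
  then show ?thesis by (simp add: P_def)
qed simp

text \<open>The type of all cadlag paths \<open>\<gamma>\<^sub>t\<close> with \<open>t \<ge> 0\<close>, as pairs \<open>(t, \<gamma>)\<close> of the final time
  and a function that is \<^const>\<open>undefined\<close> off \<open>{0..t}\<close>, so that equality is equality of paths
  on \<open>[0,t]\<close>. The horizon \<open>T\<close> enters only through the sets of paths below.\<close>

typedef 'n cadlag_path =
  "{(t :: real, \<gamma> :: real \<Rightarrow> real ^ ('n :: finite)).
      0 \<le> t \<and> \<gamma> \<in> extensional {0..t} \<and> cadlag_on t \<gamma>}"
  morphisms Rep_path Abs_path
proof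
  show "(0, restrict (\<lambda>_. 0) {0..0}) \<in> {(t :: real, \<gamma> :: real \<Rightarrow> real ^ 'n).
      0 \<le> t \<and> \<gamma> \<in> extensional {0..t} \<and> cadlag_on t \<gamma>}"
    by (auto simp: cadlag_on_def)
qed

setup_lifting type_definition_cadlag_path

lift_definition final_time :: "'n::finite cadlag_path \<Rightarrow> real" is fst .

lift_definition path_at :: "'n::finite cadlag_path \<Rightarrow> real \<Rightarrow> real ^ 'n" is snd .

text \<open>For \<open>s \<ge> t\<close> this is the continuation \<open>\<gamma>\<^sub>t\<^sub>,\<^sub>s\<close> of \<open>\<gamma>\<^sub>t\<close> by its final value; for
  \<open>0 \<le> s \<le> t\<close> it is the restriction of \<open>\<gamma>\<^sub>t\<close> to \<open>[0,s]\<close>.\<close>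

lift_definition resize :: "'n::finite cadlag_path \<Rightarrow> real \<Rightarrow> 'n cadlag_path"
  is "\<lambda>(t, \<gamma>) s. (max 0 s, restrict (\<lambda>r. \<gamma> (min r t)) {0..max 0 s})"
proof -
  fix p :: "real \<times> (real \<Rightarrow> real ^ 'n)" and s :: real
  assume "p \<in> {(t, \<gamma>). 0 \<le> t \<and> \<gamma> \<in> extensional {0..t} \<and> cadlag_on t \<gamma>}"
  then obtain t \<gamma> where p: "p = (t, \<gamma>)" "0 \<le> t" "cadlag_on t \<gamma>" by auto
  have "cadlag_on (max 0 s) (restrict (\<lambda>r. \<gamma> (min r t)) {0..max 0 s})"
    using cadlag_on_min[OF p(3,2), of "max 0 s"]
    by (rule iffD1[OF cadlag_on_cong, rotated]) simp
  then show "(case p of (t, \<gamma>) \<Rightarrow> \<lambda>s. (max 0 s, restrict (\<lambda>r. \<gamma> (min r t)) {0..max 0 s})) s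
      \<in> {(t, \<gamma>). 0 \<le> t \<and> \<gamma> \<in> extensional {0..t} \<and> cadlag_on t \<gamma>}"
    by (simp add: p(1))
qed

text \<open>The path \<open>\<gamma>\<^sub>t\<^sup>x\<close>, whose final value is moved by \<open>x\<close>.\<close>

lift_definition bump :: "'n::finite cadlag_path \<Rightarrow> real ^ 'n \<Rightarrow> 'n cadlag_path"
  is "\<lambda>(t, \<gamma>) x. (t, \<gamma>(t := \<gamma> t + x))"
  by (auto intro: cadlag_on_upd simp: extensional_def)

definition path_norm :: "'n::finite cadlag_path \<Rightarrow> real" where
  "path_norm p = (SUP s\<in>{0..final_time p}. norm (path_at p s))"

text \<open>The norm of the difference, for paths with the same final time.\<close>

definition path_diff_norm :: "'n::finite cadlag_path \<Rightarrow> 'n cadlag_path \<Rightarrow> real" where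
  "path_diff_norm p q = (SUP s\<in>{0..final_time p}. norm (path_at p s - path_at q s))"

lemma final_time_nonneg [simp]: "0 \<le> final_time p"
  by transfer auto

lemma cadlag_on_path_at: "cadlag_on (final_time p) (path_at p)"
  by transfer auto

lemma path_eqI:
  assumes "final_time p = final_time q"
    and "\<And>s. 0 \<le> s \<Longrightarrow> s \<le> final_time q \<Longrightarrow> path_at p s = path_at q s"
  shows "p = q"
  using assms by transfer (auto intro!: extensionalityI[where A = "{0.._}"])

lemma final_time_resize [simp]: "final_time (resize p s) = max 0 s"
  by transfer auto

lemma path_at_resize:
  "0 \<le> r \<Longrightarrow> r \<le> s \<Longrightarrow> path_at (resize p s) r = path_at p (min r (final_time p))"
  by transfer auto

lemma final_time_bump [simp]: "final_time (bump p x) = final_time p"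
  by transfer auto

lemma path_at_bump:
  "path_at (bump p x) = (path_at p)(final_time p := path_at p (final_time p) + x)"
  by transfer auto

text \<open>The distance \<open>d\<^sub>\<infinity>\<close>. Resizing both paths to the later of the two final times leaves the longer
  one unchanged and makes the definition symmetric.\<close>

instantiation cadlag_path :: (finite) metric_space
begin

definition dist_cadlag_path :: "'a cadlag_path \<Rightarrow> 'a cadlag_path \<Rightarrow> real" where
  "dist_cadlag_path p q = (let m = max (final_time p) (final_time q) in
     \<bar>final_time p - final_time q\<bar> + path_diff_norm (resize p m) (resize q m))"

definition uniformity_cadlag_path :: "('a cadlag_path \<times> 'a cadlag_path) filter" where
  "uniformity_cadlag_path = (INF e\<in>{0<..}. principal {(x, y). dist x y < e})"

definition open_cadlag_path :: "'a cadlag_path set \<Rightarrow> bool" where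
  "open_cadlag_path U \<longleftrightarrow> (\<forall>x\<in>U. eventually (\<lambda>(x', y). x' = x \<longrightarrow> y \<in> U) uniformity)"

instance
proof
  define e :: "'a cadlag_path \<Rightarrow> real \<Rightarrow> real ^ 'a"
    where "e p r = path_at p (min r (final_time p))" for p r
  define S where "S p q = (SUP r\<in>{0..}. norm (e p r - e q r))" for p q
  have d: "dist p q = \<bar>final_time p - final_time q\<bar> + S p q" for p q :: "'a cadlag_path"
  proof -
    define g where "g r = norm (e p r - e q r)" for r
    define m where "m = max (final_time p) (final_time q)"
    have m: "0 \<le> m" by (simp add: m_def le_max_iff_disj)
    have "g ` {0..} = g ` {0..m}"
    proof
      show "g ` {0..} \<subseteq> g ` {0..m}"
      proof
        fix y assume "y \<in> g ` {0..}"
        then obtain r where r: "r \<ge> 0" "y = g r" by auto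
        have "g r = g (min r m)" by (auto simp: g_def e_def m_def min_def)
        then show "y \<in> g ` {0..m}" using r m by auto
      qed
    qed auto
    moreover have "path_diff_norm (resize p m) (resize q m) = (SUP r\<in>{0..m}. g r)"
      using m by (auto simp: path_diff_norm_def g_def e_def path_at_resize intro!: SUP_cong)
    ultimately show ?thesis
      by (simp add: dist_cadlag_path_def Let_def m_def[symmetric] g_def S_def)
  qed
  have bdd: "bdd_above ((\<lambda>r. norm (e p r - e q r)) ` {0..})" for p q
  proof -
    have "\<exists>B. \<forall>r\<ge>0. norm (e p r) \<le> B" for p
    proof -
      obtain B where "\<forall>x\<in>path_at p ` {0..final_time p}. norm x \<le> B"
        using bounded_cadlag[OF cadlag_on_path_at] unfolding bounded_iff by blast
      then have "\<forall>r\<ge>0. norm (e p r) \<le> B"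
        by (auto simp: e_def)
      then show ?thesis ..
    qed
    then obtain B C where BC: "\<forall>r\<ge>0. norm (e p r) \<le> B" "\<forall>r\<ge>0. norm (e q r) \<le> C"
      by meson
    have "norm (e p r - e q r) \<le> B + C" if "r \<ge> 0" for r
      using BC that norm_triangle_ineq4[of "e p r" "e q r"] by (meson add_mono order_trans)
    then show ?thesis by (intro bdd_aboveI2) auto
  qed
  have up: "norm (e p r - e q r) \<le> S p q" if "r \<ge> 0" for p q r
    unfolding S_def using bdd that by (intro cSUP_upper) auto
  have nn: "0 \<le> S p q" for p q
    using up[of 0 p q] norm_ge_zero[of "e p 0 - e q 0"] by linarith
  fix p q z :: "'a cadlag_path"
  show "(dist p q = 0) = (p = q)"
  proof
    assume "dist p q = 0"
    then have ft: "final_time p = final_time q" and "S p q = 0"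
      using nn[of p q] by (auto simp: d)
    then have eq: "e p r = e q r" if "r \<ge> 0" for r
      using up[OF that, of p q] by simp
    show "p = q"
    proof (rule path_eqI[OF ft])
      fix s assume "0 \<le> s" "s \<le> final_time q"
      then show "path_at p s = path_at q s"
        using eq[of s] ft by (simp add: e_def)
    qed
  qed (simp add: d S_def)
  have "S p q \<le> S p z + S q z"
    unfolding S_def[of p q]
  proof (rule cSUP_least)
    fix r :: real assume "r \<in> {0..}"
    then show "norm (e p r - e q r) \<le> S p z + S q z"
      using up[of r p z] up[of r q z] norm_triangle_ineq4[of "e p r - e z r" "e q r - e z r"]
      by auto
  qed auto
  then show "dist p q \<le> dist p z + dist q z"
    by (auto simp: d)
qed (simp_all add: uniformity_cadlag_path_def open_cadlag_path_def)

end

text \<open>\<open>cadlag_paths T t\<close> and \<open>cont_paths T t\<close> are the paths with final time in \<open>[t,T]\<close>; the ones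
  with final time exactly \<open>t\<close> are \<open>cont_paths t t\<close>.\<close>

definition cadlag_paths :: "real \<Rightarrow> real \<Rightarrow> 'n::finite cadlag_path set" where
  "cadlag_paths T t = {p. final_time p \<in> {t..T}}"

definition cont_paths :: "real \<Rightarrow> real \<Rightarrow> 'n::finite cadlag_path set" where
  "cont_paths T t = {p \<in> cadlag_paths T t. continuous_on {0..final_time p} (path_at p)}"

section \<open>Horizontal and vertical derivatives\<close>

text \<open>Values of functionals outside the path set under consideration never matter: the limits below
  only see paths with final time in \<open>[t,T]\<close> when \<open>t < T\<close>. For \<open>t = T\<close> the left limit at \<open>T\<close> would
  leave \<open>cadlag_paths T t\<close>, but only \<open>t < T\<close> is used for viscosity solutions.\<close>

definition has_right_deriv :: "('n::finite cadlag_path \<Rightarrow> real) \<Rightarrow> 'n cadlag_path \<Rightarrow> real \<Rightarrow> bool"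
  where
  "has_right_deriv f p D \<longleftrightarrow>
     ((\<lambda>h. (f (resize p (final_time p + h)) - f p) / h) \<longlongrightarrow> D) (at_right 0)"

definition has_horizontal_deriv ::
    "real \<Rightarrow> ('n::finite cadlag_path \<Rightarrow> real) \<Rightarrow> 'n cadlag_path \<Rightarrow> real \<Rightarrow> bool" where
  "has_horizontal_deriv T f p D \<longleftrightarrow>
     (if final_time p < T then has_right_deriv f p D
      else \<exists>g. (\<forall>\<^sub>F s in at_left T. has_right_deriv f (resize p s) (g s)) \<and>
               (g \<longlongrightarrow> D) (at_left T))"

definition has_vertical_deriv ::
    "('n::finite cadlag_path \<Rightarrow> real) \<Rightarrow> 'n cadlag_path \<Rightarrow> 'n \<Rightarrow> real \<Rightarrow> bool" where
  "has_vertical_deriv f p i D \<longleftrightarrow>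
     ((\<lambda>h. (f (bump p (h *\<^sub>R axis i 1)) - f p) / h) \<longlongrightarrow> D) (at 0)"

definition horizontal_deriv :: "real \<Rightarrow> ('n::finite cadlag_path \<Rightarrow> real) \<Rightarrow> 'n cadlag_path \<Rightarrow> real"
  where
  "horizontal_deriv T f p = (THE D. has_horizontal_deriv T f p D)"

definition vertical_gradient :: "('n::finite cadlag_path \<Rightarrow> real) \<Rightarrow> 'n cadlag_path \<Rightarrow> real ^ 'n"
  where
  "vertical_gradient f p = (\<chi> i. THE D. has_vertical_deriv f p i D)"

lemma has_horizontal_deriv_unique:
  assumes "has_horizontal_deriv T f p D" "has_horizontal_deriv T f p D'"
  shows "D = D'"
proof (cases "final_time p < T")
  case True
  then show ?thesis
    using assms tendsto_unique[OF trivial_limit_at_right_real]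
    by (auto simp: has_horizontal_deriv_def has_right_deriv_def)
next
  case False
  then obtain g g' where
    g: "\<forall>\<^sub>F s in at_left T. has_right_deriv f (resize p s) (g s)" "(g \<longlongrightarrow> D) (at_left T)" and
    g': "\<forall>\<^sub>F s in at_left T. has_right_deriv f (resize p s) (g' s)" "(g' \<longlongrightarrow> D') (at_left T)"
    using assms by (auto simp: has_horizontal_deriv_def)
  have "\<forall>\<^sub>F s in at_left T. g s = g' s"
    using g(1) g'(1)
    by eventually_elim
      (auto simp: has_right_deriv_def intro: tendsto_unique[OF trivial_limit_at_right_real])
  then have "(g' \<longlongrightarrow> D) (at_left T)"
    using g(2) by (auto intro: Lim_transform_eventually)
  then show ?thesis
    using g'(2) tendsto_unique[OF trivial_limit_at_left_real] by blast
qed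

lemma horizontal_deriv_eqI: "has_horizontal_deriv T f p D \<Longrightarrow> horizontal_deriv T f p = D"
  unfolding horizontal_deriv_def using has_horizontal_deriv_unique by blast

lemma vertical_gradient_eqI:
  assumes "\<And>i. has_vertical_deriv f p i (v $ i)"
  shows "vertical_gradient f p = v"
proof -
  have "(THE D. has_vertical_deriv f p i D) = v $ i" for i
    using assms[of i] by (auto simp: has_vertical_deriv_def intro: LIM_unique)
  then show ?thesis
    by (simp add: vertical_gradient_def vec_eq_iff)
qed

definition C1_cadlag :: "real \<Rightarrow> real \<Rightarrow> ('n::finite cadlag_path \<Rightarrow> real) set" where
  "C1_cadlag T t = {f.
     continuous_on (cadlag_paths T t) f \<and>
     (\<forall>p\<in>cadlag_paths T t. \<exists>D. has_horizontal_deriv T f p D) \<and>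
     (\<forall>p\<in>cadlag_paths T t. \<forall>i. \<exists>D. has_vertical_deriv f p i D) \<and>
     continuous_on (cadlag_paths T t) (horizontal_deriv T f) \<and>
     (\<forall>i. continuous_on (cadlag_paths T t) (\<lambda>p. vertical_gradient f p $ i))}"

definition C1_extension ::
    "real \<Rightarrow> real \<Rightarrow> ('n::finite cadlag_path \<Rightarrow> real) \<Rightarrow> ('n cadlag_path \<Rightarrow> real) \<Rightarrow> bool" where
  "C1_extension T t \<phi> f \<longleftrightarrow> f \<in> C1_cadlag T t \<and> (\<forall>p\<in>cont_paths T t. f p = \<phi> p)"

definition C1_cont :: "real \<Rightarrow> real \<Rightarrow> ('n::finite cadlag_path \<Rightarrow> real) set" where
  "C1_cont T t = {\<phi>. \<exists>f. C1_extension T t \<phi> f}"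

section \<open>Viscosity solutions\<close>

text \<open>The Lipschitz bound is spelled out for all difference quotients, because a supremum in
  \<^typ>\<open>real\<close> is only meaningful for bounded sets.\<close>

definition lipschitz_paths :: "real \<Rightarrow> real \<Rightarrow> real \<Rightarrow> real \<Rightarrow> 'n::finite cadlag_path set" where
  "lipschitz_paths T t \<mu> M = {p \<in> cont_paths T t.
     path_norm p \<le> M \<and>
     (\<forall>l r. 0 \<le> l \<and> l < r \<and> r \<le> final_time p \<longrightarrow>
        norm (path_at p l - path_at p r) / \<bar>l - r\<bar> \<le> \<mu> * (1 + M))}"

definition J_plus :: "real \<Rightarrow> real \<Rightarrow> real \<Rightarrow> 'n::finite cadlag_path \<Rightarrow> ('n cadlag_path \<Rightarrow> real) \<Rightarrow>
    ('n cadlag_path \<Rightarrow> real) set" where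
  "J_plus T \<mu> M p w = {\<phi> \<in> C1_cont T (final_time p).
     w p - \<phi> p = 0 \<and>
     (SUP \<eta>\<in>lipschitz_paths T (final_time p) \<mu> M. ereal (w \<eta> - \<phi> \<eta>)) = 0}"

definition J_minus :: "real \<Rightarrow> real \<Rightarrow> real \<Rightarrow> 'n::finite cadlag_path \<Rightarrow> ('n cadlag_path \<Rightarrow> real) \<Rightarrow>
    ('n cadlag_path \<Rightarrow> real) set" where
  "J_minus T \<mu> M p w = {\<phi> \<in> C1_cont T (final_time p).
     w p + \<phi> p = 0 \<and>
     (INF \<eta>\<in>lipschitz_paths T (final_time p) \<mu> M. ereal (w \<eta> + \<phi> \<eta>)) = 0}"

text \<open>The derivatives of a test function are those of a \<open>C\<^sup>1\<close> extension of it to cadlag paths.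
  They do not depend on the extension, so the definitions below ask for the inequality for every
  extension.\<close>

definition viscosity_mu_subsolution ::
    "real \<Rightarrow> ('n::finite cadlag_path \<Rightarrow> real ^ 'n \<Rightarrow> real) \<Rightarrow> ('n cadlag_path \<Rightarrow> real) \<Rightarrow>
     real \<Rightarrow> ('n cadlag_path \<Rightarrow> real) \<Rightarrow> bool" where
  "viscosity_mu_subsolution T H \<phi> \<mu> w \<longleftrightarrow>
     continuous_on (cont_paths T 0) w \<and>
     (\<forall>p\<in>cont_paths T T. w p \<le> \<phi> p) \<and>
     (\<forall>M>0. \<forall>p\<in>lipschitz_paths T 0 \<mu> M.
        final_time p < T \<and> norm (path_at p (final_time p)) < M \<longrightarrow>
        (\<forall>\<psi>\<in>J_plus T \<mu> M p w. \<forall>f. C1_extension T (final_time p) \<psi> f \<longrightarrow>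
           horizontal_deriv T f p + H p (vertical_gradient f p) \<ge> 0))"

definition viscosity_mu_supersolution ::
    "real \<Rightarrow> ('n::finite cadlag_path \<Rightarrow> real ^ 'n \<Rightarrow> real) \<Rightarrow> ('n cadlag_path \<Rightarrow> real) \<Rightarrow>
     real \<Rightarrow> ('n cadlag_path \<Rightarrow> real) \<Rightarrow> bool" where
  "viscosity_mu_supersolution T H \<phi> \<mu> w \<longleftrightarrow>
     continuous_on (cont_paths T 0) w \<and>
     (\<forall>p\<in>cont_paths T T. w p \<ge> \<phi> p) \<and>
     (\<forall>M>0. \<forall>p\<in>lipschitz_paths T 0 \<mu> M.
        final_time p < T \<and> norm (path_at p (final_time p)) < M \<longrightarrow>
        (\<forall>\<psi>\<in>J_minus T \<mu> M p w. \<forall>f. C1_extension T (final_time p) \<psi> f \<longrightarrow>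
           - horizontal_deriv T f p + H p (- vertical_gradient f p) \<le> 0))"

definition viscosity_subsolution ::
    "real \<Rightarrow> ('n::finite cadlag_path \<Rightarrow> real ^ 'n \<Rightarrow> real) \<Rightarrow> ('n cadlag_path \<Rightarrow> real) \<Rightarrow>
     ('n cadlag_path \<Rightarrow> real) \<Rightarrow> bool" where
  "viscosity_subsolution T H \<phi> w \<longleftrightarrow> (\<exists>\<mu>\<^sub>0>0. \<forall>\<mu>\<ge>\<mu>\<^sub>0. viscosity_mu_subsolution T H \<phi> \<mu> w)"

definition viscosity_supersolution ::
    "real \<Rightarrow> ('n::finite cadlag_path \<Rightarrow> real ^ 'n \<Rightarrow> real) \<Rightarrow> ('n cadlag_path \<Rightarrow> real) \<Rightarrow>
     ('n cadlag_path \<Rightarrow> real) \<Rightarrow> bool" where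
  "viscosity_supersolution T H \<phi> w \<longleftrightarrow> (\<exists>\<mu>\<^sub>0>0. \<forall>\<mu>\<ge>\<mu>\<^sub>0. viscosity_mu_supersolution T H \<phi> \<mu> w)"

section \<open>The Hamilton-Jacobi-Bellman equation\<close>

definition hamiltonian ::
    "('n::finite cadlag_path \<Rightarrow> 'u \<Rightarrow> real ^ 'n) \<Rightarrow> ('n cadlag_path \<Rightarrow> 'u \<Rightarrow> real) \<Rightarrow>
     'n cadlag_path \<Rightarrow> real ^ 'n \<Rightarrow> real" where
  "hamiltonian F q p v = (INF u. v \<bullet> F p u + q p u)"

definition hypothesis_H ::
    "real \<Rightarrow> ('n::finite cadlag_path \<Rightarrow> 'u::metric_space \<Rightarrow> real ^ 'n) \<Rightarrow>
     ('n cadlag_path \<Rightarrow> 'u \<Rightarrow> real) \<Rightarrow> ('n cadlag_path \<Rightarrow> real) \<Rightarrow> bool" where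
  "hypothesis_H T F q \<phi> \<longleftrightarrow>
     continuous_on (cont_paths T 0 \<times> UNIV) (\<lambda>(p, u). F p u) \<and>
     continuous_on (cont_paths T 0 \<times> UNIV) (\<lambda>(p, u). q p u) \<and>
     continuous_on (cont_paths T T) \<phi> \<and>
     (\<exists>L>0.
        (\<forall>t\<in>{0..T}. \<forall>p\<in>cont_paths t t. \<forall>p'\<in>cont_paths t t. \<forall>u.
           max (norm (F p u - F p' u)) \<bar>q p u - q p' u\<bar> \<le> L * path_diff_norm p p' \<and>
           max (norm (F p u)) \<bar>q p u\<bar> \<le> L * (1 + path_norm p)) \<and>
        (\<forall>\<eta>\<in>cont_paths T T. \<forall>\<eta>'\<in>cont_paths T T.
           \<bar>\<phi> \<eta> - \<phi> \<eta>'\<bar> \<le> L * path_diff_norm \<eta> \<eta>' \<and>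
           \<bar>\<phi> \<eta>\<bar> \<le> L * (1 + path_norm \<eta>)))"

end

theory Submission
  imports Defs "HOL-Complex_Analysis.Great_Picard"
begin

text \<open>The test functionals are the squared mean distance
  \<open>\<integral>\<^sub>0\<^sup>T\<^sup>+\<^sup>1 |\<gamma>(r \<and> t) - Y(r \<and> t)|\<^sup>2 dr\<close> to a fixed path \<open>Y\<close> and functions of time. On paths with
  a common Lipschitz constant the mean distance controls the uniform distance \<open>D\<close> up to a cubic loss,
  \<open>D\<^sup>3 \<le> C g\<close>, which is good enough for the doubling of variables: with the penalty \<open>\<beta> g\<close> the product of
  \<open>D\<close> with the gradient of the penalty still tends to 0 as \<open>\<beta> \<rightarrow> \<infinity>\<close>.

  Time is not doubled. For a fixed control \<open>u\<close>, \<open>W1\<close> plus the running cost is nondecreasing along the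
  solution of \<open>X' = F(X, u)\<close>; this is the comparison of \<open>W1\<close> with a single path and needs only
  continuity of \<open>F(\<cdot>, u)\<close>. At a maximum of \<open>W1(\<gamma>\<^sub>t) - W2(\<eta>\<^sub>t) - \<beta> g(\<gamma>\<^sub>t, \<eta>\<^sub>t)\<close> minus a barrier one picks a control that is
  nearly optimal for \<open>\<eta>\<^sub>t\<close>, moves \<open>\<gamma>\<^sub>t\<close> along it, and obtains a test functional for \<open>W2\<close> at \<open>\<eta>\<^sub>t\<close>. The barrier
  works on time intervals whose length depends only on \<open>L\<close>, so the comparison proceeds backwards from
  \<open>T\<close> in finitely many steps.\<close>

section \<open>Paths as functions on the real line\<close>

text \<open>The uniform norm is not vertically differentiable, so it cannot be the penalty. The mean
  square is: every path is read as its constant extension \<open>frozen p\<close>, which freezing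
  leaves unchanged, and is integrated over a fixed interval. The price is that the data are
  Lipschitz in the uniform norm. The cube appears because a C-Lipschitz difference of height D stays
  above D/2 on an interval of length D/(2 C). The Lipschitz bounds on W1 and W2 repay this loss:
  comparing a maximum with a pair of equal paths gives \<beta> g \<le> K D, hence a bound on \<beta>
  D^2.

  Doubling time fails because U need not be compact: F(., u) and q(., u) have no modulus of
  continuity in time that is uniform in u. Therefore the control is fixed first and the length of
  the time step is chosen afterwards, depending on it.

  Slopes up to \<mu> (1 + R) with \<mu> \<ge> L cover the speed L (1 + R), so controlled motion
  inside the ball of radius R stays in a compact class of paths. Contact points must lie strictly
  inside that ball to be tested, which is the purpose of the barrier.\<close>

definition frozen :: "'n::finite cadlag_path \<Rightarrow> real \<Rightarrow> real ^ 'n" where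
  "frozen p r = path_at p (max 0 (min r (final_time p)))"

text \<open>One function on the line yields a path for every final time, so a reference path can be
  carried along in time. \<open>Abs_path\<close> is meaningful only for t \<ge> 0 and a cadlag
  restriction, whence the continuity assumptions in the lemmas.\<close>

definition mk_path :: "real \<Rightarrow> (real \<Rightarrow> real ^ 'n) \<Rightarrow> 'n::finite cadlag_path" where
  "mk_path t g = Abs_path (t, restrict g {0..t})"

lemma frozen_eq: "0 \<le> r \<Longrightarrow> r \<le> final_time p \<Longrightarrow> frozen p r = path_at p r"
  by (simp add: frozen_def)

lemma frozen_final: "final_time p \<le> r \<Longrightarrow> frozen p r = path_at p (final_time p)"
  by (simp add: frozen_def)

lemma Rep_mk_path:
  assumes "0 \<le> t" "continuous_on {0..t} g"
  shows "Rep_path (mk_path t g) = (t, restrict g {0..t})"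
proof -
  have "cadlag_on t (restrict g {0..t})"
    using continuous_on_imp_cadlag_on[OF assms(2)]
    by (rule iffD1[OF cadlag_on_cong, rotated]) simp
  then show ?thesis
    unfolding mk_path_def using assms by (intro Abs_path_inverse) auto
qed

lemma final_time_mk_path [simp]:
  "0 \<le> t \<Longrightarrow> continuous_on {0..t} g \<Longrightarrow> final_time (mk_path t g) = t"
  by (simp add: final_time.rep_eq Rep_mk_path)

lemma path_at_mk_path:
  "continuous_on {0..t} g \<Longrightarrow> 0 \<le> r \<Longrightarrow> r \<le> t \<Longrightarrow> path_at (mk_path t g) r = g r"
  by (simp add: path_at.rep_eq Rep_mk_path)

lemma frozen_mk_path:
  "0 \<le> t \<Longrightarrow> continuous_on {0..t} g \<Longrightarrow> frozen (mk_path t g) r = g (max 0 (min r t))"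
  by (simp add: frozen_def path_at_mk_path)

lemma cont_pathsI:
  assumes "s \<le> final_time p" "final_time p \<le> T" "continuous_on {0..final_time p} (path_at p)"
  shows "p \<in> cont_paths T s"
  using assms by (simp add: cont_paths_def cadlag_paths_def)

lemma cont_paths_final_time: "p \<in> cont_paths T s \<Longrightarrow> s \<le> final_time p \<and> final_time p \<le> T"
  by (simp add: cont_paths_def cadlag_paths_def)

lemma mk_path_cont_paths:
  assumes "s \<le> t" "0 \<le> t" "t \<le> T" "continuous_on {0..t} g"
  shows "mk_path t g \<in> cont_paths T s"
proof (rule cont_pathsI)
  show "continuous_on {0..final_time (mk_path t g)} (path_at (mk_path t g))"
    using assms continuous_on_cong[of "{0..t}" "{0..t}" "path_at (mk_path t g)" g]
    by (simp add: path_at_mk_path)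
qed (use assms in auto)

lemma continuous_on_frozen:
  assumes "p \<in> cont_paths T s"
  shows "continuous_on A (frozen p)"
proof -
  have "continuous_on {0..final_time p} (path_at p)"
    using assms by (simp add: cont_paths_def)
  then have "continuous_on UNIV (\<lambda>r. path_at p (max 0 (min r (final_time p))))"
    by (rule continuous_on_compose2) (auto intro!: continuous_intros)
  then show ?thesis
    unfolding frozen_def[abs_def] by (rule continuous_on_subset) simp
qed

lemma mk_path_frozen:
  assumes "p \<in> cont_paths T s"
  shows "mk_path (final_time p) (frozen p) = p"
  using continuous_on_frozen[OF assms]
  by (intro path_eqI) (auto simp: path_at_mk_path frozen_eq)

section \<open>Norm and distance in terms of the constant extensions\<close>

lemma norm_path_at_le:
  assumes "0 \<le> r" "r \<le> final_time p"
  shows "norm (path_at p r) \<le> path_norm p"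
proof -
  have "bounded (path_at p ` {0..final_time p})"
    by (rule bounded_cadlag[OF cadlag_on_path_at])
  then have "bdd_above ((\<lambda>s. norm (path_at p s)) ` {0..final_time p})"
    by (auto simp: bounded_iff bdd_above_def)
  then show ?thesis
    unfolding path_norm_def using assms by (intro cSUP_upper) auto
qed

lemma norm_frozen_le: "norm (frozen p r) \<le> path_norm p"
  unfolding frozen_def by (rule norm_path_at_le) auto

lemma path_norm_nonneg: "0 \<le> path_norm p"
  using norm_frozen_le[of p 0] norm_ge_zero[of "frozen p 0"] by linarith

lemma path_norm_leI:
  assumes "\<And>r. 0 \<le> r \<Longrightarrow> r \<le> final_time p \<Longrightarrow> norm (path_at p r) \<le> M"
  shows "path_norm p \<le> M"
  unfolding path_norm_def using assms by (intro cSUP_least) auto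

lemma dist_path_eq:
  "dist p q = \<bar>final_time p - final_time q\<bar> +
     (SUP s\<in>{0..max (final_time p) (final_time q)}. norm (frozen p s - frozen q s))"
proof -
  define m where "m = max (final_time p) (final_time q)"
  have [simp]: "0 \<le> m" by (simp add: m_def le_max_iff_disj)
  have "path_diff_norm (resize p m) (resize q m) = (SUP s\<in>{0..m}. norm (frozen p s - frozen q s))"
    unfolding path_diff_norm_def
    by (intro SUP_cong) (auto simp: path_at_resize frozen_def)
  then show ?thesis
    by (simp add: dist_cadlag_path_def m_def Let_def)
qed

text \<open>Clamping r to [0, m], with m the later final time, changes neither extension, so the
  supremum over [0, m] already bounds the difference at every real r.\<close>

lemma dist_frozen_le: "\<bar>final_time p - final_time q\<bar> + norm (frozen p r - frozen q r) \<le> dist p q"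
proof -
  define m where "m = max (final_time p) (final_time q)"
  have m0: "0 \<le> m" by (simp add: m_def le_max_iff_disj)
  define g where "g s = norm (frozen p s - frozen q s)" for s
  have "g s \<le> path_norm p + path_norm q" for s
    unfolding g_def using norm_frozen_le[of p s] norm_frozen_le[of q s]
      norm_triangle_ineq4[of "frozen p s" "frozen q s"] by linarith
  then have bdd: "bdd_above (g ` {0..m})" by (intro bdd_aboveI2)
  have "g r = g (max 0 (min r m))"
  proof -
    have "max 0 (min r (final_time z)) = max 0 (min (max 0 (min r m)) (final_time z))"
      if "final_time z \<le> m" for z :: "'a cadlag_path"
      using that m0 final_time_nonneg[of z] by (auto simp: max_def min_def not_le simp del: final_time_nonneg)
    then have "frozen p r = frozen p (max 0 (min r m))" "frozen q r = frozen q (max 0 (min r m))"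
      unfolding frozen_def by (simp_all add: m_def)
    then show ?thesis by (simp add: g_def)
  qed
  moreover have "max 0 (min r m) \<in> {0..m}" by (auto simp: m_def le_max_iff_disj)
  then have "g (max 0 (min r m)) \<le> (SUP s\<in>{0..m}. g s)"
    using bdd by (rule cSUP_upper)
  ultimately show ?thesis
    by (simp add: dist_path_eq g_def m_def)
qed

lemma norm_frozen_diff_le: "norm (frozen p r - frozen q r) \<le> dist p q"
  using dist_frozen_le[of p q r] by linarith

lemma final_time_dist_le: "\<bar>final_time p - final_time q\<bar> \<le> dist p q"
  using dist_frozen_le[of p q 0] norm_ge_zero[of "frozen p 0 - frozen q 0"] by linarith

lemma dist_path_leI:
  assumes "\<And>r. 0 \<le> r \<Longrightarrow> r \<le> max (final_time p) (final_time q) \<Longrightarrow> norm (frozen p r - frozen q r) \<le> e"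
  shows "dist p q \<le> \<bar>final_time p - final_time q\<bar> + e"
  unfolding dist_path_eq using assms
  by (intro add_left_mono cSUP_least) (auto simp: le_max_iff_disj)

lemma path_diff_norm_eq_dist:
  assumes "final_time p = final_time q"
  shows "path_diff_norm p q = dist p q"
  unfolding path_diff_norm_def dist_path_eq using assms
  by (auto intro!: SUP_cong simp: frozen_eq)

lemma continuous_on_final_time: "continuous_on A final_time"
  unfolding continuous_on_iff
proof (intro ballI allI impI)
  fix x :: "'a cadlag_path" and e :: real assume "e > 0"
  then show "\<exists>d>0. \<forall>x'\<in>A. dist x' x < d \<longrightarrow> dist (final_time x') (final_time x) < e"
    by (intro exI[of _ e]) (auto simp: dist_real_def intro: order_le_less_trans[OF final_time_dist_le])
qed

lemma continuous_on_frozen_at: "continuous_on A (\<lambda>p. frozen p r)"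
  unfolding continuous_on_iff
proof (intro ballI allI impI)
  fix x :: "'a cadlag_path" and e :: real assume "e > 0"
  then show "\<exists>d>0. \<forall>x'\<in>A. dist x' x < d \<longrightarrow> dist (frozen x' r) (frozen x r) < e"
    by (intro exI[of _ e]) (auto simp: dist_norm intro: order_le_less_trans[OF norm_frozen_diff_le])
qed

lemma tendsto_mk_path:
  assumes "continuous_on {0..} g" "0 \<le> t"
  shows "\<forall>e>0. \<exists>d>0. \<forall>s\<ge>0. \<bar>s - t\<bar> < d \<longrightarrow> dist (mk_path s g) (mk_path t g) < e"
proof (intro allI impI)
  fix e :: real assume "e > 0"
  have cg: "continuous_on {0..s} g" for s
    using assms(1) by (rule continuous_on_subset) auto
  have "uniformly_continuous_on {0..t+1} g"
    using cg by (rule compact_uniformly_continuous) simp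
  then obtain d where d: "d > 0" "\<And>r r'. r \<in> {0..t+1} \<Longrightarrow> r' \<in> {0..t+1} \<Longrightarrow> dist r' r < d \<Longrightarrow> dist (g r') (g r) < e/2"
    unfolding uniformly_continuous_on_def using \<open>e > 0\<close> by (metis half_gt_zero)
  have "dist (mk_path s g) (mk_path t g) < e" if "s \<ge> 0" "\<bar>s - t\<bar> < min (min d 1) (e/2)" for s
  proof -
    have "dist (mk_path s g) (mk_path t g) \<le> \<bar>s - t\<bar> + e/2"
    proof (rule order_trans[OF dist_path_leI])
      fix r assume "0 \<le> r" "r \<le> max (final_time (mk_path s g)) (final_time (mk_path t g))"
      then have "dist (g (max 0 (min r s))) (g (max 0 (min r t))) < e/2"
        using that assms cg by (intro d(2)) (auto simp: dist_real_def)
      then show "norm (frozen (mk_path s g) r - frozen (mk_path t g) r) \<le> e/2"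
        using that assms cg by (simp add: frozen_mk_path dist_norm)
    qed (use that assms cg in auto)
    then show ?thesis using that by linarith
  qed
  then show "\<exists>d>0. \<forall>s\<ge>0. \<bar>s - t\<bar> < d \<longrightarrow> dist (mk_path s g) (mk_path t g) < e"
    using d(1) \<open>e > 0\<close> by (intro exI[of _ "min (min d 1) (e/2)"]) auto
qed

lemma continuous_on_mk_path:
  assumes "continuous_on {0..} g" "A \<subseteq> {0..}"
  shows "continuous_on A (\<lambda>t. mk_path t g)"
  unfolding continuous_on_iff
proof (intro ballI allI impI)
  fix x e :: real assume x: "x \<in> A" "e > 0"
  then obtain d where "d > 0" "\<forall>s\<ge>0. \<bar>s - x\<bar> < d \<longrightarrow> dist (mk_path s g) (mk_path x g) < e"
    using tendsto_mk_path[OF assms(1), of x] assms(2) by fastforce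
  then show "\<exists>d>0. \<forall>x'\<in>A. dist x' x < d \<longrightarrow> dist (mk_path x' g) (mk_path x g) < e"
    using assms(2) by (intro exI[of _ d]) (auto simp: dist_real_def subset_iff)
qed

section \<open>Integrability of functions with one-sided limits\<close>

text \<open>Test functionals live on cadlag paths, so the integrand may jump. Bisection shows that a
  function with one-sided limits is uniformly close to integrable ones: near each point it is almost
  constant on either side.\<close>

lemma integrable_regulated:
  fixes f :: "real \<Rightarrow> 'a::euclidean_space"
  assumes R: "\<And>s. \<exists>l. (f \<longlongrightarrow> l) (at_right s)" and L: "\<And>s. \<exists>l. (f \<longlongrightarrow> l) (at_left s)"
  shows "f integrable_on {a..b}"
proof (cases "a \<le> b")
  case True
  have "\<exists>g. (\<forall>x\<in>{a..b}. norm (f x - g x) \<le> e) \<and> g integrable_on {a..b}" if "e > 0" for e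
  proof -
    define P where "P a b \<longleftrightarrow> (\<exists>g. (\<forall>x\<in>{a..b}. norm (f x - g x) \<le> e) \<and> g integrable_on {a..b})" for a b
    have join: "P a c" if P: "P a b" "P b c" and ab: "a \<le> b" "b \<le> c" for a b c
    proof -
      obtain g h where g: "\<forall>x\<in>{a..b}. norm (f x - g x) \<le> e" "g integrable_on {a..b}"
        and h: "\<forall>x\<in>{b..c}. norm (f x - h x) \<le> e" "h integrable_on {b..c}"
        using P unfolding P_def by blast
      define k where "k x = (if x \<le> b then g x else h x)" for x
      have "k integrable_on {a..b}"
        using g(2) by (rule integrable_eq) (auto simp: k_def)
      moreover have "k integrable_on {b..c}"
        using h(2) by (rule integrable_spike_finite[where S = "{b}", rotated 2]) (auto simp: k_def)
      ultimately have "k integrable_on {a..c}"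
        using ab Henstock_Kurzweil_Integration.integrable_combine by blast
      then show ?thesis
        unfolding P_def using g(1) h(1) by (intro exI[of _ k]) (auto simp: k_def)
    qed
    have const: "P a b" if "\<And>x. a < x \<Longrightarrow> x < b \<Longrightarrow> norm (f x - l) \<le> e" for a b l
    proof -
      \<comment> \<open>One-sided limits say nothing about the endpoints, so the approximant takes
        the values of f there.\<close>
      define k where "k x = (if x = a \<or> x = b then f x else l)" for x
      have "k integrable_on {a..b}"
        by (rule integrable_spike_finite[where S = "{a,b}" and f = "\<lambda>_. l"]) (auto simp: k_def)
      then show ?thesis
        unfolding P_def using that \<open>e > 0\<close> by (intro exI[of _ k]) (auto simp: k_def)
    qed
    have "P a b" using True
    proof (induction rule: Bolzano)
      case (trans a b c)
      then show ?case using join by blast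
    next
      case (local x)
      obtain l where "(f \<longlongrightarrow> l) (at_right x)" using R by blast
      then have "\<forall>\<^sub>F y in at_right x. dist (f y) l < e" using \<open>e > 0\<close> by (rule tendstoD)
      then obtain b1 where b1: "b1 > x" "\<And>y. x < y \<Longrightarrow> y < b1 \<Longrightarrow> norm (f y - l) < e"
        unfolding eventually_at_right_field dist_norm by blast
      obtain l' where "(f \<longlongrightarrow> l') (at_left x)" using L by blast
      then have "\<forall>\<^sub>F y in at_left x. dist (f y) l' < e" using \<open>e > 0\<close> by (rule tendstoD)
      then obtain b2 where b2: "b2 < x" "\<And>y. b2 < y \<Longrightarrow> y < x \<Longrightarrow> norm (f y - l') < e"
        unfolding eventually_at_left_field dist_norm by blast
      have "P c d" if "c \<le> x" "x \<le> d" "d - c < min (b1 - x) (x - b2)" for c d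
        using that b1 b2
        by (intro join[of c x d] const[of c x l'] const[of x d l]) (auto intro!: less_imp_le)
      then show ?case using b1(1) b2(1) by (intro exI[of _ "min (b1 - x) (x - b2)"]) auto
    qed
    then show ?thesis by (simp add: P_def)
  qed
  then show ?thesis
    using integrable_uniform_limit[of a b f] by auto
qed (simp add: integrable_on_empty)

lemma frozen_right_limit: "(frozen p \<longlongrightarrow> frozen p s) (at_right s)"
proof -
  let ?t = "final_time p"
  have "cadlag_on ?t (path_at p)" by (rule cadlag_on_path_at)
  consider "s < 0" | "0 \<le> s" "s < ?t" | "?t \<le> s" by linarith
  then show ?thesis
  proof cases
    case 1
    have "\<forall>\<^sub>F r in at_right s. frozen p s = frozen p r"
      using 1 unfolding eventually_at_right_field by (intro exI[of _ 0]) (auto simp: frozen_def)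
    then show ?thesis by (rule Lim_transform_eventually[OF tendsto_const])
  next
    case 2
    then have "(path_at p \<longlongrightarrow> path_at p s) (at_right s)"
      using cadlag_on_path_at[of p] by (auto simp: cadlag_on_def)
    moreover have "\<forall>\<^sub>F r in at_right s. path_at p r = frozen p r"
      using 2 unfolding eventually_at_right_field by (intro exI[of _ ?t]) (auto simp: frozen_def)
    ultimately show ?thesis using 2 by (simp add: frozen_eq Lim_transform_eventually)
  next
    case 3
    have "\<forall>\<^sub>F r in at_right s. frozen p s = frozen p r"
      using 3 unfolding eventually_at_right_field by (intro exI[of _ "s+1"]) (auto simp: frozen_def)
    then show ?thesis by (rule Lim_transform_eventually[OF tendsto_const])
  qed
qed

lemma frozen_left_limit: "\<exists>l. (frozen p \<longlongrightarrow> l) (at_left s)"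
proof -
  let ?t = "final_time p"
  consider "s \<le> 0" | "0 < s" "s \<le> ?t" | "?t < s" by linarith
  then show ?thesis
  proof cases
    case 1
    have "\<forall>\<^sub>F r in at_left s. frozen p s = frozen p r"
      using 1 unfolding eventually_at_left_field by (intro exI[of _ "s-1"]) (auto simp: frozen_def)
    then show ?thesis using Lim_transform_eventually[OF tendsto_const] by blast
  next
    case 2
    then obtain l where "(path_at p \<longlongrightarrow> l) (at_left s)"
      using cadlag_on_path_at[of p] unfolding cadlag_on_def by (meson greaterThanAtMost_iff)
    moreover have "\<forall>\<^sub>F r in at_left s. path_at p r = frozen p r"
      using 2 unfolding eventually_at_left_field by (intro exI[of _ 0]) (auto simp: frozen_def)
    ultimately show ?thesis by (auto intro: Lim_transform_eventually)
  next
    case 3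
    have "\<forall>\<^sub>F r in at_left s. frozen p s = frozen p r"
      using 3 unfolding eventually_at_left_field by (intro exI[of _ ?t]) (auto simp: frozen_def)
    then show ?thesis using Lim_transform_eventually[OF tendsto_const] by blast
  qed
qed

lemma integrable_sq_frozen_diff:
  "(\<lambda>r. (norm (frozen p r - frozen q r))\<^sup>2) integrable_on {a..b}"
proof (rule integrable_regulated)
  fix s
  show "\<exists>l. ((\<lambda>r. (norm (frozen p r - frozen q r))\<^sup>2) \<longlongrightarrow> l) (at_right s)"
    using frozen_right_limit[of p s] frozen_right_limit[of q s]
    by (intro exI) (rule tendsto_intros)+
  obtain l l' where "(frozen p \<longlongrightarrow> l) (at_left s)" "(frozen q \<longlongrightarrow> l') (at_left s)"
    using frozen_left_limit by metis
  then show "\<exists>l. ((\<lambda>r. (norm (frozen p r - frozen q r))\<^sup>2) \<longlongrightarrow> l) (at_left s)"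
    by (intro exI) (rule tendsto_intros)+
qed

section \<open>The squared distance of paths in the mean\<close>

definition sq_gap :: "real \<Rightarrow> 'n::finite cadlag_path \<Rightarrow> 'n cadlag_path \<Rightarrow> real" where
  "sq_gap T p q = integral {0..T+1} (\<lambda>r. (norm (frozen p r - frozen q r))\<^sup>2)"

lemma sq_gap_nonneg: "0 \<le> sq_gap T p q"
  unfolding sq_gap_def by (rule integral_nonneg[OF integrable_sq_frozen_diff]) auto

lemma sq_gap_self [simp]: "sq_gap T p p = 0"
  by (simp add: sq_gap_def)

lemma sq_gap_diff_le:
  assumes "0 \<le> T"
  shows "\<bar>sq_gap T p' q' - sq_gap T p q\<bar> \<le>
    (T + 1) * ((dist p' p + dist q' q) * (2 * (path_norm p + path_norm q) + (dist p' p + dist q' q)))"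
proof -
  define d where "d = dist p' p + dist q' q"
  define B where "B = path_norm p + path_norm q"
  have "\<bar>(norm (frozen p' r - frozen q' r))\<^sup>2 - (norm (frozen p r - frozen q r))\<^sup>2\<bar> \<le> d * (2 * B + d)" for r
  proof -
    define a where "a = frozen p' r - frozen q' r"
    define b where "b = frozen p r - frozen q r"
    have "norm (a - b) \<le> norm (frozen p' r - frozen p r) + norm (frozen q' r - frozen q r)"
      unfolding a_def b_def
      using norm_triangle_ineq4[of "frozen p' r - frozen p r" "frozen q' r - frozen q r"]
      by (simp add: algebra_simps)
    then have ab: "norm (a - b) \<le> d"
      using norm_frozen_diff_le[of p' r p] norm_frozen_diff_le[of q' r q] by (simp add: d_def)
    have b: "norm b \<le> B"
      unfolding b_def B_def using norm_frozen_le[of p r] norm_frozen_le[of q r]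
        norm_triangle_ineq4[of "frozen p r" "frozen q r"] by linarith
    have "\<bar>norm a - norm b\<bar> \<le> d"
      using norm_triangle_ineq3[of a b] ab by linarith
    moreover have "norm a + norm b \<le> 2 * B + d"
      using calculation b by linarith
    ultimately have "\<bar>norm a - norm b\<bar> * (norm a + norm b) \<le> d * (2 * B + d)"
      by (intro mult_mono) auto
    moreover have "\<bar>(norm a)\<^sup>2 - (norm b)\<^sup>2\<bar> = \<bar>norm a - norm b\<bar> * (norm a + norm b)"
    proof -
      have "(norm a)\<^sup>2 - (norm b)\<^sup>2 = (norm a - norm b) * (norm a + norm b)"
        by (simp add: power2_eq_square algebra_simps)
      then show ?thesis by (simp add: abs_mult)
    qed
    ultimately show ?thesis by (simp add: a_def b_def)
  qed
  then have "norm (integral {0..T+1} (\<lambda>r. (norm (frozen p' r - frozen q' r))\<^sup>2 - (norm (frozen p r - frozen q r))\<^sup>2))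
      \<le> integral {0..T+1} (\<lambda>r. d * (2 * B + d))"
    by (intro integral_norm_bound_integral integrable_diff integrable_sq_frozen_diff) auto
  then show ?thesis
    using assms by (simp add: sq_gap_def integral_diff integrable_sq_frozen_diff d_def B_def mult_ac)
qed

lemma continuous_on_sq_gap [continuous_intros]:
  assumes "0 \<le> T" "continuous_on A f" "continuous_on A g"
  shows "continuous_on A (\<lambda>x. sq_gap T (f x) (g x))"
  unfolding continuous_on_def
proof
  fix x assume x: "x \<in> A"
  define d where "d y = dist (f y) (f x) + dist (g y) (g x)" for y
  have "(f \<longlongrightarrow> f x) (at x within A)" "(g \<longlongrightarrow> g x) (at x within A)"
    using assms x by (auto simp: continuous_on_def)
  then have d: "(d \<longlongrightarrow> 0) (at x within A)"
    unfolding d_def by (auto intro!: tendsto_eq_intros)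
  have "((\<lambda>y. (T + 1) * (d y * (2 * (path_norm (f x) + path_norm (g x)) + d y))) \<longlongrightarrow> 0) (at x within A)"
    by (auto intro!: tendsto_eq_intros d)
  then have "((\<lambda>y. sq_gap T (f y) (g y) - sq_gap T (f x) (g x)) \<longlongrightarrow> 0) (at x within A)"
    by (rule Lim_null_comparison[rotated])
      (use sq_gap_diff_le[OF assms(1)] in \<open>auto simp: d_def intro!: always_eventually\<close>)
  then show "((\<lambda>y. sq_gap T (f y) (g y)) \<longlongrightarrow> sq_gap T (f x) (g x)) (at x within A)"
    by (simp add: LIM_zero_iff)
qed

text \<open>The interval of length 1 that \<^term>\<open>sq_gap T\<close> adds after the horizon leaves room to the
  right of every point at which the difference of the paths is large.\<close>

lemma cube_le_sq_gap:
  fixes p q :: "'n::finite cadlag_path"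
  assumes lip: "\<And>r s. norm ((frozen p r - frozen q r) - (frozen p s - frozen q s)) \<le> C * \<bar>r - s\<bar>"
    and r0: "0 \<le> r0" "r0 \<le> T" and C: "C > 0" and D: "norm (frozen p r0 - frozen q r0) \<le> 2 * C"
  shows "(norm (frozen p r0 - frozen q r0)) ^ 3 \<le> 8 * C * sq_gap T p q"
proof -
  define f where "f r = frozen p r - frozen q r" for r
  define D where "D = norm (f r0)"
  define l where "l = D / (2 * C)"
  have l: "0 \<le> l" "l \<le> 1" "C * l = D / 2"
    using C D by (auto simp: l_def D_def f_def divide_simps)
  have "(D / 2)\<^sup>2 \<le> (norm (f r))\<^sup>2" if "r \<in> {r0..r0+l}" for r
  proof (rule power_mono)
    have "norm (f r0 - f r) \<le> C * l"
      using lip[of r0 r] that C unfolding f_def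
      by (intro order_trans[OF lip] mult_left_mono) auto
    then show "D / 2 \<le> norm (f r)"
      using l(3) norm_triangle_ineq2[of "f r0" "f r"] unfolding D_def by linarith
  qed (simp add: D_def)
  then have "integral {r0..r0+l} (\<lambda>_. (D / 2)\<^sup>2) \<le> integral {r0..r0+l} (\<lambda>r. (norm (f r))\<^sup>2)"
    unfolding f_def by (intro integral_le integrable_sq_frozen_diff) auto
  also have "\<dots> \<le> integral {0..T+1} (\<lambda>r. (norm (f r))\<^sup>2)"
    unfolding f_def using r0 l by (intro integral_subset_le integrable_sq_frozen_diff) auto
  finally have "l * (D / 2)\<^sup>2 \<le> sq_gap T p q"
    using l(1) by (simp add: sq_gap_def f_def)
  then have "8 * C * (l * (D / 2)\<^sup>2) \<le> 8 * C * sq_gap T p q"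
    using C by (intro mult_left_mono) auto
  moreover have "8 * C * (l * (D / 2)\<^sup>2) = D ^ 3"
    using l(3) by (simp add: power2_eq_square power3_eq_cube field_simps)
  ultimately show ?thesis by (simp add: D_def f_def)
qed

lemma sq_gap_split:
  assumes t: "0 \<le> t" "t \<le> T"
    and e: "\<And>r. r \<ge> t \<Longrightarrow> frozen p r = x" "\<And>r. r \<ge> t \<Longrightarrow> frozen q r = y"
  shows "sq_gap T p q =
    integral {0..t} (\<lambda>r. (norm (frozen p r - frozen q r))\<^sup>2) + (T + 1 - t) * (norm (x - y))\<^sup>2"
proof -
  have "sq_gap T p q = integral {0..t} (\<lambda>r. (norm (frozen p r - frozen q r))\<^sup>2) +
      integral {t..T+1} (\<lambda>r. (norm (frozen p r - frozen q r))\<^sup>2)"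
    unfolding sq_gap_def using t
    by (intro Henstock_Kurzweil_Integration.integral_combine[symmetric] integrable_sq_frozen_diff) auto
  also have "integral {t..T+1} (\<lambda>r. (norm (frozen p r - frozen q r))\<^sup>2) = integral {t..T+1} (\<lambda>r. (norm (x - y))\<^sup>2)"
    using e by (intro integral_cong) auto
  finally show ?thesis using t by simp
qed

lemma final_sq_le_sq_gap:
  assumes "final_time p = t" "final_time q = t" "t \<le> T"
  shows "(T + 1 - t) * (norm (path_at p t - path_at q t))\<^sup>2 \<le> sq_gap T p q"
proof -
  have "0 \<le> t" using assms(1) final_time_nonneg[of p] by simp
  then have "sq_gap T p q =
    integral {0..t} (\<lambda>r. (norm (frozen p r - frozen q r))\<^sup>2) + (T + 1 - t) * (norm (path_at p t - path_at q t))\<^sup>2"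
    using assms by (intro sq_gap_split) (auto simp: frozen_def)
  moreover have "0 \<le> integral {0..t} (\<lambda>r. (norm (frozen p r - frozen q r))\<^sup>2)"
    by (rule integral_nonneg[OF integrable_sq_frozen_diff]) auto
  ultimately show ?thesis by linarith
qed

section \<open>Test functionals\<close>

text \<open>The reference path is cut at the final time of the argument, so it moves while the
  argument is frozen; this is how the velocity of Y enters the horizontal derivative.\<close>

definition gap_test :: "real \<Rightarrow> real \<Rightarrow> (real \<Rightarrow> real ^ 'n) \<Rightarrow> (real \<Rightarrow> real) \<Rightarrow> 'n::finite cadlag_path \<Rightarrow> real" where
  "gap_test T a Y \<rho> p = a * sq_gap T p (mk_path (final_time p) Y) + \<rho> (final_time p)"

text \<open>The left limit at \<open>T\<close> of a path continued by its final value. It differs from the final value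
  only for paths on \<open>[0,T]\<close> that jump at \<open>T\<close>; there the horizontal derivative of a functional
  depends on it.\<close>

definition end_limit :: "real \<Rightarrow> 'n::finite cadlag_path \<Rightarrow> real ^ 'n" where
  "end_limit T p = Lim (at_left T) (frozen p)"

lemma tendsto_end_limit: "(frozen p \<longlongrightarrow> end_limit T p) (at_left T)"
  using frozen_left_limit[of p T] unfolding end_limit_def
  by (metis tendsto_Lim trivial_limit_at_left_real)

lemma end_limit_eq:
  assumes "final_time p < T"
  shows "end_limit T p = path_at p (final_time p)"
proof -
  have "\<forall>\<^sub>F r in at_left T. path_at p (final_time p) = frozen p r"
    using assms unfolding eventually_at_left_field by (intro exI[of _ "final_time p"]) (auto simp: frozen_def)
  then have "(frozen p \<longlongrightarrow> path_at p (final_time p)) (at_left T)"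
    by (rule Lim_transform_eventually[OF tendsto_const])
  then show ?thesis
    using tendsto_end_limit tendsto_unique trivial_limit_at_left_real by blast
qed

lemma norm_end_limit_diff_le: "norm (end_limit T p - end_limit T q) \<le> dist p q"
proof (rule tendsto_upperbound)
  show "((\<lambda>r. norm (frozen p r - frozen q r)) \<longlongrightarrow> norm (end_limit T p - end_limit T q)) (at_left T)"
    by (intro tendsto_intros tendsto_end_limit)
qed (auto intro!: always_eventually norm_frozen_diff_le)

lemma continuous_on_end_limit: "continuous_on A (end_limit T)"
  unfolding continuous_on_iff
proof (intro ballI allI impI)
  fix x :: "'a cadlag_path" and e :: real assume "e > 0"
  then show "\<exists>d>0. \<forall>x'\<in>A. dist x' x < d \<longrightarrow> dist (end_limit T x') (end_limit T x) < e"
    by (intro exI[of _ e]) (auto simp: dist_norm intro: order_le_less_trans[OF norm_end_limit_diff_le])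
qed

section \<open>Derivatives of the test functionals\<close>

lemma has_right_derivI:
  assumes \<Phi>: "(\<Phi> has_real_derivative D) (at_right (final_time p))"
    and T: "final_time p < T" and eq: "\<And>s. final_time p \<le> s \<Longrightarrow> s < T \<Longrightarrow> f (resize p s) = \<Phi> s"
    and eq0: "f p = \<Phi> (final_time p)"
  shows "has_right_deriv f p D"
proof -
  define t where "t = final_time p"
  have "((\<lambda>s. (\<Phi> s - \<Phi> t) / (s - t)) \<longlongrightarrow> D) (at_right t)"
    using \<Phi> by (simp add: has_field_derivative_iff t_def)
  then have "((\<lambda>h. (\<Phi> (h + t) - \<Phi> t) / (h + t - t)) \<longlongrightarrow> D) (at_right 0)"
    by (subst (asm) filterlim_at_right_to_0)
  moreover have "\<forall>\<^sub>F h in at_right 0. (\<Phi> (h + t) - \<Phi> t) / (h + t - t) = (f (resize p (t + h)) - f p) / h"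
    using T unfolding eventually_at_right_field
    by (intro exI[of _ "T - t"]) (auto simp: t_def eq eq0 add.commute)
  ultimately show ?thesis
    unfolding has_right_deriv_def t_def by (rule Lim_transform_eventually)
qed

lemma frozen_resize: "final_time p \<le> s \<Longrightarrow> frozen (resize p s) r = frozen p r"
proof -
  assume s: "final_time p \<le> s"
  then have s0: "0 \<le> s" using final_time_nonneg[of p] by linarith
  have "min (max 0 (min r s)) (final_time p) = max 0 (min r (final_time p))"
    using s final_time_nonneg[of p] by linarith
  then show ?thesis using s0 by (simp add: frozen_def path_at_resize)
qed

text \<open>With p frozen at x, put g(s) = |x - Y(s)|^2. The gap is a constant plus the integral of
  g over [t, s] plus (T + 1 - s) g(s). The growth of the integral cancels the shrinking of the
  weight, and only (T + 1 - t) g'(t) is left.\<close>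

lemma has_right_deriv_gap_test:
  assumes t: "final_time p = t" "t < T"
    and cY: "continuous_on UNIV Y" and Y: "(Y has_vector_derivative y) (at_right t)"
    and \<rho>: "(\<rho> has_real_derivative \<rho>') (at_right t)"
  shows "has_right_deriv (gap_test T a Y \<rho>) p
    (\<rho>' - 2 * a * (T + 1 - t) * ((path_at p t - Y t) \<bullet> y))"
proof -
  define x where "x = path_at p t"
  define g where "g s = (norm (x - Y s))\<^sup>2" for s
  have t0: "0 \<le> t" using t final_time_nonneg[of p] by simp
  define I where "I = integral {0..t} (\<lambda>r. (norm (frozen p r - Y r))\<^sup>2)"
  define \<Phi> where "\<Phi> s = a * (I + (integral {t..s} g + (T + 1 - s) * g s)) + \<rho> s" for s
  have [simp]: "continuous_on A Y" for A using cY continuous_on_subset by blast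
  have gap: "sq_gap T r (mk_path s Y) = I + (integral {t..s} g + (T + 1 - s) * g s)"
    if s: "t \<le> s" "s < T" and fr: "frozen r = frozen p" "final_time r = s" for s r
  proof -
    have "sq_gap T r (mk_path s Y) = integral {0..s} (\<lambda>r'. (norm (frozen r r' - frozen (mk_path s Y) r'))\<^sup>2) + (T + 1 - s) * (norm (x - Y s))\<^sup>2"
      using s fr t0 t by (intro sq_gap_split) (auto simp: frozen_def[of p] x_def frozen_mk_path)
    also have "integral {0..s} (\<lambda>r'. (norm (frozen r r' - frozen (mk_path s Y) r'))\<^sup>2) =
      integral {0..t} (\<lambda>r'. (norm (frozen r r' - frozen (mk_path s Y) r'))\<^sup>2) +
      integral {t..s} (\<lambda>r'. (norm (frozen r r' - frozen (mk_path s Y) r'))\<^sup>2)"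
      using s t0 by (intro Henstock_Kurzweil_Integration.integral_combine[symmetric] integrable_sq_frozen_diff) auto
    also have "integral {0..t} (\<lambda>r'. (norm (frozen r r' - frozen (mk_path s Y) r'))\<^sup>2) = I"
      unfolding I_def using s t0 by (intro integral_cong) (auto simp: fr frozen_mk_path)
    also have "integral {t..s} (\<lambda>r'. (norm (frozen r r' - frozen (mk_path s Y) r'))\<^sup>2) = integral {t..s} g"
      using s t0 t by (intro integral_cong) (auto simp: fr frozen_mk_path g_def x_def frozen_def[of p])
    finally show ?thesis by (simp add: g_def)
  qed
  have cg: "continuous_on {t..T} g"
    unfolding g_def by (intro continuous_intros) auto
  have "((\<lambda>s. integral {t..s} g) has_real_derivative g t) (at t within {t..T})"
    using cg t by (intro integral_has_real_derivative) auto
  then have d1: "((\<lambda>s. integral {t..s} g) has_real_derivative g t) (at_right t)"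
    using t by (simp add: at_within_Icc_at_right)
  have dg: "(g has_real_derivative - 2 * ((x - Y t) \<bullet> y)) (at_right t)"
  proof -
    have "((\<lambda>s. (x - Y s) \<bullet> (x - Y s)) has_derivative
      (\<lambda>h. (x - Y t) \<bullet> (0 - h *\<^sub>R y) + (0 - h *\<^sub>R y) \<bullet> (x - Y t))) (at_right t)"
      using Y unfolding has_vector_derivative_def
      by (intro has_derivative_inner has_derivative_diff has_derivative_const)
    then have "(g has_derivative
      (\<lambda>h. (x - Y t) \<bullet> (0 - h *\<^sub>R y) + (0 - h *\<^sub>R y) \<bullet> (x - Y t))) (at_right t)"
      by (simp add: g_def[abs_def] power2_norm_eq_inner)
    then show ?thesis
      unfolding has_field_derivative_def
      by (rule has_derivative_eq_rhs) (auto simp: fun_eq_iff inner_commute algebra_simps)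
  qed
  have d2: "((\<lambda>s. T + 1 - s) has_real_derivative - 1) (at_right t)"
    by (auto intro!: derivative_eq_intros)
  have "(\<Phi> has_real_derivative \<rho>' - 2 * a * (T + 1 - t) * ((x - Y t) \<bullet> y)) (at_right t)"
    unfolding \<Phi>_def
    by (rule DERIV_cong[OF DERIV_add[OF DERIV_cmult[OF DERIV_add[OF DERIV_const
        DERIV_add[OF d1 DERIV_mult[OF d2 dg]]]] \<rho>]]) (simp add: algebra_simps)
  then have "has_right_deriv (gap_test T a Y \<rho>) p (\<rho>' - 2 * a * (T + 1 - t) * ((x - Y t) \<bullet> y))"
  proof (intro has_right_derivI[where \<Phi> = \<Phi> and T = T])
    show "gap_test T a Y \<rho> p = \<Phi> (final_time p)"
      using t t0 gap[of t p] by (simp add: gap_test_def \<Phi>_def)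
    fix s assume "final_time p \<le> s" "s < T"
    then show "gap_test T a Y \<rho> (resize p s) = \<Phi> s"
      using t t0 gap[of s "resize p s"] by (simp add: gap_test_def \<Phi>_def frozen_resize fun_eq_iff)
  qed (use t in auto)
  then show ?thesis by (simp add: x_def)
qed

text \<open>A bump changes the extension on [0, t] only at t, a null set, but it shifts the whole
  tail. The gap is therefore an exact quadratic in the bump.\<close>

lemma has_vertical_deriv_gap_test:
  assumes t: "final_time p = t" "t \<le> T" and cY: "continuous_on UNIV Y"
  shows "has_vertical_deriv (gap_test T a Y \<rho>) p i (2 * a * (T + 1 - t) * ((path_at p t - Y t) $ i))"
proof -
  define z where "z = path_at p t - Y t"
  define I where "I = integral {0..t} (\<lambda>r. (norm (frozen p r - Y r))\<^sup>2)"
  have t0: "0 \<le> t" using t final_time_nonneg[of p] by simp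
  have [simp]: "continuous_on A Y" for A using cY continuous_on_subset by blast
  have gap: "sq_gap T (bump p x) (mk_path t Y) = I + (T + 1 - t) * (norm (z + x))\<^sup>2" for x
  proof -
    have "sq_gap T (bump p x) (mk_path t Y) =
      integral {0..t} (\<lambda>r. (norm (frozen (bump p x) r - frozen (mk_path t Y) r))\<^sup>2)
      + (T + 1 - t) * (norm ((path_at p t + x) - Y t))\<^sup>2"
      using t t0 by (intro sq_gap_split) (auto simp: frozen_def[of "bump p x"] path_at_bump frozen_mk_path)
    also have "integral {0..t} (\<lambda>r. (norm (frozen (bump p x) r - frozen (mk_path t Y) r))\<^sup>2) = I"
      unfolding I_def
      by (rule integral_spike[where S = "{t}"])
        (use t t0 in \<open>auto simp: frozen_mk_path frozen_def path_at_bump path_at_mk_path\<close>)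
    finally show ?thesis by (simp add: z_def algebra_simps)
  qed
  have "bump p 0 = p"
    by (rule path_eqI) (auto simp: path_at_bump)
  with gap[of 0] have gap0: "sq_gap T p (mk_path t Y) = I + (T + 1 - t) * (norm z)\<^sup>2" by simp
  have "(gap_test T a Y \<rho> (bump p (h *\<^sub>R axis i 1)) - gap_test T a Y \<rho> p) / h =
      a * (T + 1 - t) * (2 * z $ i + h)" if "h \<noteq> 0" for h
  proof -
    have "(norm (z + h *\<^sub>R axis i 1))\<^sup>2 = (norm z)\<^sup>2 + h * (2 * z $ i + h)"
      by (simp add: power2_norm_eq_inner inner_add_left inner_add_right inner_axis inner_axis_axis inner_commute algebra_simps)
    then show ?thesis
      using that t by (simp add: gap_test_def gap gap0 field_simps)
  qed
  moreover have "((\<lambda>h. a * (T + 1 - t) * (2 * z $ i + h)) \<longlongrightarrow> 2 * a * (T + 1 - t) * (z $ i)) (at 0)"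
    by (auto intro!: tendsto_eq_intros)
  ultimately show ?thesis
    unfolding has_vertical_deriv_def z_def[symmetric]
    by (subst Lim_cong_within[OF refl refl refl, where g = "\<lambda>h. a * (T + 1 - t) * (2 * z $ i + h)"]) auto
qed

text \<open>Horizontal derivatives look forward only, so right derivatives from t0 on suffice; Y may
  have a kink at t0, where a path is continued by a control, and is merely continuous
  before.\<close>

lemma gap_test_derivatives:
  fixes Y y :: "real \<Rightarrow> real ^ 'n::finite"
  assumes T: "0 \<le> t0" "t0 < T" and cY: "continuous_on UNIV Y"
    and Y: "\<And>s. t0 \<le> s \<Longrightarrow> s < T \<Longrightarrow> (Y has_vector_derivative y s) (at_right s)"
    and cy: "continuous_on {t0..T} y"
    and \<rho>: "\<And>s. t0 \<le> s \<Longrightarrow> s < T \<Longrightarrow> (\<rho> has_real_derivative \<rho>' s) (at_right s)"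
    and c\<rho>: "continuous_on {t0..T} \<rho>" and c\<rho>': "continuous_on {t0..T} \<rho>'"
  shows "gap_test T a Y \<rho> \<in> C1_cadlag T t0"
    and "\<And>p. t0 \<le> final_time p \<Longrightarrow> final_time p < T \<Longrightarrow>
      horizontal_deriv T (gap_test T a Y \<rho>) p = \<rho>' (final_time p) - 2 * a * (T + 1 - final_time p) *
        ((path_at p (final_time p) - Y (final_time p)) \<bullet> y (final_time p))"
    and "\<And>p. final_time p \<le> T \<Longrightarrow>
      vertical_gradient (gap_test T a Y \<rho>) p =
        (2 * a * (T + 1 - final_time p)) *\<^sub>R (path_at p (final_time p) - Y (final_time p))"
proof -
  let ?f = "gap_test T a Y \<rho>"
  let ?A = "cadlag_paths T t0 :: 'n cadlag_path set"
  have [simp]: "continuous_on A Y" for A using cY continuous_on_subset by blast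
  define D where "D s x = \<rho>' s - 2 * a * (T + 1 - s) * ((x - Y s) \<bullet> y s)" for s x
  have rd: "has_right_deriv ?f p (D (final_time p) (path_at p (final_time p)))"
    if "t0 \<le> final_time p" "final_time p < T" for p
    unfolding D_def using that by (intro has_right_deriv_gap_test cY Y \<rho>) auto
  have hd: "has_horizontal_deriv T ?f p (D (final_time p) (end_limit T p))"
    if p: "p \<in> ?A" for p
  proof (cases "final_time p < T")
    case True
    then show ?thesis
      using rd[of p] p by (simp add: has_horizontal_deriv_def end_limit_eq cadlag_paths_def)
  next
    case False
    with p have t: "final_time p = T" by (simp add: cadlag_paths_def)
    have "has_right_deriv ?f (resize p s) (D s (frozen p s))" if "t0 \<le> s" "s < T" for s
      using rd[of "resize p s"] that T by (simp add: path_at_resize frozen_def t)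
    then have ev: "\<forall>\<^sub>F s in at_left T. has_right_deriv ?f (resize p s) (D s (frozen p s))"
      using T unfolding eventually_at_left_field by (intro exI[of _ t0]) auto
    have lim: "(\<rho>' \<longlongrightarrow> \<rho>' T) (at_left T)" "(y \<longlongrightarrow> y T) (at_left T)" "(Y \<longlongrightarrow> Y T) (at_left T)"
      using T cy c\<rho>' by (auto intro!: continuous_on_Icc_at_leftD[of t0])
    have "((\<lambda>s. D s (frozen p s)) \<longlongrightarrow> D T (end_limit T p)) (at_left T)"
      unfolding D_def by (intro tendsto_intros lim tendsto_end_limit)
    with ev show ?thesis
      using t by (auto simp: has_horizontal_deriv_def intro!: exI[of _ "\<lambda>s. D s (frozen p s)"])
  qed
  have vd: "has_vertical_deriv ?f p i (2 * a * (T + 1 - final_time p) * ((path_at p (final_time p) - Y (final_time p)) $ i))"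
    if "final_time p \<le> T" for p i
    using that by (intro has_vertical_deriv_gap_test cY) auto
  show v: "vertical_gradient ?f p =
        (2 * a * (T + 1 - final_time p)) *\<^sub>R (path_at p (final_time p) - Y (final_time p))"
    if "final_time p \<le> T" for p
    using vd[OF that] by (intro vertical_gradient_eqI) auto
  have ft: "final_time p \<in> {t0..T}" if "p \<in> ?A" for p
    using that by (simp add: cadlag_paths_def)
  have comp: "continuous_on ?A (\<lambda>p. h (final_time p))" if "continuous_on {t0..T} h" for h :: "real \<Rightarrow> 'c::topological_space"
    using that continuous_on_final_time by (rule continuous_on_compose2) (use ft in auto)
  show "?f \<in> C1_cadlag T t0"
    unfolding C1_cadlag_def
  proof (intro CollectI conjI ballI allI)
    show "continuous_on ?A ?f"
      unfolding gap_test_def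
      by (intro continuous_intros comp c\<rho> continuous_on_mk_path) (use T in \<open>auto simp: continuous_on_id\<close>)
    show "\<exists>D. has_horizontal_deriv T ?f p D" if "p \<in> ?A" for p
      using hd[OF that] by blast
    show "\<exists>D. has_vertical_deriv ?f p i D" if "p \<in> ?A" for p i
      using vd[of p i] ft[OF that] by auto
    have "continuous_on ?A (\<lambda>p. D (final_time p) (end_limit T p))"
      unfolding D_def by (intro continuous_intros comp c\<rho>' cy continuous_on_end_limit continuous_on_final_time) auto
    then show "continuous_on ?A (horizontal_deriv T ?f)"
      by (rule continuous_on_eq) (rule horizontal_deriv_eqI[OF hd, symmetric])
    \<comment> \<open>\<open>frozen p T\<close> is the final value read at a fixed time, which makes
      its continuity in p immediate.\<close>
    have "continuous_on ?A (\<lambda>p. ((2 * a * (T + 1 - final_time p)) *\<^sub>R (frozen p T - Y (final_time p))) $ i)" for i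
      by (intro continuous_intros comp continuous_on_frozen_at continuous_on_final_time) auto
    then show "continuous_on ?A (\<lambda>p. vertical_gradient ?f p $ i)" for i
      by (rule continuous_on_eq) (use ft in \<open>auto simp: v frozen_final\<close>)
  qed
  show "horizontal_deriv T ?f p = \<rho>' (final_time p) - 2 * a * (T + 1 - final_time p) *
        ((path_at p (final_time p) - Y (final_time p)) \<bullet> y (final_time p))"
    if "t0 \<le> final_time p" "final_time p < T" for p
    using rd[OF that] that
    by (intro horizontal_deriv_eqI) (simp add: has_horizontal_deriv_def D_def)
qed

section \<open>Lipschitz paths\<close>

lemma lipschitz_pathsI:
  assumes "p \<in> cont_paths T s" "\<And>r. norm (frozen p r) \<le> M"
    and "\<And>l r. norm (frozen p l - frozen p r) \<le> \<mu> * (1 + M) * \<bar>l - r\<bar>"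
  shows "p \<in> lipschitz_paths T s \<mu> M"
  unfolding lipschitz_paths_def
proof (intro CollectI conjI allI impI)
  show "path_norm p \<le> M"
    using assms(2) by (intro path_norm_leI) (metis frozen_eq)
  fix l r assume lr: "0 \<le> l \<and> l < r \<and> r \<le> final_time p"
  then have "norm (path_at p l - path_at p r) \<le> \<mu> * (1 + M) * \<bar>l - r\<bar>"
    using assms(3)[of l r] by (simp add: frozen_eq)
  then show "norm (path_at p l - path_at p r) / \<bar>l - r\<bar> \<le> \<mu> * (1 + M)"
    using lr by (simp add: divide_simps)
qed (rule assms(1))

lemma lipschitz_pathsD:
  assumes "p \<in> lipschitz_paths T s \<mu> M"
  shows "p \<in> cont_paths T s" "norm (frozen p r) \<le> M" "path_norm p \<le> M"
    and "0 \<le> \<mu> * (1 + M) \<Longrightarrow> norm (frozen p l - frozen p r) \<le> \<mu> * (1 + M) * \<bar>l - r\<bar>"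
proof -
  show "p \<in> cont_paths T s" "path_norm p \<le> M"
    using assms by (auto simp: lipschitz_paths_def)
  then show "norm (frozen p r) \<le> M"
    using norm_frozen_le order_trans by blast
  assume C: "0 \<le> \<mu> * (1 + M)"
  define c where "c x = max 0 (min x (final_time p))" for x
  have *: "norm (path_at p (c a) - path_at p (c b)) \<le> \<mu> * (1 + M) * \<bar>a - b\<bar>" if "a < b" for a b
  proof (cases "c a = c b")
    case True then show ?thesis using C by simp
  next
    case False
    then have ab: "0 \<le> c a" "c a < c b" "c b \<le> final_time p" "\<bar>c a - c b\<bar> \<le> \<bar>a - b\<bar>"
      using that final_time_nonneg[of p] by (auto simp: c_def simp del: final_time_nonneg)
    then have "norm (path_at p (c a) - path_at p (c b)) / \<bar>c a - c b\<bar> \<le> \<mu> * (1 + M)"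
      using assms unfolding lipschitz_paths_def by blast
    then have "norm (path_at p (c a) - path_at p (c b)) \<le> \<mu> * (1 + M) * \<bar>c a - c b\<bar>"
      using ab by (simp add: divide_simps)
    also have "\<dots> \<le> \<mu> * (1 + M) * \<bar>a - b\<bar>"
      using ab(4) C by (rule mult_left_mono)
    finally show ?thesis .
  qed
  show "norm (frozen p l - frozen p r) \<le> \<mu> * (1 + M) * \<bar>l - r\<bar>"
    using *[of l r] *[of r l] unfolding frozen_def c_def
    by (cases l r rule: linorder_cases) (auto simp: norm_minus_commute)
qed

lemma mk_path_lipschitz_paths:
  assumes t: "s \<le> t" "0 \<le> t" "t \<le> T" and c: "continuous_on {0..t} g"
    and M: "\<And>r. 0 \<le> r \<Longrightarrow> r \<le> t \<Longrightarrow> norm (g r) \<le> M"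
    and lip: "\<And>l r. 0 \<le> l \<Longrightarrow> l < r \<Longrightarrow> r \<le> t \<Longrightarrow> norm (g l - g r) \<le> \<mu> * (1 + M) * (r - l)"
  shows "mk_path t g \<in> lipschitz_paths T s \<mu> M"
  unfolding lipschitz_paths_def
proof (intro CollectI conjI allI impI)
  show "mk_path t g \<in> cont_paths T s" using t c by (intro mk_path_cont_paths) auto
  show "path_norm (mk_path t g) \<le> M"
    using t c M by (intro path_norm_leI) (auto simp: path_at_mk_path)
  fix l r assume lr: "0 \<le> l \<and> l < r \<and> r \<le> final_time (mk_path t g)"
  then have "norm (g l - g r) \<le> \<mu> * (1 + M) * (r - l)"
    using t c by (intro lip) auto
  then show "norm (path_at (mk_path t g) l - path_at (mk_path t g) r) / \<bar>l - r\<bar> \<le> \<mu> * (1 + M)"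
    using lr t c by (simp add: path_at_mk_path divide_simps)
qed

lemma lipschitz_paths_mono_time:
  "p \<in> lipschitz_paths T s \<mu> M \<Longrightarrow> s' \<le> final_time p \<Longrightarrow> p \<in> lipschitz_paths T s' \<mu> M"
  by (auto simp: lipschitz_paths_def cont_paths_def cadlag_paths_def)

text \<open>Final times converge along a subsequence, and the extensions are bounded and
  equi-Lipschitz on [0, T], so Arzela-Ascoli applies. Compactness is what produces the contact
  points below.\<close>

lemma compact_lipschitz_paths:
  assumes C: "0 \<le> \<mu> * (1 + M)"
  shows "compact (lipschitz_paths T s \<mu> M :: 'n::finite cadlag_path set)"
  unfolding compact_eq_seq_compact_metric
proof (rule seq_compactI)
  define C where "C = \<mu> * (1 + M)"
  fix p :: "nat \<Rightarrow> 'n cadlag_path" assume p: "\<forall>n. p n \<in> lipschitz_paths T s \<mu> M"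
  have pt: "s \<le> final_time (p n)" "final_time (p n) \<le> T" "0 \<le> final_time (p n)" for n
    using cont_paths_final_time[OF lipschitz_pathsD(1)[OF p[rule_format]], of n] by auto
  have plip: "norm (frozen (p n) l - frozen (p n) r) \<le> C * \<bar>l - r\<bar>" for n l r
    using p lipschitz_pathsD(4)[OF _ assms] unfolding C_def by blast
  have pM: "norm (frozen (p n) r) \<le> M" for n r
    using p lipschitz_pathsD(2) by blast
  have "\<exists>l\<in>{max 0 s..T}. \<exists>r. strict_mono r \<and> ((\<lambda>n. final_time (p n)) \<circ> r) \<longlonglongrightarrow> l"
    using compact_Icc[of "max 0 s" T] pt unfolding compact_def by simp
  then obtain t k1 where t: "max 0 s \<le> t" "t \<le> T" and k1: "strict_mono (k1 :: nat \<Rightarrow> nat)"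
    and lim1: "(\<lambda>n. final_time (p (k1 n))) \<longlonglongrightarrow> t"
    by (auto simp: o_def)
  obtain g k2 where cg: "continuous_on {0..T} g" and k2: "strict_mono (k2 :: nat \<Rightarrow> nat)"
    and lim2: "\<And>e. 0 < e \<Longrightarrow> \<exists>N. \<forall>n r. n \<ge> N \<and> r \<in> {0..T} \<longrightarrow> norm (frozen (p (k1 (k2 n))) r - g r) < e"
  proof (rule Arzela_Ascoli[of "{0..T}" "\<lambda>n. frozen (p (k1 n))" M])
    fix x e :: real assume "0 < e"
    have "norm (frozen (p (k1 n)) x - frozen (p (k1 n)) y) < e" if "norm (x - y) < e / (C + 1)" for n y
    proof -
      have C1: "C \<ge> 0" using assms by (simp add: C_def)
      have "norm (frozen (p (k1 n)) x - frozen (p (k1 n)) y) \<le> C * \<bar>x - y\<bar>" by (rule plip)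
      also have "\<dots> \<le> (C + 1) * \<bar>x - y\<bar>" by (simp add: mult_right_mono)
      also have "\<dots> < e" using that C1 by (simp add: field_simps)
      finally show ?thesis .
    qed
    then show "\<exists>d>0. \<forall>n y. y \<in> {0..T} \<and> norm (x - y) < d \<longrightarrow> norm (frozen (p (k1 n)) x - frozen (p (k1 n)) y) < e"
      using \<open>0 < e\<close> assms by (intro exI[of _ "e / (C + 1)"]) (auto simp: C_def intro!: divide_pos_pos)
  qed (use pM in auto)
  define k where "k = k1 \<circ> k2"
  have k: "strict_mono k" unfolding k_def using k1 k2 by (rule strict_mono_o)
  have limt: "(\<lambda>n. final_time (p (k n))) \<longlonglongrightarrow> t"
    using LIMSEQ_subseq_LIMSEQ[OF lim1 k2] by (simp add: k_def o_def)
  have limg: "(\<lambda>n. frozen (p (k n)) r) \<longlonglongrightarrow> g r" if "r \<in> {0..T}" for r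
    unfolding LIMSEQ_iff using lim2 that by (fastforce simp: k_def)
  have cg': "continuous_on {0..t} g" using cg by (rule continuous_on_subset) (use t in auto)
  define q where "q = mk_path t g"
  have "q \<in> lipschitz_paths T s \<mu> M"
    unfolding q_def
  proof (rule mk_path_lipschitz_paths)
    fix r assume "0 \<le> r" "r \<le> t"
    then show "norm (g r) \<le> M"
      using t pM by (intro Lim_bounded[OF tendsto_norm[OF limg[of r]]]) auto
  next
    fix l r assume "0 \<le> l" "l < r" "r \<le> t"
    then show "norm (g l - g r) \<le> \<mu> * (1 + M) * (r - l)"
      using t plip[of _ l r] by (intro Lim_bounded[OF tendsto_norm[OF tendsto_diff[OF limg[of l] limg[of r]]]]) (auto simp: C_def)
  qed (use t cg' in auto)
  moreover have "(p \<circ> k) \<longlonglongrightarrow> q"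
    unfolding LIMSEQ_def
  proof (intro allI impI)
    fix e :: real assume e: "e > 0"
    have C1: "C \<ge> 0" using assms by (simp add: C_def)
    obtain N1 where N1: "\<And>n. n \<ge> N1 \<Longrightarrow> \<bar>final_time (p (k n)) - t\<bar> < e / (2 * (C + 1))"
      using limt e C1 unfolding LIMSEQ_def dist_real_def by (metis add_nonneg_pos divide_pos_pos mult_pos_pos zero_less_numeral zero_less_one)
    obtain N2 where N2: "\<And>n r. n \<ge> N2 \<Longrightarrow> r \<in> {0..T} \<Longrightarrow> norm (frozen (p (k n)) r - g r) < e / 2"
      using lim2[of "e/2"] e by (auto simp: k_def)
    have "dist ((p \<circ> k) n) q < e" if n: "n \<ge> max N1 N2" for n
    proof -
      define P where "P = p (k n)"
      have ft: "final_time q = t" using t cg' by (simp add: q_def)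
      \<comment> \<open>After time t the limit is frozen while P may still move, but for at most
        |\<open>final_time P\<close> - t|; before t, uniform convergence takes over.\<close>
      have "dist P q \<le> \<bar>final_time P - final_time q\<bar> + (C * \<bar>final_time P - t\<bar> + e / 2)"
      proof (rule dist_path_leI)
        fix r assume r: "0 \<le> r" "r \<le> max (final_time P) (final_time q)"
        have fq: "frozen q r = g (min r t)"
          unfolding q_def using t cg' r(1) by (subst frozen_mk_path) (auto simp: min_def)
        have "norm (frozen P r - frozen P (min r t)) \<le> C * \<bar>r - min r t\<bar>"
          unfolding P_def by (rule plip)
        also have "\<dots> \<le> C * \<bar>final_time P - t\<bar>"
          using r ft C1 by (intro mult_left_mono) auto
        finally have "norm (frozen P r - frozen P (min r t)) \<le> C * \<bar>final_time P - t\<bar>" .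
        moreover have "norm (frozen P (min r t) - g (min r t)) < e / 2"
          unfolding P_def using n r t by (intro N2) auto
        ultimately show "norm (frozen P r - frozen q r) \<le> C * \<bar>final_time P - t\<bar> + e / 2"
          unfolding fq using norm_triangle_ineq[of "frozen P r - frozen P (min r t)" "frozen P (min r t) - g (min r t)"]
          by simp
      qed
      also have "\<dots> = (C + 1) * \<bar>final_time P - t\<bar> + e / 2"
        by (simp add: ft algebra_simps)
      also have "\<dots> < (C + 1) * (e / (2 * (C + 1))) + e / 2"
        using N1[of n] n C1 by (intro add_strict_right_mono mult_strict_left_mono) (auto simp: P_def)
      also have "\<dots> = e" using C1 by (simp add: field_simps)
      finally show ?thesis by (simp add: P_def)
    qed
    then show "\<exists>N. \<forall>n\<ge>N. dist ((p \<circ> k) n) q < e" by blast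
  qed
  ultimately show "\<exists>l\<in>lipschitz_paths T s \<mu> M. \<exists>r. strict_mono r \<and> (p \<circ> r) \<longlonglongrightarrow> l"
    using k by blast
qed

section \<open>Testing at a contact point\<close>

text \<open>The functional f serves as its own extension to cadlag paths, and the supremum condition
  is reduced to a pointwise inequality.\<close>

lemma subsolution_test:
  assumes sub: "viscosity_mu_subsolution T H \<phi> \<mu> w" and M: "M > 0" and p: "p \<in> lipschitz_paths T 0 \<mu> M"
    and t: "final_time p < T" "norm (path_at p (final_time p)) < M"
    and f: "f \<in> C1_cadlag T (final_time p)" and eq: "w p = f p"
    and le: "\<And>\<eta>. \<eta> \<in> lipschitz_paths T (final_time p) \<mu> M \<Longrightarrow> w \<eta> \<le> f \<eta>"
  shows "0 \<le> horizontal_deriv T f p + H p (vertical_gradient f p)"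
proof -
  have ext: "C1_extension T (final_time p) f f"
    using f by (simp add: C1_extension_def)
  have "(SUP \<eta>\<in>lipschitz_paths T (final_time p) \<mu> M. ereal (w \<eta> - f \<eta>)) = 0"
  proof (rule antisym)
    have "p \<in> lipschitz_paths T (final_time p) \<mu> M"
      using p by (rule lipschitz_paths_mono_time) simp
    then show "0 \<le> (SUP \<eta>\<in>lipschitz_paths T (final_time p) \<mu> M. ereal (w \<eta> - f \<eta>))"
      using eq by (intro SUP_upper2) auto
  qed (use le in \<open>auto intro!: SUP_least\<close>)
  then have "f \<in> J_plus T \<mu> M p w"
    using ext eq by (auto simp: J_plus_def C1_cont_def)
  with sub M p t ext show ?thesis
    unfolding viscosity_mu_subsolution_def by blast
qed

text \<open>Here -f touches w from below, which explains the signs of both derivatives.\<close>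

lemma supersolution_test:
  assumes super: "viscosity_mu_supersolution T H \<phi> \<mu> w" and M: "M > 0" and p: "p \<in> lipschitz_paths T 0 \<mu> M"
    and t: "final_time p < T" "norm (path_at p (final_time p)) < M"
    and f: "f \<in> C1_cadlag T (final_time p)" and eq: "w p = - f p"
    and le: "\<And>\<eta>. \<eta> \<in> lipschitz_paths T (final_time p) \<mu> M \<Longrightarrow> - f \<eta> \<le> w \<eta>"
  shows "- horizontal_deriv T f p + H p (- vertical_gradient f p) \<le> 0"
proof -
  have ext: "C1_extension T (final_time p) f f"
    using f by (simp add: C1_extension_def)
  have "(INF \<eta>\<in>lipschitz_paths T (final_time p) \<mu> M. ereal (w \<eta> + f \<eta>)) = 0"
  proof (rule antisym)
    have "p \<in> lipschitz_paths T (final_time p) \<mu> M"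
      using p by (rule lipschitz_paths_mono_time) simp
    then show "(INF \<eta>\<in>lipschitz_paths T (final_time p) \<mu> M. ereal (w \<eta> + f \<eta>)) \<le> 0"
      using eq by (intro INF_lower2) auto
  next
    show "0 \<le> (INF \<eta>\<in>lipschitz_paths T (final_time p) \<mu> M. ereal (w \<eta> + f \<eta>))"
      by (rule INF_greatest) (use le in \<open>force simp: zero_ereal_def\<close>)
  qed
  then have "f \<in> J_minus T \<mu> M p w"
    using ext eq by (auto simp: J_minus_def C1_cont_def)
  with super M p t ext show ?thesis
    unfolding viscosity_mu_supersolution_def by blast
qed

section \<open>A path-dependent ordinary differential equation\<close>

lemma mk_path_cong:
  assumes "\<And>r. 0 \<le> r \<Longrightarrow> r \<le> t \<Longrightarrow> f r = g r"
  shows "mk_path t f = mk_path t g"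
proof -
  have "restrict f {0..t} = restrict g {0..t}"
    using assms by (auto simp: restrict_def)
  then show ?thesis by (simp add: mk_path_def)
qed

text \<open>Banach's fixed point theorem for the integral equation; the unknown is the increment
  over \<open>frozen p\<close>.\<close>

lemma path_dependent_ode:
  fixes F :: "'n::finite cadlag_path \<Rightarrow> real ^ 'n"
  assumes L: "L > 0" and cF: "continuous_on (cont_paths T 0) F"
    and lip: "\<And>p q. p \<in> cont_paths T 0 \<Longrightarrow> q \<in> cont_paths T 0 \<Longrightarrow> final_time p = final_time q \<Longrightarrow>
      norm (F p - F q) \<le> L * dist p q"
    and p: "p \<in> cont_paths T 0" and t: "final_time p = t" "t < T"
  obtains \<delta> Y y where "\<delta> > 0" "t + \<delta> < T" "continuous_on UNIV Y" "continuous_on UNIV y"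
    "\<And>r. r \<le> t \<Longrightarrow> Y r = frozen p r"
    "\<And>s. t \<le> s \<Longrightarrow> Y s = path_at p t + integral {t..s} y"
    "\<And>s. t \<le> s \<Longrightarrow> (Y has_vector_derivative y s) (at_right s)"
    "\<And>s. t \<le> s \<Longrightarrow> s \<le> t + \<delta> \<Longrightarrow> y s = F (mk_path s Y)"
proof -
  have t0: "0 \<le> t" using t final_time_nonneg[of p] by simp
  \<comment> \<open>The second bound makes the integral operator a contraction with factor 1/2; the
    first keeps the solution before T.\<close>
  define \<delta> where "\<delta> = min ((T - t) / 2) (1 / (2 * L))"
  have \<delta>: "\<delta> > 0" "t + \<delta> < T" "\<delta> * L \<le> 1/2"
  proof -
    show "\<delta> > 0" using t L by (simp add: \<delta>_def)
    have "\<delta> \<le> (T - t) / 2" unfolding \<delta>_def by (rule min.cobounded1)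
    then show "t + \<delta> < T" using t by simp
    have "\<delta> * L \<le> 1 / (2 * L) * L" using L by (intro mult_right_mono) (auto simp: \<delta>_def)
    then show "\<delta> * L \<le> 1/2" using L by simp
  qed
  \<comment> \<open>Clamping time to [t, t + \<delta>] lets the operator act on bounded continuous
    functions on the whole line, a complete space.\<close>
  define c where "c s = max t (min s (t + \<delta>))" for s
  have c: "t \<le> c s" "c s \<le> t + \<delta>" "0 \<le> c s" "c s \<le> T" for s
    using \<delta> t0 by (auto simp: c_def)
  have cc: "continuous_on A c" for A unfolding c_def by (intro continuous_intros)
  define P where "P x r = mk_path r (\<lambda>\<theta>. frozen p \<theta> + apply_bcontfun x \<theta>)" for x :: "real \<Rightarrow>\<^sub>C (real ^ 'n)" and r
  have cP: "continuous_on A (\<lambda>\<theta>. frozen p \<theta> + apply_bcontfun x \<theta>)" for A and x :: "real \<Rightarrow>\<^sub>C (real ^ 'n)"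
    by (intro continuous_intros continuous_on_frozen[OF p]) auto
  define z where "z x r = F (P x (c r))" for x r
  have PT: "P x (c r) \<in> cont_paths T 0" for x r
    unfolding P_def using c cP by (intro mk_path_cont_paths) auto
  have cz: "continuous_on A (z x)" for x A
  proof -
    have "continuous_on A (\<lambda>r. P x (c r))"
      unfolding P_def
      by (rule continuous_on_compose2[OF continuous_on_mk_path[OF cP order_refl] cc]) (use c in auto)
    then show ?thesis
      unfolding z_def by (rule continuous_on_compose2[OF cF]) (use PT in auto)
  qed
  have iz: "z x integrable_on {a..b}" for x a b
    by (rule integrable_continuous_real[OF cz])
  define \<Phi> where "\<Phi> x s = integral {t..c s} (z x)" for x s
  have \<Phi>: "\<Phi> x \<in> bcontfun" for x
  proof -
    have ci: "continuous_on {t..t+\<delta>} (\<lambda>s. integral {t..s} (z x))"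
      by (rule indefinite_integral_continuous_1[OF iz])
    then have "continuous_on UNIV (\<Phi> x)"
      unfolding \<Phi>_def by (rule continuous_on_compose2[OF _ cc]) (use c in auto)
    moreover have "bounded (range (\<Phi> x))"
    proof (rule bounded_subset)
      show "bounded ((\<lambda>s. integral {t..s} (z x)) ` {t..t+\<delta>})"
        by (intro compact_imp_bounded compact_continuous_image ci) auto
      show "range (\<Phi> x) \<subseteq> (\<lambda>s. integral {t..s} (z x)) ` {t..t+\<delta>}"
        using c by (auto simp: \<Phi>_def)
    qed
    ultimately show ?thesis by (simp add: bcontfun_def)
  qed
  have app: "apply_bcontfun (Bcontfun (\<Phi> x)) = \<Phi> x" for x
    by (rule Bcontfun_inverse[OF \<Phi>])
  have "dist (Bcontfun (\<Phi> x)) (Bcontfun (\<Phi> x')) \<le> 1/2 * dist x x'" for x x'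
  proof (rule dist_bound)
    fix s
    have zz: "norm (z x r - z x' r) \<le> L * dist x x'" for r
    proof -
      have "norm (z x r - z x' r) \<le> L * dist (P x (c r)) (P x' (c r))"
        unfolding z_def using c cP by (intro lip PT) (simp add: P_def)
      moreover have "dist (P x (c r)) (P x' (c r)) \<le> 0 + dist x x'"
      proof (rule order_trans[OF dist_path_leI])
        show "norm (frozen (P x (c r)) r' - frozen (P x' (c r)) r') \<le> dist x x'" for r'
          using c cP dist_bounded[of x _ x'] by (simp add: P_def frozen_mk_path dist_norm)
      qed (use c cP in \<open>simp add: P_def\<close>)
      then have "L * dist (P x (c r)) (P x' (c r)) \<le> L * dist x x'"
        using L by simp
      ultimately show ?thesis by linarith
    qed
    have "dist (\<Phi> x s) (\<Phi> x' s) = norm (integral {t..c s} (\<lambda>r. z x r - z x' r))"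
      unfolding \<Phi>_def dist_norm by (simp add: integral_diff iz)
    also have "\<dots> \<le> integral {t..c s} (\<lambda>r. L * dist x x')"
      by (intro integral_norm_bound_integral integrable_diff iz zz) auto
    also have "\<dots> = (c s - t) * (L * dist x x')"
      using c by simp
    also have "\<dots> \<le> \<delta> * (L * dist x x')"
      using c[of s] L by (intro mult_right_mono) auto
    also have "\<dots> = (\<delta> * L) * dist x x'" by simp
    also have "\<dots> \<le> 1/2 * dist x x'"
      using \<delta>(3) by (rule mult_right_mono) simp
    finally show "dist (apply_bcontfun (Bcontfun (\<Phi> x)) s) (apply_bcontfun (Bcontfun (\<Phi> x')) s) \<le> 1/2 * dist x x'"
      by (simp add: app)
  qed
  then obtain x where "Bcontfun (\<Phi> x) = x"
    using banach_fix_type[of "1/2" "\<lambda>x. Bcontfun (\<Phi> x)"] by auto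
  then have x: "apply_bcontfun x s = \<Phi> x s" for s
    using app[of x] by simp
  define y where "y = z x"
  \<comment> \<open>The fixed point x is constant after t + \<delta>, whereas Y goes on with the
    constant velocity reached there. Thus Y has a right derivative at every later time, as test
    functionals up to T require.\<close>
  define Y where "Y s = frozen p s + integral {t..max t s} y" for s
  have Yle: "Y r = frozen p r" if "r \<le> t" for r
    using that by (simp add: Y_def)
  have Yge: "Y s = path_at p t + integral {t..s} y" if "t \<le> s" for s
    using that t t0 by (simp add: Y_def frozen_def)
  have cY: "continuous_on UNIV Y"
  proof -
    have "continuous_on {a..b} Y" for a b
    proof -
      have "continuous_on {a..b} (\<lambda>s. integral {t..max t s} y)"
      proof (rule continuous_on_compose2[where g = "\<lambda>s. integral {t..s} y" and f = "max t"])
        show "continuous_on {t..max t b} (\<lambda>s. integral {t..s} y)"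
          unfolding y_def by (rule indefinite_integral_continuous_1[OF iz])
      qed (auto intro!: continuous_intros)
      then show ?thesis
        unfolding Y_def by (intro continuous_intros continuous_on_frozen[OF p])
    qed
    then show ?thesis
      by (intro continuous_at_imp_continuous_on ballI)
        (metis continuous_on_interior interior_atLeastAtMost_real greaterThanLessThan_iff lt_ex gt_ex)
  qed
  have der: "(Y has_vector_derivative y s) (at_right s)" if s: "t \<le> s" for s
  proof -
    have "((\<lambda>r. integral {t..r} y) has_vector_derivative y s) (at s within {t..s+1})"
      unfolding y_def using s by (intro integral_has_vector_derivative cz) auto
    then have "((\<lambda>r. path_at p t + integral {t..r} y) has_vector_derivative y s) (at s within {s..s+1})"
      using s by (intro derivative_eq_intros) (auto intro: has_vector_derivative_within_subset)
    then have "(Y has_vector_derivative y s) (at s within {s..s+1})"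
      by (rule has_vector_derivative_transform[rotated 2]) (use s Yge in auto)
    then show ?thesis by (simp add: at_within_Icc_at_right)
  qed
  have "y s = F (mk_path s Y)" if s: "t \<le> s" "s \<le> t + \<delta>" for s
  proof -
    have "mk_path s Y = P x s"
      unfolding P_def
    proof (rule mk_path_cong)
      fix r assume "r \<le> s"
      then have "max t r = c r" using s by (auto simp: c_def)
      then show "Y r = frozen p r + apply_bcontfun x r" by (simp add: Y_def x \<Phi>_def y_def)
    qed
    moreover have "c s = s" using s by (simp add: c_def)
    ultimately show ?thesis by (simp add: y_def z_def)
  qed
  then show ?thesis
    using that[of \<delta> Y y] \<delta> cY cz Yle Yge der by (simp add: y_def)
qed

section \<open>Monotonicity of subsolutions along constant controls\<close>

text \<open>Slope bounds before and after t combine through the value at t, so an admissible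
  continuation stays in the class.\<close>

lemma lipschitz_paths_extend:
  assumes p: "p \<in> lipschitz_paths T 0 \<mu> R" and t: "final_time p = t" "t \<le> s" "s \<le> T"
    and C: "0 \<le> \<mu> * (1 + R)" and cg: "continuous_on UNIV g" and g: "\<And>r. r \<le> t \<Longrightarrow> g r = frozen p r"
    and R: "\<And>r. t \<le> r \<Longrightarrow> r \<le> s \<Longrightarrow> norm (g r) \<le> R"
    and lip: "\<And>l r. t \<le> l \<Longrightarrow> l \<le> r \<Longrightarrow> r \<le> s \<Longrightarrow> norm (g l - g r) \<le> \<mu> * (1 + R) * (r - l)"
  shows "mk_path s g \<in> lipschitz_paths T 0 \<mu> R"
proof (rule mk_path_lipschitz_paths)
  show "0 \<le> s" using t final_time_nonneg[of p] by linarith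
  then show "0 \<le> s" .
  show "continuous_on {0..s} g" using cg continuous_on_subset by blast
  show "norm (g r) \<le> R" if "0 \<le> r" "r \<le> s" for r
    using R[of r] g[of r] that lipschitz_pathsD(2)[OF p, of r] by (cases "r \<le> t") auto
  have lo: "norm (g l - g r) \<le> \<mu> * (1 + R) * (r - l)" if "l \<le> r" "r \<le> t" for l r
    using lipschitz_pathsD(4)[OF p C, of l r] g[of l] g[of r] that by simp
  fix l r assume lr: "0 \<le> l" "l < r" "r \<le> s"
  show "norm (g l - g r) \<le> \<mu> * (1 + R) * (r - l)"
  proof (cases "l < t \<and> t < r")
    case True
    have "norm (g l - g r) \<le> norm (g l - g t) + norm (g t - g r)"
      using norm_triangle_ineq[of "g l - g t" "g t - g r"] by simp
    also have "\<dots> \<le> \<mu> * (1 + R) * (t - l) + \<mu> * (1 + R) * (r - t)"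
      using True lr lo[of l t] lip[of t r] by (intro add_mono) auto
    finally show ?thesis by (simp add: algebra_simps)
  next
    case False
    then show ?thesis using lo[of l r] lip[of l r] lr by linarith
  qed
qed (use t in auto)

lemma bounded_on_lipschitz_paths:
  fixes W :: "'n::finite cadlag_path \<Rightarrow> real"
  assumes "continuous_on (cont_paths T 0) W" "0 \<le> \<mu> * (1 + R)"
  shows "\<exists>B. \<forall>z\<in>lipschitz_paths T 0 \<mu> R. \<bar>W z\<bar> \<le> B"
proof -
  have "continuous_on (lipschitz_paths T 0 \<mu> R) W"
    using assms(1) by (rule continuous_on_subset) (use lipschitz_pathsD(1) in blast)
  then have "compact (W ` lipschitz_paths T 0 \<mu> R)"
    using compact_lipschitz_paths[OF assms(2)] by (rule compact_continuous_image)
  then show ?thesis using compact_imp_bounded by (fastforce simp: bounded_iff)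
qed

text \<open>A difference of two paths of the class has slope at most C = 2 \<mu> (1 + R) and height
  at most 2 R \<le> 2 C, so the pointwise cube estimate applies at every time. Cube roots allow
  passing to the supremum.\<close>

lemma cube_dist_le_sq_gap:
  assumes p: "p \<in> lipschitz_paths T 0 \<mu> R" and q: "q \<in> lipschitz_paths T 0 \<mu> R"
    and eq: "final_time p = final_time q" and \<mu>: "\<mu> \<ge> 1" "R > 0"
  shows "(dist p q) ^ 3 \<le> 16 * \<mu> * (1 + R) * sq_gap T p q"
proof -
  define C where "C = 2 * (\<mu> * (1 + R))"
  have m: "0 \<le> \<mu> * (1 + R)" "1 + R \<le> \<mu> * (1 + R)" using \<mu> by (auto simp: mult_le_cancel_right1)
  have "0 \<le> final_time p" "final_time p \<le> T" using cont_paths_final_time[OF lipschitz_pathsD(1)[OF p]] by auto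
  have C: "C > 0" using m \<mu> by (simp add: C_def)
  have "norm (frozen p r - frozen q r) \<le> root 3 (8 * C * sq_gap T p q)" if "0 \<le> r" "r \<le> T" for r
  proof -
    have "(norm (frozen p r - frozen q r)) ^ 3 \<le> 8 * C * sq_gap T p q"
    proof (rule cube_le_sq_gap)
      fix r s
      have "norm ((frozen p r - frozen q r) - (frozen p s - frozen q s)) \<le>
        norm (frozen p r - frozen p s) + norm (frozen q r - frozen q s)"
        using norm_triangle_ineq4[of "frozen p r - frozen p s" "frozen q r - frozen q s"] by (simp add: algebra_simps)
      then show "norm ((frozen p r - frozen q r) - (frozen p s - frozen q s)) \<le> C * \<bar>r - s\<bar>"
        using lipschitz_pathsD(4)[OF p m(1), of r s] lipschitz_pathsD(4)[OF q m(1), of r s] by (simp add: C_def)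
    next
      have "norm (frozen p r - frozen q r) \<le> 2 * R"
        using norm_triangle_ineq4[of "frozen p r" "frozen q r"] lipschitz_pathsD(2)[OF p, of r]
          lipschitz_pathsD(2)[OF q, of r] by linarith
      then show "norm (frozen p r - frozen q r) \<le> 2 * C" using m \<mu> unfolding C_def by linarith
    qed (use that C in auto)
    then have "root 3 ((norm (frozen p r - frozen q r)) ^ 3) \<le> root 3 (8 * C * sq_gap T p q)"
      by (intro real_root_le_mono) auto
    then show ?thesis by (simp add: real_root_power_cancel)
  qed
  then have "dist p q \<le> \<bar>final_time p - final_time q\<bar> + root 3 (8 * C * sq_gap T p q)"
    using \<open>final_time p \<le> T\<close> eq by (intro dist_path_leI) auto
  then have "(dist p q) ^ 3 \<le> (root 3 (8 * C * sq_gap T p q)) ^ 3"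
    using eq by (intro power_mono) auto
  also have "\<dots> = 8 * C * sq_gap T p q"
    using C sq_gap_nonneg[of T p q] by (intro real_root_pow_pos2) auto
  finally show ?thesis by (simp add: C_def)
qed

text \<open>With a penalty \<open>\<beta> g\<close> of cubic strength, \<open>D\<close> is of order \<open>\<beta>\<^sup>-\<^sup>1\<^sup>/\<^sup>2\<close>, while the gradient of the
  penalty, of order \<open>\<beta> sqrt g\<close>, only grows like \<open>\<beta>\<^sup>1\<^sup>/\<^sup>4\<close>.\<close>

lemma large_penalty:
  fixes c1 c2 e :: real
  assumes "0 \<le> c1" "0 \<le> c2" "e > 0"
  obtains \<beta> where "\<beta> > 0"
    "\<And>D g. 0 \<le> D \<Longrightarrow> 0 \<le> g \<Longrightarrow> D ^ 3 \<le> c1 * g \<Longrightarrow> \<beta> * g \<le> c2 * D \<Longrightarrow> D \<le> e \<and> \<beta> * sqrt g * D \<le> e"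
proof -
  define c where "c = c1 * c2"
  \<comment> \<open>From \<beta> D^2 \<le> c the second summand gives D \<le> e. For z = \<beta>
    sqrt(g) D one has \<beta> z^4 \<le> c2^2 (\<beta> D^2)^3, and the third summand gives z \<le>
    e.\<close>
  define \<beta> where "\<beta> = 1 + c / e\<^sup>2 + c2\<^sup>2 * c ^ 3 / e ^ 4"
  have c: "0 \<le> c" using assms by (simp add: c_def)
  have \<beta>: "\<beta> > 0" "c \<le> \<beta> * e\<^sup>2" "c2\<^sup>2 * c ^ 3 \<le> \<beta> * e ^ 4"
  proof -
    have a: "0 \<le> c / e\<^sup>2" "0 \<le> c2\<^sup>2 * c ^ 3 / e ^ 4" using c assms by auto
    then show "\<beta> > 0" by (simp add: \<beta>_def)
    have "c / e\<^sup>2 \<le> \<beta>" "c2\<^sup>2 * c ^ 3 / e ^ 4 \<le> \<beta>" using a by (simp_all add: \<beta>_def)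
    then show "c \<le> \<beta> * e\<^sup>2" "c2\<^sup>2 * c ^ 3 \<le> \<beta> * e ^ 4" using assms by (simp_all add: divide_simps)
  qed
  have "D \<le> e \<and> \<beta> * sqrt g * D \<le> e" if D: "0 \<le> D" "0 \<le> g" "D ^ 3 \<le> c1 * g" "\<beta> * g \<le> c2 * D" for D g
  proof (cases "D = 0")
    case True then show ?thesis using assms by simp
  next
    case False
    have "\<beta> * D ^ 3 \<le> \<beta> * (c1 * g)" using D \<beta>(1) by (intro mult_left_mono) auto
    also have "\<dots> = c1 * (\<beta> * g)" by simp
    also have "\<dots> \<le> c1 * (c2 * D)" using D assms by (intro mult_left_mono) auto
    finally have "(\<beta> * D\<^sup>2) * D \<le> c * D" by (simp add: c_def power2_eq_square power3_eq_cube mult_ac)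
    then have D2: "\<beta> * D\<^sup>2 \<le> c" using D False by simp
    then have "\<beta> * D\<^sup>2 \<le> \<beta> * e\<^sup>2" using \<beta>(2) by linarith
    then have "D\<^sup>2 \<le> e\<^sup>2" using \<beta>(1) by simp
    then have De: "D \<le> e" by (rule power2_le_imp_le) (use assms(3) in simp)
    define z where "z = \<beta> * sqrt g * D"
    have z0: "0 \<le> z" using D \<beta>(1) by (simp add: z_def)
    have "z\<^sup>2 = \<beta> * D\<^sup>2 * (\<beta> * g)" using D by (simp add: z_def power_mult_distrib) (simp add: power2_eq_square)
    also have "\<dots> \<le> \<beta> * D\<^sup>2 * (c2 * D)" using D \<beta>(1) by (intro mult_left_mono) auto
    finally have "(z\<^sup>2)\<^sup>2 \<le> (\<beta> * D\<^sup>2 * (c2 * D))\<^sup>2" by (intro power_mono) auto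
    then have "\<beta> * (z\<^sup>2)\<^sup>2 \<le> \<beta> * (\<beta> * D\<^sup>2 * (c2 * D))\<^sup>2" using \<beta>(1) by simp
    also have "\<dots> = c2\<^sup>2 * (\<beta> * D\<^sup>2) ^ 3" by (simp add: power2_eq_square power3_eq_cube)
    also have "\<dots> \<le> c2\<^sup>2 * c ^ 3" using D2 \<beta>(1) D by (intro mult_left_mono power_mono) auto
    also have "\<dots> \<le> \<beta> * e ^ 4" by (rule \<beta>(3))
    finally have "z ^ 4 \<le> e ^ 4" using \<beta>(1) by (simp add: power_mult[symmetric])
    then have "z \<le> e" using assms(3) by (simp add: power_mono_iff z0)
    then show ?thesis using De by (simp add: z_def)
  qed
  with \<beta>(1) that show ?thesis by blast
qed

text \<open>Hypothesis (H) in working form: continuity is for each control separately, while the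
  Lipschitz and growth constants are uniform in the control and refer to equal final times.\<close>

locale control_data =
  fixes T L :: real and F :: "'n::finite cadlag_path \<Rightarrow> 'u::metric_space \<Rightarrow> real ^ 'n"
    and q :: "'n cadlag_path \<Rightarrow> 'u \<Rightarrow> real"
  assumes T: "T > 0" and L: "L > 0"
    and cF: "\<And>u. continuous_on (cont_paths T 0) (\<lambda>p. F p u)"
    and cq: "\<And>u. continuous_on (cont_paths T 0) (\<lambda>p. q p u)"
    and lipF: "\<And>p p' u. p \<in> cont_paths T 0 \<Longrightarrow> p' \<in> cont_paths T 0 \<Longrightarrow> final_time p = final_time p' \<Longrightarrow>
      norm (F p u - F p' u) \<le> L * dist p p'"
    and lipq: "\<And>p p' u. p \<in> cont_paths T 0 \<Longrightarrow> p' \<in> cont_paths T 0 \<Longrightarrow> final_time p = final_time p' \<Longrightarrow>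
      \<bar>q p u - q p' u\<bar> \<le> L * dist p p'"
    and bF: "\<And>p u. p \<in> cont_paths T 0 \<Longrightarrow> norm (F p u) \<le> L * (1 + path_norm p)"
    and bq: "\<And>p u. p \<in> cont_paths T 0 \<Longrightarrow> \<bar>q p u\<bar> \<le> L * (1 + path_norm p)"
begin

text \<open>The growth bounds make the Hamiltonian a genuine infimum; a real \<open>INF\<close> over
  a set unbounded below would carry no information.\<close>

lemma bdd_below_hamiltonian:
  assumes "p \<in> cont_paths T 0"
  shows "bdd_below (range (\<lambda>u. v \<bullet> F p u + q p u))"
proof (rule bdd_belowI2)
  fix u
  have "\<bar>v \<bullet> F p u\<bar> \<le> norm v * norm (F p u)" by (rule Cauchy_Schwarz_ineq2)
  also have "\<dots> \<le> norm v * (L * (1 + path_norm p))"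
    using bF[OF assms] by (intro mult_left_mono) auto
  finally show "- (norm v * (L * (1 + path_norm p))) - L * (1 + path_norm p) \<le> v \<bullet> F p u + q p u"
    using bq[OF assms, of u] by linarith
qed

lemma hamiltonian_le: "p \<in> cont_paths T 0 \<Longrightarrow> hamiltonian F q p v \<le> v \<bullet> F p u + q p u"
  unfolding hamiltonian_def using bdd_below_hamiltonian by (intro cINF_lower) auto

lemma hamiltonian_approx:
  assumes "p \<in> cont_paths T 0" "e > 0"
  obtains u where "v \<bullet> F p u + q p u < hamiltonian F q p v + e"
proof -
  have "(INF u. v \<bullet> F p u + q p u) < hamiltonian F q p v + e"
    using assms(2) by (simp add: hamiltonian_def)
  then show ?thesis
    using that bdd_below_hamiltonian[OF assms(1)] by (subst (asm) cINF_less_iff) auto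
qed

text \<open>The vector is the gradient of the penalty. Since T + 1 - s \<ge> 1, its norm is at most
  2 \<beta> (T + 1) times the square root of the gap, and the Lipschitz bounds supply the factor
  \<open>dist p p'\<close>.\<close>

lemma penalty_error:
  assumes p: "p \<in> cont_paths T 0" "p' \<in> cont_paths T 0" and s: "final_time p = s" "final_time p' = s"
    and \<beta>: "\<beta> > 0" and e: "dist p p' \<le> e" "\<beta> * sqrt (sq_gap T p p') * dist p p' \<le> e"
  shows "((2 * \<beta> * (T + 1 - s)) *\<^sub>R (path_at p s - path_at p' s)) \<bullet> (F p u - F p' u) + (q p u - q p' u)
    \<le> L * (2 * (T + 1) + 1) * e"
proof -
  define G where "G = sq_gap T p p'"
  define D where "D = dist p p'"
  define P where "P = (2 * \<beta> * (T + 1 - s)) *\<^sub>R (path_at p s - path_at p' s)"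
  have sT: "0 \<le> s" "s \<le> T" using cont_paths_final_time[OF p(1)] s by auto
  have G: "0 \<le> G" by (simp add: G_def sq_gap_nonneg)
  have "(norm (path_at p s - path_at p' s))\<^sup>2 \<le> (T + 1 - s) * (norm (path_at p s - path_at p' s))\<^sup>2"
    using sT by (simp add: mult_le_cancel_right1)
  also have "\<dots> \<le> G"
    unfolding G_def using s sT by (intro final_sq_le_sq_gap)
  finally have "norm (path_at p s - path_at p' s) \<le> sqrt G" by (rule real_le_rsqrt)
  then have "norm P \<le> 2 * \<beta> * (T + 1) * sqrt G"
    unfolding P_def using \<beta> sT by (simp add: mult_mono abs_mult)
  then have "norm P * norm (F p u - F p' u) \<le> (2 * \<beta> * (T + 1) * sqrt G) * (L * D)"
    using lipF[OF p, of u] s \<beta> T G by (intro mult_mono) (auto simp: D_def)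
  moreover have "P \<bullet> (F p u - F p' u) \<le> norm P * norm (F p u - F p' u)" by (rule norm_cauchy_schwarz)
  moreover have "(2 * \<beta> * (T + 1) * sqrt G) * (L * D) = L * (2 * (T + 1)) * (\<beta> * sqrt G * D)" by simp
  moreover have "L * (2 * (T + 1)) * (\<beta> * sqrt G * D) \<le> L * (2 * (T + 1)) * e"
    using e L T by (intro mult_left_mono) (auto simp: D_def G_def)
  moreover have "L * D \<le> L * e" using e L by (simp add: D_def)
  moreover have "q p u - q p' u \<le> L * D" using lipq[OF p, of u] s by (simp add: D_def)
  moreover have "L * (2 * (T + 1) + 1) * e = L * (2 * (T + 1)) * e + L * e" by (simp add: algebra_simps)
  ultimately show ?thesis unfolding P_def by linarith
qed

text \<open>The infimum is at most its value at u, so W satisfies a transport inequality along u. It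
  is compared with the solution Y of the controlled equation, which at short range may be replaced
  by the straight continuation g, since Y has initial velocity \<open>F p u\<close>.\<close>

lemma subsolution_along_constant_control:
  fixes u :: 'u
  assumes sub: "viscosity_mu_subsolution T (hamiltonian F q) \<phi> \<mu> W"
    and K: "K > 0" and lipW: "\<And>p p'. p \<in> lipschitz_paths T 0 \<mu> R \<Longrightarrow> p' \<in> lipschitz_paths T 0 \<mu> R \<Longrightarrow>
      \<bar>W p - W p'\<bar> \<le> K * dist p p'"
    and \<mu>: "\<mu> \<ge> 1" "\<mu> \<ge> L" and R: "R > 0" and p: "p \<in> lipschitz_paths T 0 \<mu> R"
    and t: "final_time p = t" "t < T" and pR: "norm (path_at p t) < R" and e: "e > 0"
    and g_def: "\<And>r. g r = frozen p r + max 0 (r - t) *\<^sub>R F p u"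
  obtains \<delta> where "\<delta> > 0" "t + \<delta> < T"
    "\<And>s. t \<le> s \<Longrightarrow> s \<le> t + \<delta> \<Longrightarrow> mk_path s g \<in> lipschitz_paths T 0 \<mu> R \<and>
       W p \<le> W (mk_path s g) + (s - t) * (q p u + e)"
proof -
  define C where "C = \<mu> * (1 + R)"
  have C: "C \<ge> 0" "L * (1 + R) \<le> C" using \<mu> R by (auto simp: C_def)
  have t0: "0 \<le> t" using t final_time_nonneg[of p] by simp
  have pc: "p \<in> cont_paths T 0" using p by (rule lipschitz_pathsD(1))
  define v where "v = F p u"
  define Q where "Q = q p u"
  \<comment> \<open>Half of e pays for the comparison along Y; the other half, K e1 per unit time,
    pays for replacing Y by g.\<close>
  define e1 where "e1 = e / (2 * K)"
  have e1: "e1 > 0" "K * e1 = e / 2" using e K by (auto simp: e1_def)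
  \<comment> \<open>Y stays in the ball of radius R', which leaves room for a nearby contact point
    to lie strictly inside radius R.\<close>
  define R' where "R' = (norm (path_at p t) + R) / 2"
  have R': "norm (path_at p t) < R'" "R' < R" using pR by (auto simp: R'_def)
  obtain \<delta>1 Y y where \<delta>1: "\<delta>1 > 0" "t + \<delta>1 < T" and cY: "continuous_on UNIV Y" and cy: "continuous_on UNIV y"
    and Yle: "\<And>r. r \<le> t \<Longrightarrow> Y r = frozen p r"
    and Yge: "\<And>s. t \<le> s \<Longrightarrow> Y s = path_at p t + integral {t..s} y"
    and der: "\<And>s. t \<le> s \<Longrightarrow> (Y has_vector_derivative y s) (at_right s)"
    and y: "\<And>s. t \<le> s \<Longrightarrow> s \<le> t + \<delta>1 \<Longrightarrow> y s = F (mk_path s Y) u"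
  proof (rule path_dependent_ode[where F = "\<lambda>p. F p u", OF L cF lipF pc t])
    fix \<delta>1 Y y
    assume "\<delta>1 > 0" "t + \<delta>1 < T" "continuous_on UNIV Y" "continuous_on UNIV y"
      "\<And>r. r \<le> t \<Longrightarrow> Y r = frozen p r" "\<And>s. t \<le> s \<Longrightarrow> Y s = path_at p t + integral {t..s} y"
      "\<And>s. t \<le> s \<Longrightarrow> (Y has_vector_derivative y s) (at_right s)"
      "\<And>s. t \<le> s \<Longrightarrow> s \<le> t + \<delta>1 \<Longrightarrow> y s = F (mk_path s Y) u"
    then show thesis by (rule that)
  qed
  have cY': "continuous_on A Y" for A using cY continuous_on_subset by blast
  have cy': "continuous_on A y" for A using cy continuous_on_subset by blast
  have iy: "y integrable_on {a..b}" for a b by (rule integrable_continuous_real[OF cy'])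
  have cg: "continuous_on UNIV g"
    unfolding g_def by (intro continuous_intros continuous_on_frozen[OF pc])
  have cg': "continuous_on A g" for A using cg continuous_on_subset by blast
  have mkY: "mk_path s Y \<in> cont_paths T 0" if "t \<le> s" "s \<le> T" for s
    using that t0 cY' by (intro mk_path_cont_paths) auto
  have mkYt: "mk_path t Y = p"
    using mk_path_cong[of t Y "frozen p"] Yle mk_path_frozen[OF pc] t by simp
  have cmk: "continuous_on {t..T} (\<lambda>s. mk_path s Y)"
    by (rule continuous_on_mk_path[OF cY']) (use t0 in auto)
  have cq': "continuous_on {t..T} (\<lambda>s. q (mk_path s Y) u)"
    by (rule continuous_on_compose2[OF cq cmk]) (use mkY in auto)
  have limq: "((\<lambda>s. q (mk_path s Y) u) \<longlongrightarrow> Q) (at_right t)"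
    using continuous_on_Icc_at_rightD[OF cq' t(2)] by (simp add: mkYt Q_def)
  have Yt: "Y t = path_at p t" "g t = path_at p t"
    using Yle[of t] t t0 by (auto simp: frozen_def g_def)
  have yt: "y t = v" using y[of t] \<delta>1 mkYt by (simp add: v_def)
  have limy: "(y \<longlongrightarrow> v) (at_right t)"
    using continuous_on_Icc_at_rightD[OF cy' t(2)] yt by simp
  have limY: "(Y \<longlongrightarrow> path_at p t) (at_right t)"
    using continuous_on_Icc_at_rightD[OF cY' t(2)] Yt by simp
  have limg: "(g \<longlongrightarrow> path_at p t) (at_right t)"
    using continuous_on_Icc_at_rightD[OF cg' t(2)] Yt by simp
  have e4: "e / 4 > 0" using e by simp
  have "\<forall>\<^sub>F s in at_right t. \<bar>q (mk_path s Y) u - Q\<bar> < e / 4 \<and> norm (y s - v) < e1 \<and> norm (Y s) < R' \<and> norm (g s) < R'"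
    using tendstoD[OF limq e4] tendstoD[OF limy e1(1)] order_tendstoD(2)[OF tendsto_norm[OF limY] R'(1)]
      order_tendstoD(2)[OF tendsto_norm[OF limg] R'(1)]
    unfolding dist_real_def dist_norm by eventually_elim auto
  then obtain b where b: "b > t" and near: "\<And>s. t < s \<Longrightarrow> s < b \<Longrightarrow> \<bar>q (mk_path s Y) u - Q\<bar> < e / 4 \<and> norm (y s - v) < e1 \<and> norm (Y s) < R' \<and> norm (g s) < R'"
    unfolding eventually_at_right_field by blast
  define \<delta> where "\<delta> = min \<delta>1 ((b - t) / 2)"
  have \<delta>: "\<delta> > 0" "\<delta> \<le> \<delta>1" "t + \<delta> < b"
  proof -
    show "\<delta> > 0" using \<delta>1 b by (simp add: \<delta>_def)
    show "\<delta> \<le> \<delta>1" by (simp add: \<delta>_def)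
    have "\<delta> \<le> (b - t) / 2" unfolding \<delta>_def by (rule min.cobounded2)
    then show "t + \<delta> < b" using b by (simp add: field_simps)
  qed
  have near': "\<bar>q (mk_path s Y) u - Q\<bar> < e / 4 \<and> norm (y s - v) < e1 \<and> norm (Y s) < R' \<and> norm (g s) < R'"
    if "t \<le> s" "s \<le> t + \<delta>" for s
    using near[of s] that \<delta> e e1 R' Yt mkYt yt by (cases "s = t") (auto simp: Q_def)
  have nearR: "norm (Y s) \<le> R" "norm (g s) \<le> R" "s \<le> T" if "t \<le> s" "s \<le> t + \<delta>" for s
    using near'[OF that] R' that \<delta> \<delta>1 by linarith+
  have Ydiff: "Y r - Y l = integral {l..r} y" if "t \<le> l" "l \<le> r" for l r
    using Yge[of l] Yge[of r] that Henstock_Kurzweil_Integration.integral_combine[OF that iy] by (simp add: algebra_simps)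
  have YL: "mk_path s Y \<in> lipschitz_paths T 0 \<mu> R" if s: "t \<le> s" "s \<le> t + \<delta>" for s
  proof (rule lipschitz_paths_extend[OF p t(1)])
    have yb: "norm (y r) \<le> C" if r: "t \<le> r" "r \<le> t + \<delta>" for r
    proof -
      have "path_norm (mk_path r Y) \<le> R"
      proof (rule path_norm_leI)
        fix \<theta> assume "0 \<le> \<theta>" "\<theta> \<le> final_time (mk_path r Y)"
        then have \<theta>: "0 \<le> \<theta>" "\<theta> \<le> r" using r t0 cY' by auto
        then have "norm (Y \<theta>) \<le> R"
          using nearR(1)[of \<theta>] r Yle[of \<theta>] lipschitz_pathsD(2)[OF p, of \<theta>] by (cases "\<theta> \<le> t") auto
        then show "norm (path_at (mk_path r Y) \<theta>) \<le> R" using \<theta> cY' by (simp add: path_at_mk_path)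
      qed
      then have "L * (1 + path_norm (mk_path r Y)) \<le> L * (1 + R)" using L by simp
      then show ?thesis
        using bF[OF mkY[OF r(1) nearR(3)[OF r]], of u] y[of r] r \<delta> C by simp
    qed
    show "norm (Y l - Y r) \<le> \<mu> * (1 + R) * (r - l)" if lr: "t \<le> l" "l \<le> r" "r \<le> s" for l r
    proof -
      have "norm (integral {l..r} y) \<le> integral {l..r} (\<lambda>_. C)"
        using lr s by (intro integral_norm_bound_integral iy yb) auto
      then show ?thesis using lr Ydiff[of l r] norm_minus_commute[of "Y l" "Y r"] by (simp add: C_def mult_ac)
    qed
  qed (use s C cY Yle nearR[of s] nearR in \<open>auto simp: C_def\<close>)
  have gL: "mk_path s g \<in> lipschitz_paths T 0 \<mu> R" if s: "t \<le> s" "s \<le> t + \<delta>" for s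
  proof (rule lipschitz_paths_extend[OF p t(1)])
    have "L * (1 + path_norm p) \<le> L * (1 + R)" using L lipschitz_pathsD(3)[OF p] by simp
    then have vC: "norm v \<le> C" using bF[OF pc, of u] C by (simp add: v_def)
    show "norm (g l - g r) \<le> \<mu> * (1 + R) * (r - l)" if lr: "t \<le> l" "l \<le> r" "r \<le> s" for l r
    proof -
      have "g l - g r = (l - r) *\<^sub>R v"
        using lr t by (simp add: g_def v_def frozen_final algebra_simps)
      then have "norm (g l - g r) = (r - l) * norm v" using lr by simp
      also have "\<dots> \<le> (r - l) * C" using lr vC by (intro mult_left_mono) auto
      finally show ?thesis by (simp add: C_def mult_ac)
    qed
  qed (use s C cg nearR[of s] nearR in \<open>auto simp: C_def g_def[of r for r]\<close>)
  have main: "W p \<le> W (mk_path s1 Y) + (s1 - t) * (Q + e / 2)" if s1: "t \<le> s1" "s1 \<le> t + \<delta>" for s1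
  proof (rule ccontr)
    assume neg: "\<not> ?thesis"
    define k where "k = W p - (W (mk_path s1 Y) + (s1 - t) * (Q + e / 2))"
    have k: "k > 0" "W p = W (mk_path s1 Y) + (s1 - t) * (Q + e / 2) + k"
      using neg by (simp_all add: k_def)
    define M where "M = L * (2 * (T + 1) + 1)"
    have M: "0 < M" using L T by (simp add: M_def)
    \<comment> \<open>The three bounds serve, in order, to exclude a maximum at time s1, to keep the
      contact point inside the ball, and to make the penalty error smaller than e / 4.\<close>
    define e' where "e' = min (k / (2 * K)) (min ((R - R') / 2) (e / (8 * M)))"
    have e': "e' > 0" "K * e' < k" "e' < R - R'" "M * e' \<le> e / 8"
    proof -
      show "e' > 0" using k K R' e M by (simp add: e'_def)
      have le: "e' \<le> k / (2 * K)" "e' \<le> (R - R') / 2" "e' \<le> e / (8 * M)"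
        unfolding e'_def by (rule min.cobounded1, rule order_trans[OF min.cobounded2 min.cobounded1],
          rule order_trans[OF min.cobounded2 min.cobounded2])
      show "e' < R - R'" using le(2) R'(2) \<open>e' > 0\<close> by (simp add: field_simps)
      have "K * e' \<le> k / 2" using le(1) K by (simp add: field_simps)
      then show "K * e' < k" using k by linarith
      show "M * e' \<le> e / 8" using le(3) M by (simp add: field_simps)
    qed
    have nn: "0 \<le> 16 * \<mu> * (1 + R)" "0 \<le> K" using \<mu> R K by auto
    obtain \<beta> where \<beta>: "\<beta> > 0" and pen: "\<And>D g. 0 \<le> D \<Longrightarrow> 0 \<le> g \<Longrightarrow> D ^ 3 \<le> 16 * \<mu> * (1 + R) * g \<Longrightarrow> \<beta> * g \<le> K * D \<Longrightarrow> D \<le> e' \<and> \<beta> * sqrt g * D \<le> e'"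
      by (rule large_penalty[OF nn e'(1)]) (rule that; blast)
    define \<Psi> where "\<Psi> z = W z + (final_time z - t) * (Q + e / 2) - \<beta> * sq_gap T z (mk_path (final_time z) Y)" for z
    define S where "S = (lipschitz_paths s1 t \<mu> R :: 'n cadlag_path set)"
    have ST: "z \<in> lipschitz_paths T 0 \<mu> R" "t \<le> final_time z" "final_time z \<le> s1" if "z \<in> S" for z
      using that s1 t0 \<delta> \<delta>1 by (auto simp: S_def lipschitz_paths_def cont_paths_def cadlag_paths_def)
    have SI: "z \<in> S" if "z \<in> lipschitz_paths T r \<mu> R" "t \<le> final_time z" "final_time z \<le> s1" for z r
      using that by (auto simp: S_def lipschitz_paths_def cont_paths_def cadlag_paths_def)
    have "compact S" unfolding S_def using C by (intro compact_lipschitz_paths) (simp add: C_def)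
    moreover have "p \<in> S" using SI[OF p] t s1 by simp
    moreover have "continuous_on S \<Psi>"
    proof -
      have "continuous_on (cont_paths T 0) W" using sub by (simp add: viscosity_mu_subsolution_def)
      then have "continuous_on S W"
        by (rule continuous_on_subset) (use ST(1) lipschitz_pathsD(1) in blast)
      moreover have "continuous_on S (\<lambda>z. mk_path (final_time z) Y)"
        by (rule continuous_on_compose2[OF continuous_on_mk_path[OF cY' order_refl] continuous_on_final_time]) auto
      ultimately show ?thesis
        unfolding \<Psi>_def using T by (intro continuous_intros continuous_on_final_time) auto
    qed
    ultimately obtain m where m: "m \<in> S" "\<And>z. z \<in> S \<Longrightarrow> \<Psi> z \<le> \<Psi> m"
      using continuous_attains_sup[of S \<Psi>] by blast
    define s where "s = final_time m"
    define X where "X = mk_path s Y"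
    define D where "D = dist m X"
    define G where "G = sq_gap T m X"
    have s: "t \<le> s" "s \<le> s1" "s \<le> t + \<delta>" "s < T" "0 \<le> s" using ST[OF m(1)] s1 \<delta> \<delta>1 t0 by (auto simp: s_def)
    have mL: "m \<in> lipschitz_paths T 0 \<mu> R" using ST m by blast
    have mc: "m \<in> cont_paths T 0" using mL by (rule lipschitz_pathsD(1))
    have XL: "X \<in> lipschitz_paths T 0 \<mu> R" unfolding X_def using s by (intro YL) auto
    have Xc: "X \<in> cont_paths T 0" using XL by (rule lipschitz_pathsD(1))
    have ftX: "final_time X = s" using s cY' by (simp add: X_def)
    have "X \<in> S" using SI[OF XL] ftX s by simp
    \<comment> \<open>The competitor X carries no penalty and has the same time terms, so the
      penalty at m is at most W m - W X.\<close>
    then have "\<Psi> X \<le> \<Psi> m" by (rule m(2))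
    then have "W X \<le> W m - \<beta> * G"
      using ftX by (simp add: \<Psi>_def s_def[symmetric] X_def[symmetric] G_def)
    then have bG: "\<beta> * G \<le> K * D"
      using lipW[OF mL XL] by (simp add: D_def)
    have "0 \<le> G" by (simp add: G_def sq_gap_nonneg)
    moreover have "D ^ 3 \<le> 16 * \<mu> * (1 + R) * G"
      unfolding D_def G_def using ftX \<mu> R by (intro cube_dist_le_sq_gap mL XL) (auto simp: s_def)
    ultimately have D: "D \<le> e'" "\<beta> * sqrt G * D \<le> e'"
      using pen[of D G] bG by (auto simp: D_def)
    have \<Psi>m_eq: "\<Psi> m = W m + (s - t) * (Q + e / 2) - \<beta> * G"
      by (simp add: \<Psi>_def s_def[symmetric] X_def[symmetric] G_def)
    have \<Psi>m: "W p \<le> \<Psi> m"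
      using m(2)[OF \<open>p \<in> S\<close>] t mkYt by (simp add: \<Psi>_def)
    show False
    proof (cases "s = s1")
      case True
      have "W p \<le> W m + (s1 - t) * (Q + e / 2) - \<beta> * G"
        using \<Psi>m \<Psi>m_eq True by simp
      also have "\<dots> \<le> W X + K * D + (s1 - t) * (Q + e / 2)"
      proof -
        have "0 \<le> \<beta> * G" using \<beta> \<open>0 \<le> G\<close> by simp
        then show ?thesis using lipW[OF mL XL] by (simp add: D_def)
      qed
      finally have "k \<le> K * D" using k True by (simp add: X_def)
      also have "\<dots> \<le> K * e'" using D K by simp
      finally show False using e' by simp
    next
      case False
      with s have ss1: "s < s1" by simp
      have cW: "continuous_on (cont_paths T 0) W" using sub by (simp add: viscosity_mu_subsolution_def)
      obtain B where B: "\<And>z. z \<in> lipschitz_paths T 0 \<mu> R \<Longrightarrow> \<bar>W z\<bar> \<le> B"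
        using bounded_on_lipschitz_paths[OF cW C(1)[unfolded C_def]] by blast
      define N where "N = \<bar>Q + e / 2\<bar>"
      \<comment> \<open>Maximality of m is known only up to time s1, but a test functional must
        dominate W up to T. The term A (r - s)^2 has zero derivative at s and outweighs all other
        terms after s1.\<close>
      define A where "A = (2 * B + T * N) / (s1 - s)\<^sup>2"
      have B0: "0 \<le> B" using B[OF p] by linarith
      have A0: "0 \<le> A" using B0 T by (simp add: A_def N_def)
      define \<rho> where "\<rho> r = \<Psi> m - (r - t) * (Q + e / 2) + A * (r - s)\<^sup>2" for r
      define \<rho>' where "\<rho>' r = - (Q + e / 2) + 2 * A * (r - s)" for r
      define f where "f = gap_test T \<beta> Y \<rho>"
      define P where "P = (2 * \<beta> * (T + 1 - s)) *\<^sub>R (path_at m s - Y s)"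
      have \<rho>: "(\<rho> has_real_derivative \<rho>' r) (at_right r)" for r
        unfolding \<rho>_def \<rho>'_def by (auto intro!: derivative_eq_intros)
      have c: "continuous_on A \<rho>" "continuous_on A \<rho>'" for A
        unfolding \<rho>_def \<rho>'_def by (intro continuous_intros)+
      note D1 = gap_test_derivatives[OF s(5,4) cY der cy' \<rho> c, where a = \<beta>]
      have f1: "f \<in> C1_cadlag T (final_time m)"
        unfolding f_def s_def[symmetric] using s by (intro D1(1)) auto
      have f2: "horizontal_deriv T f m = \<rho>' s - P \<bullet> y s"
        unfolding f_def P_def using D1(2)[of m] s by (simp add: s_def[symmetric])
      have f3: "vertical_gradient f m = P"
        unfolding f_def P_def using D1(3)[of m] s by (simp add: s_def[symmetric])
      have "path_at m s - Y s = frozen m s - frozen X s"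
        using s cY' by (simp add: s_def frozen_eq) (simp add: X_def frozen_mk_path s_def)
      then have mY: "norm (path_at m s - Y s) \<le> D" using norm_frozen_diff_le[of m s X] by (simp add: D_def)
      have "norm (Y s) < R'" using near' s by blast
      then have mR: "norm (path_at m (final_time m)) < R"
        using mY D e' norm_triangle_ineq2[of "path_at m s" "Y s"] by (simp add: s_def[symmetric])
      have eq: "W m = f m"
        by (simp add: f_def gap_test_def \<rho>_def \<Psi>_def s_def[symmetric])
      have le: "W z \<le> f z" if z: "z \<in> lipschitz_paths T (final_time m) \<mu> R" for z
      proof -
        define r where "r = final_time z"
        have r: "s \<le> r" "r \<le> T" using cont_paths_final_time[OF lipschitz_pathsD(1)[OF z]] by (auto simp: s_def r_def)
        have fz: "f z = \<Psi> m - (r - t) * (Q + e / 2) + A * (r - s)\<^sup>2 + \<beta> * sq_gap T z (mk_path r Y)"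
          by (simp add: f_def gap_test_def \<rho>_def r_def)
        have zL: "z \<in> lipschitz_paths T 0 \<mu> R" using z by (rule lipschitz_paths_mono_time) simp
        show ?thesis
        proof (cases "r \<le> s1")
          case True
          then have "\<Psi> z \<le> \<Psi> m" using z r s by (intro m(2) SI[OF z]) (auto simp: r_def)
          moreover have "0 \<le> A * (r - s)\<^sup>2" using A0 by simp
          ultimately show ?thesis unfolding fz by (simp add: \<Psi>_def r_def[symmetric])
        next
          case False
          have "A * (s1 - s)\<^sup>2 \<le> A * (r - s)\<^sup>2"
            using False ss1 A0 by (intro mult_left_mono power_mono) auto
          moreover have "A * (s1 - s)\<^sup>2 = 2 * B + T * N" using ss1 by (simp add: A_def)
          moreover have "(r - t) * (Q + e / 2) \<le> (r - t) * N"
            using r s by (intro mult_left_mono) (auto simp: N_def)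
          moreover have "(r - t) * N \<le> T * N" using r t0 by (intro mult_right_mono) (auto simp: N_def)
          moreover have "0 \<le> \<beta> * sq_gap T z (mk_path r Y)" using \<beta> by (simp add: sq_gap_nonneg)
          ultimately show ?thesis unfolding fz using \<Psi>m B[OF p] B[OF zL] by linarith
        qed
      qed
      have "0 \<le> horizontal_deriv T f m + hamiltonian F q m (vertical_gradient f m)"
        using s by (intro subsolution_test[OF sub R mL _ mR f1 eq le]) (auto simp: s_def)
      also have "\<dots> \<le> \<rho>' s - P \<bullet> y s + (P \<bullet> F m u + q m u)"
        unfolding f2 f3 using hamiltonian_le[OF mc] by simp
      \<comment> \<open>The moving reference contributes -P . y(s), and y(s) = F(X, u), so F enters
        only through a difference at equal times.\<close>
      also have "\<dots> = - (Q + e / 2) + P \<bullet> (F m u - F X u) + q m u"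
        using y[of s] s \<delta> by (simp add: \<rho>'_def X_def inner_diff_right)
      finally have 1: "0 \<le> - (Q + e / 2) + P \<bullet> (F m u - F X u) + q m u" .
      have 2: "q X u \<le> Q + e / 4" using near'[OF s(1,3)] unfolding X_def by linarith
      have "P \<bullet> (F m u - F X u) + (q m u - q X u) \<le> M * e'"
        using penalty_error[OF mc Xc s_def[symmetric] ftX \<beta>, of e' u] D s cY'
        by (simp add: P_def M_def D_def G_def X_def path_at_mk_path)
      then show False using 1 2 e e'(4) by linarith
    qed
  qed
  have "mk_path s g \<in> lipschitz_paths T 0 \<mu> R \<and> W p \<le> W (mk_path s g) + (s - t) * (q p u + e)"
    if s: "t \<le> s" "s \<le> t + \<delta>" for s
  proof
    show "mk_path s g \<in> lipschitz_paths T 0 \<mu> R" using s by (rule gL)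
    have s0: "0 \<le> s" using s t0 by simp
    \<comment> \<open>Up to time t the two paths agree; afterwards their velocities differ by at
      most e1.\<close>
    have "dist (mk_path s Y) (mk_path s g) \<le> 0 + (s - t) * e1"
    proof (rule order_trans[OF dist_path_leI])
      fix r assume "0 \<le> r" "r \<le> max (final_time (mk_path s Y)) (final_time (mk_path s g))"
      then have r: "0 \<le> r" "r \<le> s" using s0 cY' cg' by auto
      have "norm (Y r - g r) \<le> (s - t) * e1"
      proof (cases "r \<le> t")
        case True then show ?thesis using Yle[of r] s e1 by (simp add: g_def)
      next
        case False
        then have "Y r - g r = integral {t..r} y - integral {t..r} (\<lambda>_. v)"
          using Yge[of r] t by (simp add: g_def frozen_final v_def)
        also have "\<dots> = integral {t..r} (\<lambda>\<theta>. y \<theta> - v)"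
          by (intro integral_diff[symmetric] iy integrable_const_ivl)
        finally have "Y r - g r = integral {t..r} (\<lambda>\<theta>. y \<theta> - v)" .
        moreover have "norm (y \<theta> - v) \<le> e1" if "\<theta> \<in> {t..r}" for \<theta>
          using near'[of \<theta>] that r s by simp
        then have "norm (integral {t..r} (\<lambda>\<theta>. y \<theta> - v)) \<le> integral {t..r} (\<lambda>_. e1)"
          by (intro integral_norm_bound_integral integrable_diff iy integrable_const_ivl)
        ultimately have "norm (Y r - g r) \<le> integral {t..r} (\<lambda>_. e1)" by simp
        also have "\<dots> \<le> (s - t) * e1" using False r e1 by (simp add: mult_right_mono)
        finally show ?thesis .
      qed
      then show "norm (frozen (mk_path s Y) r - frozen (mk_path s g) r) \<le> (s - t) * e1"
        using r s0 cY' cg' by (simp add: frozen_mk_path)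
    qed (use s0 cY' cg' in auto)
    then have "K * dist (mk_path s Y) (mk_path s g) \<le> K * ((s - t) * e1)" using K by simp
    also have "\<dots> = (s - t) * (K * e1)" by simp
    finally have "W (mk_path s Y) \<le> W (mk_path s g) + (s - t) * (e / 2)"
      using lipW[OF YL gL, OF s s] e1 by auto
    moreover have "(s - t) * (q p u + e) = (s - t) * (Q + e / 2) + (s - t) * (e / 2)"
      by (simp add: Q_def field_simps)
    ultimately show "W p \<le> W (mk_path s g) + (s - t) * (q p u + e)"
      using main[OF s] by linarith
  qed
  with \<delta> \<delta>1 that show ?thesis by auto
qed

end

section \<open>Comparison on short time intervals\<close>

lemma sq_gap_commute: "sq_gap T p q = sq_gap T q p"
  by (simp add: sq_gap_def norm_minus_commute)

lemma has_vector_derivative_affine_extension: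
  fixes g :: "'n::finite cadlag_path"
  assumes "final_time g \<le> r"
  shows "((\<lambda>r. frozen g r + max 0 (r - final_time g) *\<^sub>R v) has_vector_derivative v) (at_right r)"
proof -
  have "((\<lambda>r. path_at g (final_time g) + (r - final_time g) *\<^sub>R v) has_vector_derivative v) (at r within {r..r+1})"
    by (auto intro!: derivative_eq_intros)
  then have "((\<lambda>r. frozen g r + max 0 (r - final_time g) *\<^sub>R v) has_vector_derivative v) (at r within {r..r+1})"
    by (rule has_vector_derivative_transform[rotated 2]) (use assms in \<open>auto simp: frozen_final\<close>)
  then show ?thesis by (simp add: at_within_Icc_at_right)
qed

text \<open>The exponential is a barrier that stays below \<open>exp (- k)\<close> at the starting path, exceeds
  \<open>exp k\<close> before the final value reaches the boundary of the ball of radius \<open>R\<close>, and decreases along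
  the controlled dynamics, whose speed is at most \<open>L (1 + R)\<close>. Subsolution and supersolution are compared
  at equal times, because the Hamiltonian is only upper semicontinuous in time when \<open>U\<close> is not compact.\<close>

lemma (in control_data) comparison_step:
  assumes sub: "viscosity_mu_subsolution T (hamiltonian F q) \<phi> \<mu> W1"
    and super: "viscosity_mu_supersolution T (hamiltonian F q) \<phi> \<mu> W2"
    and K: "K > 0"
    and lip1: "\<And>p p'. p \<in> lipschitz_paths T 0 \<mu> R \<Longrightarrow> p' \<in> lipschitz_paths T 0 \<mu> R \<Longrightarrow>
      \<bar>W1 p - W1 p'\<bar> \<le> K * dist p p'"
    and lip2: "\<And>p p'. p \<in> lipschitz_paths T 0 \<mu> R \<Longrightarrow> p' \<in> lipschitz_paths T 0 \<mu> R \<Longrightarrow>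
      \<bar>W2 p - W2 p'\<bar> \<le> K * dist p p'"
    and \<mu>: "\<mu> \<ge> 1" "\<mu> \<ge> L" and M: "M \<ge> 0" and R_def: "R = 4 + 2 * M"
    and p0: "p0 \<in> lipschitz_paths T 0 \<mu> R" "final_time p0 = t0" "norm (path_at p0 t0) \<le> M"
    and t1: "t0 < t1" "t1 \<le> T" "t1 - t0 \<le> 1 / (16 * L)"
    and terminal: "\<And>z. z \<in> cont_paths T 0 \<Longrightarrow> final_time z = t1 \<Longrightarrow> W1 z \<le> W2 z"
  shows "W1 p0 \<le> W2 p0"
proof (rule ccontr)
  assume neg: "\<not> W1 p0 \<le> W2 p0"
  define m where "m = W1 p0 - W2 p0"
  have m: "m > 0" using neg by (simp add: m_def)
  have R: "R > 0" using M by (simp add: R_def)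
  have C: "0 \<le> \<mu> * (1 + R)" using \<mu> R by simp
  have t0: "0 \<le> t0" using p0(2) final_time_nonneg[of p0] by simp
  have cW: "continuous_on (cont_paths T 0) W1" "continuous_on (cont_paths T 0) W2"
    using sub super by (simp_all add: viscosity_mu_subsolution_def viscosity_mu_supersolution_def)
  obtain B1 B2 where B12: "\<And>z. z \<in> lipschitz_paths T 0 \<mu> R \<Longrightarrow> \<bar>W1 z\<bar> \<le> B1"
    "\<And>z. z \<in> lipschitz_paths T 0 \<mu> R \<Longrightarrow> \<bar>W2 z\<bar> \<le> B2"
    using bounded_on_lipschitz_paths[OF cW(1) C] bounded_on_lipschitz_paths[OF cW(2) C] by blast
  define B where "B = max B1 B2"
  have B: "\<bar>W1 z\<bar> \<le> B" "\<bar>W2 z\<bar> \<le> B" if "z \<in> lipschitz_paths T 0 \<mu> R" for z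
    using B12[OF that] by (auto simp: B_def)
  have B0: "0 \<le> B" using B(1)[OF p0(1)] by linarith
  \<comment> \<open>Inside the ball, |x|^2 grows at rate at most 2 R L (1 + R), so the exponent of
    the barrier does not increase.\<close>
  define c where "c = 2 * R * (L * (1 + R))"
  define b where "b = M\<^sup>2 + 1"
  \<comment> \<open>Since exp k \<ge> 1 + k, this beats both 2 B and 4 / m.\<close>
  define k where "k = 2 * B + 1 + 4 / m"
  have k: "k > 0" "2 * B < exp k" "exp (- k) < m / 4"
  proof -
    have "0 < 4 / m" using m by simp
    then show "k > 0" using B0 unfolding k_def by linarith
    have ek: "1 + k \<le> exp k" by (rule exp_ge_add_one_self)
    then show "2 * B < exp k" using \<open>0 < 4 / m\<close> unfolding k_def by linarith
    have "4 / m < exp k" using ek B0 unfolding k_def by linarith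
    then show "exp (- k) < m / 4" using m by (simp add: exp_minus field_simps)
  qed
  define Bf where "Bf s x = exp (k * ((norm x)\<^sup>2 - c * (s - t0) - b))" for s and x :: "real ^ 'n"
  \<comment> \<open>The linear term in time costs at most m / 4 over the interval and supplies the
    strict inequality that is contradicted at the end.\<close>
  define \<theta> where "\<theta> = m / 4 / (t1 - t0)"
  have "\<theta> > 0" using m t1 by (simp add: \<theta>_def)
  moreover have "\<theta> * (t1 - t0) = m / 4"
    by (rule iffD1[OF nonzero_eq_divide_eq \<theta>_def]) (use t1 in simp)
  ultimately have \<theta>: "\<theta> > 0" "\<theta> * (t1 - t0) = m / 4" by blast+
  define N where "N = L * (2 * (T + 1) + 1)"
  have N: "N > 0" using L T by (simp add: N_def)
  \<comment> \<open>In order: excluding contact at t1, keeping h inside the ball, and bounding the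
    penalty error by \<theta> / 4.\<close>
  define e' where "e' = min (m / (4 * K)) (min (1 / 2) (\<theta> / (4 * N)))"
  have e': "e' > 0" "K * e' < m / 2" "e' < 1" "N * e' \<le> \<theta> / 4"
  proof -
    show "e' > 0" using m K \<theta> N by (simp add: e'_def)
    have le: "e' \<le> m / (4 * K)" "e' \<le> 1 / 2" "e' \<le> \<theta> / (4 * N)"
      unfolding e'_def by (rule min.cobounded1, rule order_trans[OF min.cobounded2 min.cobounded1],
        rule order_trans[OF min.cobounded2 min.cobounded2])
    have "K * e' \<le> m / 4" using le(1) K by (simp add: field_simps)
    then show "K * e' < m / 2" using m by linarith
    show "e' < 1" using le(2) by linarith
    show "N * e' \<le> \<theta> / 4" using le(3) N by (simp add: field_simps)
  qed
  have nn: "0 \<le> 16 * \<mu> * (1 + R)" "0 \<le> K" using \<mu> R K by auto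
  obtain \<beta> where \<beta>: "\<beta> > 0" and pen: "\<And>D g. 0 \<le> D \<Longrightarrow> 0 \<le> g \<Longrightarrow> D ^ 3 \<le> 16 * \<mu> * (1 + R) * g \<Longrightarrow> \<beta> * g \<le> K * D \<Longrightarrow> D \<le> e' \<and> \<beta> * sqrt g * D \<le> e'"
    by (rule large_penalty[OF nn e'(1)]) (rule that; blast)
  define \<Psi> where "\<Psi> = (\<lambda>(g, h). W1 g - W2 h - \<beta> * sq_gap T g h - Bf (final_time g) (frozen g T) - \<theta> * (t1 - final_time g))"
  define S where "S = (lipschitz_paths t1 t0 \<mu> R \<times> lipschitz_paths t1 t0 \<mu> R) \<inter>
    {z :: 'n cadlag_path \<times> 'n cadlag_path. final_time (fst z) = final_time (snd z)}"
  have SI: "(g, h) \<in> S" if "g \<in> lipschitz_paths T r \<mu> R" "h \<in> lipschitz_paths T r' \<mu> R"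
    "final_time g = s" "final_time h = s" "t0 \<le> s" "s \<le> t1" for g h r r' s
    using that by (auto simp: S_def lipschitz_paths_def cont_paths_def cadlag_paths_def)
  have SD: "g \<in> lipschitz_paths T 0 \<mu> R" "h \<in> lipschitz_paths T 0 \<mu> R" "final_time g = final_time h"
    "t0 \<le> final_time g" "final_time g \<le> t1" if "(g, h) \<in> S" for g h
    using that t0 t1 by (auto simp: S_def lipschitz_paths_def cont_paths_def cadlag_paths_def)
  have "compact S"
    unfolding S_def
  proof (intro compact_Int_closed compact_Times compact_lipschitz_paths C)
    show "closed {z :: 'n cadlag_path \<times> 'n cadlag_path. final_time (fst z) = final_time (snd z)}"
      by (intro closed_Collect_eq continuous_on_compose2[OF continuous_on_final_time[of UNIV]] continuous_intros) auto
  qed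
  moreover have p0S: "(p0, p0) \<in> S" using SI[OF p0(1) p0(1)] p0 t1 by simp
  moreover have "continuous_on S \<Psi>"
  proof -
    have S: "fst ` S \<subseteq> cont_paths T 0" "snd ` S \<subseteq> cont_paths T 0"
      using SD(1,2) lipschitz_pathsD(1) by fastforce+
    note fs = continuous_on_fst[OF continuous_on_id] continuous_on_snd[OF continuous_on_id]
    have "continuous_on S (\<lambda>z. W1 (fst z))" "continuous_on S (\<lambda>z. W2 (snd z))"
      by (rule continuous_on_compose2[OF cW(1) fs(1) S(1)], rule continuous_on_compose2[OF cW(2) fs(2) S(2)])
    moreover have "continuous_on S (\<lambda>z. final_time (fst z))" "continuous_on S (\<lambda>z. frozen (fst z) T)"
      by (rule continuous_on_compose2[OF continuous_on_final_time fs(1) subset_UNIV],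
          rule continuous_on_compose2[OF continuous_on_frozen_at fs(1) subset_UNIV])
    ultimately show ?thesis
      unfolding \<Psi>_def case_prod_beta Bf_def using T by (intro continuous_intros) auto
  qed
  ultimately obtain z where z: "z \<in> S" "\<And>z'. z' \<in> S \<Longrightarrow> \<Psi> z' \<le> \<Psi> z"
    using continuous_attains_sup[of S \<Psi>] by blast
  obtain g h where gh: "z = (g, h)" by (cases z)
  define s where "s = final_time g"
  define x where "x = path_at g s"
  define G where "G = sq_gap T g h"
  define D where "D = dist g h"
  have gL: "g \<in> lipschitz_paths T 0 \<mu> R" and hL: "h \<in> lipschitz_paths T 0 \<mu> R"
    and fh: "final_time h = s" and s: "t0 \<le> s" "s \<le> t1"
    using SD[of g h] z(1) by (auto simp: gh s_def)
  have s0: "0 \<le> s" "s \<le> T" using s t0 t1 by auto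
  have gc: "g \<in> cont_paths T 0" and hc: "h \<in> cont_paths T 0"
    using gL hL lipschitz_pathsD(1) by blast+
  have fx: "frozen g r = x" if "s \<le> r" for r using that by (simp add: frozen_final s_def x_def)
  have \<Psi>z: "\<Psi> z = W1 g - W2 h - \<beta> * G - Bf s x - \<theta> * (t1 - s)"
    using fx s0 by (simp add: \<Psi>_def gh s_def[symmetric] G_def)
  have "(g, g) \<in> S" using SI[OF gL gL] s by (simp add: s_def)
  \<comment> \<open>The barrier and the time term depend only on the first path, so they cancel
    against the diagonal pair.\<close>
  then have "\<Psi> (g, g) \<le> \<Psi> z" by (rule z(2))
  moreover have "\<Psi> (g, g) = W1 g - W2 g - Bf s x - \<theta> * (t1 - s)"
    using fx s0 by (simp add: \<Psi>_def s_def[symmetric])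
  ultimately have "\<beta> * G \<le> W2 g - W2 h" by (simp add: \<Psi>z)
  then have bG: "\<beta> * G \<le> K * D" using lip2[OF gL hL] by (simp add: D_def)
  have G0: "0 \<le> G" by (simp add: G_def sq_gap_nonneg)
  moreover have "D ^ 3 \<le> 16 * \<mu> * (1 + R) * G"
    unfolding D_def G_def using \<mu> R fh by (intro cube_dist_le_sq_gap gL hL) (auto simp: s_def)
  ultimately have D: "D \<le> e'" "\<beta> * sqrt G * D \<le> e'"
    using pen[of D G] bG by (auto simp: D_def)
  have "m / 2 < \<Psi> (p0, p0)"
  proof -
    have "(norm (path_at p0 t0))\<^sup>2 \<le> M\<^sup>2" using p0(3) by (intro power_mono) auto
    then have "k * ((norm (path_at p0 t0))\<^sup>2 - b) \<le> k * (- 1)"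
      using k(1) by (intro mult_left_mono) (auto simp: b_def)
    then have "Bf t0 (path_at p0 t0) \<le> exp (- k)" by (simp add: Bf_def)
    moreover have "frozen p0 T = path_at p0 t0" using p0(2) t1 by (simp add: frozen_final)
    ultimately show ?thesis
      using p0(2) k(3) \<theta>(2) by (simp add: \<Psi>_def m_def)
  qed
  then have \<Psi>m: "m / 2 < \<Psi> z" using z(2)[OF p0S] by linarith
  have bG0: "0 \<le> \<beta> * G" using \<beta> G0 by simp
  have Bf0: "0 < Bf r y" for r y by (simp add: Bf_def)
  have \<theta>s: "0 \<le> \<theta> * (t1 - s)" using \<theta> s by simp
  have st1: "s < t1"
  proof (rule ccontr)
    assume "\<not> ?thesis"
    with s have "s = t1" by simp
    then have "W1 g \<le> W2 g" using gc by (intro terminal) (auto simp: s_def)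
    then have "\<Psi> z \<le> W2 g - W2 h" unfolding \<Psi>z using bG0 Bf0[of s x] \<theta>s by linarith
    also have "\<dots> \<le> K * D" using lip2[OF gL hL] by (simp add: D_def)
    also have "\<dots> \<le> K * e'" using D K by simp
    finally show False using \<Psi>m e' by linarith
  qed
  have sT: "s < T" using st1 t1 by simp
  \<comment> \<open>On an interval of length 1 / (16 L) the barrier loses at most R (1 + R) / 8,
    less than the gain in (R - 1)^2. Hence R = 4 + 2 M works for every M without shortening the
    interval. The margin 1 is for the second path, closer than e' < 1.\<close>
  have xR: "norm x < R - 1"
  proof -
    have "Bf s x < exp k"
      using \<Psi>m m bG0 \<theta>s B(1)[OF gL] B(2)[OF hL] k(2) unfolding \<Psi>z by linarith
    then have 1: "(norm x)\<^sup>2 - c * (s - t0) - b < 1" using k(1) by (simp add: Bf_def)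
    have "c * (s - t0) \<le> c * (1 / (16 * L))"
      using s t1 R L by (intro mult_left_mono) (auto simp: c_def)
    also have "\<dots> = R * (1 + R) / 8" using L by (simp add: c_def)
    finally have "(norm x)\<^sup>2 < 1 + b + R * (1 + R) / 8" using 1 by linarith
    also have "\<dots> \<le> (R - 1)\<^sup>2"
    proof -
      have "0 \<le> M\<^sup>2" by simp
      then show ?thesis using M by (simp add: R_def b_def power2_eq_square algebra_simps)
    qed
    finally show ?thesis using R_def M by (intro power2_less_imp_less[of "norm x" "R - 1"]) auto
  qed
  have hR: "norm (path_at h (final_time h)) < R"
  proof -
    have "norm (x - path_at h s) \<le> D"
      using norm_frozen_diff_le[of g s h] fx[of s] fh s0 by (simp add: D_def frozen_eq norm_minus_commute)
    then show ?thesis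
      using xR D e' norm_triangle_ineq2[of "path_at h s" x] fh by (simp add: norm_minus_commute)
  qed
  define P where "P = (2 * \<beta> * (T + 1 - s)) *\<^sub>R (x - path_at h s)"
  \<comment> \<open>The error e enters twice, through the near-optimal control and through the
    motion along it; 2 e = \<theta> / 4 together with the penalty error \<theta> / 4 stays below
    \<theta>.\<close>
  define e where "e = \<theta> / 8"
  have e: "e > 0" using \<theta> by (simp add: e_def)
  obtain u where u: "P \<bullet> F h u + q h u < hamiltonian F q h P + e"
    using hamiltonian_approx[OF hc e] by blast
  define v where "v = F g u"
  define Q where "Q = q g u"
  define Y where "Y r = frozen g r + max 0 (r - s) *\<^sub>R v" for r
  have gR: "norm (path_at g s) < R" using xR by (simp add: x_def)
  obtain \<delta>1 where \<delta>1: "\<delta>1 > 0" "s + \<delta>1 < T" and along: "\<And>r. s \<le> r \<Longrightarrow> r \<le> s + \<delta>1 \<Longrightarrow>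
      mk_path r Y \<in> lipschitz_paths T 0 \<mu> R \<and> W1 g \<le> W1 (mk_path r Y) + (r - s) * (Q + e)"
    by (rule subsolution_along_constant_control[OF sub K lip1 \<mu> R gL s_def[symmetric] sT gR e, of Y u])
      (auto simp: Y_def v_def Q_def intro: that)
  define \<delta> where "\<delta> = min \<delta>1 (t1 - s)"
  have \<delta>: "\<delta> > 0" "\<delta> \<le> \<delta>1" "s + \<delta> \<le> t1" using \<delta>1 st1 by (auto simp: \<delta>_def)
  have cY: "continuous_on UNIV Y"
    unfolding Y_def by (intro continuous_intros continuous_on_frozen[OF gc])
  have cY': "continuous_on X Y" for X using cY continuous_on_subset by blast
  have derY: "(Y has_vector_derivative v) (at_right r)" if "s \<le> r" for r
    using has_vector_derivative_affine_extension[of g r v] that unfolding Y_def s_def by simp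
  have Ys: "Y r = x + (r - s) *\<^sub>R v" if "s \<le> r" for r using that fx[of r] by (simp add: Y_def)
  define c0 where "c0 = \<Psi> z - W1 g"
  define A where "A = (2 * B + T * \<bar>Q + e\<bar> + \<theta> * T) / \<delta>\<^sup>2"
  have A0: "0 \<le> A" using B0 T \<theta> by (simp add: A_def)
  \<comment> \<open>For a path \<eta> ending at r, the maximum is tested against the pair of g
    continued along v up to r and \<eta>. Bounding W1 there from below by W1 g - (r - s) (Q + e)
    leaves exactly these terms; A again handles times after s + \<delta>.\<close>
  define \<rho> where "\<rho> r = c0 + (r - s) * (Q + e) + Bf r (x + (r - s) *\<^sub>R v) + \<theta> * (t1 - r) + A * (r - s)\<^sup>2" for r
  define \<rho>' where "\<rho>' r = (Q + e) + Bf r (x + (r - s) *\<^sub>R v) * (k * (2 * ((x + (r - s) *\<^sub>R v) \<bullet> v) - c)) - \<theta> + 2 * A * (r - s)" for r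
  define f where "f = gap_test T \<beta> Y \<rho>"
  have d\<rho>: "(\<rho> has_real_derivative \<rho>' r) (at_right r)" for r
  proof -
    have expand: "(norm (x + (r - s) *\<^sub>R v))\<^sup>2 = (norm x)\<^sup>2 + 2 * (r - s) * (x \<bullet> v) + (r - s)\<^sup>2 * (v \<bullet> v)" for r
      unfolding power2_norm_eq_inner
      by (simp add: inner_add_left inner_add_right inner_commute power2_eq_square)
    have "((\<lambda>r. (norm x)\<^sup>2 + 2 * (r - s) * (x \<bullet> v) + (r - s)\<^sup>2 * (v \<bullet> v)) has_real_derivative
      2 * (x \<bullet> v) + 2 * (r - s) * (v \<bullet> v)) (at_right r)"
      by (auto intro!: derivative_eq_intros)
    then have sq: "((\<lambda>r. (norm (x + (r - s) *\<^sub>R v))\<^sup>2) has_real_derivative 2 * ((x + (r - s) *\<^sub>R v) \<bullet> v)) (at_right r)"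
      unfolding expand by (rule DERIV_cong) (simp add: inner_add_left)
    show ?thesis
      unfolding \<rho>_def \<rho>'_def Bf_def
      by (rule derivative_eq_intros sq refl | simp)+
  qed
  have c\<rho>: "continuous_on X \<rho>" "continuous_on X \<rho>'" for X
    unfolding \<rho>_def \<rho>'_def Bf_def by (intro continuous_intros)+
  note D1 = gap_test_derivatives[OF s0(1) sT cY derY continuous_on_const d\<rho> c\<rho>, where a = \<beta>]
  have f1: "f \<in> C1_cadlag T (final_time h)"
    unfolding f_def fh by (intro D1(1)) auto
  have f2: "horizontal_deriv T f h = \<rho>' s + P \<bullet> v"
  proof -
    have "horizontal_deriv T f h = \<rho>' s - 2 * \<beta> * (T + 1 - s) * ((path_at h s - Y s) \<bullet> v)"
      unfolding f_def using D1(2)[of h] sT by (simp add: fh)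
    then show ?thesis using Ys[of s] by (simp add: P_def inner_diff_left algebra_simps)
  qed
  have f3: "vertical_gradient f h = - P"
  proof -
    have "vertical_gradient f h = (2 * \<beta> * (T + 1 - s)) *\<^sub>R (path_at h s - Y s)"
      unfolding f_def using D1(3)[of h] sT by (simp add: fh)
    then show ?thesis using Ys[of s] by (simp add: P_def scaleR_right_diff_distrib)
  qed
  have mkYs: "mk_path s Y = g"
    using mk_path_cong[of s Y "frozen g"] mk_path_frozen[OF gc] by (simp add: Y_def s_def)
  have eq: "W2 h = - f h"
    using mkYs fh by (simp add: f_def gap_test_def \<rho>_def c0_def \<Psi>z G_def sq_gap_commute[of T h])
  have le: "- f \<eta> \<le> W2 \<eta>" if \<eta>: "\<eta> \<in> lipschitz_paths T (final_time h) \<mu> R" for \<eta>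
  proof -
    define r where "r = final_time \<eta>"
    have r: "s \<le> r" "r \<le> T" using cont_paths_final_time[OF lipschitz_pathsD(1)[OF \<eta>]] fh by (auto simp: r_def)
    have f\<eta>: "f \<eta> = \<beta> * sq_gap T \<eta> (mk_path r Y) + \<rho> r"
      by (simp add: f_def gap_test_def r_def)
    have \<eta>L: "\<eta> \<in> lipschitz_paths T 0 \<mu> R" using \<eta> by (rule lipschitz_paths_mono_time) simp
    have A2: "0 \<le> A * (r - s)\<^sup>2" using A0 by simp
    show ?thesis
    proof (cases "r \<le> s + \<delta>")
      case True
      define z' where "z' = mk_path r Y"
      have z'L: "z' \<in> lipschitz_paths T 0 \<mu> R" and Wz': "W1 g \<le> W1 z' + (r - s) * (Q + e)"
        using along[of r] r True \<delta> by (auto simp: z'_def)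
      have fz': "final_time z' = r" using r s0 cY' by (simp add: z'_def)
      have "(z', \<eta>) \<in> S" using SI[OF z'L \<eta> fz'] r True \<delta> s by (simp add: r_def)
      then have "\<Psi> (z', \<eta>) \<le> \<Psi> z" by (rule z(2))
      moreover have "frozen z' T = x + (r - s) *\<^sub>R v"
        using r s0 cY' Ys[of r] T by (simp add: z'_def frozen_mk_path)
      ultimately have "W1 z' - W2 \<eta> - \<beta> * sq_gap T \<eta> z' - Bf r (x + (r - s) *\<^sub>R v) - \<theta> * (t1 - r) \<le> \<Psi> z"
        using fz' by (simp add: \<Psi>_def sq_gap_commute[of T z'])
      then show ?thesis using Wz' A2 unfolding f\<eta> \<rho>_def c0_def z'_def[symmetric] by linarith
    next
      case False
      have "A * \<delta>\<^sup>2 \<le> A * (r - s)\<^sup>2"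
        using False \<delta> A0 by (intro mult_left_mono power_mono) auto
      moreover have "A * \<delta>\<^sup>2 = 2 * B + T * \<bar>Q + e\<bar> + \<theta> * T" using \<delta> by (simp add: A_def)
      moreover have "(r - s) * - (Q + e) \<le> (r - s) * \<bar>Q + e\<bar>" using r by (intro mult_left_mono) auto
      moreover have "(r - s) * \<bar>Q + e\<bar> \<le> T * \<bar>Q + e\<bar>" using r s0 by (intro mult_right_mono) auto
      moreover have "\<theta> * (r - t1) \<le> \<theta> * T" using r t0 t1 \<theta> by (intro mult_left_mono) auto
      moreover have "\<theta> * (t1 - r) = - (\<theta> * (r - t1))" by (simp add: algebra_simps)
      moreover have "(r - s) * - (Q + e) = - ((r - s) * (Q + e))" by (rule mult_minus_right)
      moreover have "0 \<le> \<beta> * sq_gap T \<eta> (mk_path r Y)" using \<beta> by (simp add: sq_gap_nonneg)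
      moreover have "- B \<le> c0" using \<Psi>m m B(1)[OF gL] by (simp add: c0_def)
      ultimately show ?thesis
        using B(2)[OF \<eta>L] Bf0[of r "x + (r - s) *\<^sub>R v"] unfolding f\<eta> \<rho>_def by linarith
    qed
  qed
  have "- horizontal_deriv T f h + hamiltonian F q h (- vertical_gradient f h) \<le> 0"
    using sT fh by (intro supersolution_test[OF super R hL _ hR f1 eq le]) auto
  then have 1: "hamiltonian F q h P \<le> \<rho>' s + P \<bullet> v" by (simp add: f2 f3)
  have \<rho>'s: "\<rho>' s \<le> Q + e - \<theta>"
  proof -
    have "L * (1 + path_norm g) \<le> L * (1 + R)" using L lipschitz_pathsD(3)[OF gL] by simp
    then have "norm v \<le> L * (1 + R)" using bF[OF gc, of u] by (simp add: v_def)
    then have "norm x * norm v \<le> R * (L * (1 + R))"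
      using xR R by (intro mult_mono) auto
    then have "2 * (x \<bullet> v) - c \<le> 0" using norm_cauchy_schwarz[of x v] by (simp add: c_def)
    then have "k * (2 * (x \<bullet> v) - c) \<le> 0" using k(1) by (simp add: mult_le_0_iff)
    then have "Bf s x * (k * (2 * (x \<bullet> v) - c)) \<le> 0"
      using Bf0[of s x] by (simp add: mult_le_0_iff)
    then show ?thesis by (simp add: \<rho>'_def)
  qed
  have "P \<bullet> (F g u - F h u) + (q g u - q h u) \<le> N * e'"
    using penalty_error[OF gc hc s_def[symmetric] fh \<beta>, of e' u] D
    by (simp add: P_def x_def N_def D_def G_def)
  then have "P \<bullet> v - P \<bullet> F h u + (Q - q h u) \<le> \<theta> / 4"
    using e'(4) by (simp add: inner_diff_right v_def Q_def)
  then have "\<theta> \<le> \<theta> / 4 + 2 * e" using 1 u \<rho>'s by linarith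
  then show False using \<theta> by (simp add: e_def)
qed

section \<open>Approximation by Lipschitz paths\<close>

text \<open>Polynomials are dense in the uniform norm and have bounded derivative on a compact
  interval. The final time is kept, so the approximant falls under the same step of the backward
  induction.\<close>

lemma lipschitz_path_approx:
  fixes p :: "'n::finite cadlag_path"
  assumes p: "p \<in> cont_paths T 0" and e: "e > 0"
  obtains p' C where "p' \<in> cont_paths T 0" "final_time p' = final_time p" "dist p' p < e"
    "\<And>l r. norm (frozen p' l - frozen p' r) \<le> C * \<bar>l - r\<bar>"
proof -
  define t where "t = final_time p"
  have t: "0 \<le> t" "t \<le> T" using cont_paths_final_time[OF p] by (auto simp: t_def)
  obtain g where g: "polynomial_function g" "\<And>x. x \<in> {0..t} \<Longrightarrow> norm (frozen p x - g x) < e / 2"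
    using Stone_Weierstrass_polynomial_function[of "{0..t}" "frozen p" "e / 2"] continuous_on_frozen[OF p] e by auto
  have cg: "continuous_on X g" for X using g(1) by (rule continuous_on_polymonial_function)
  obtain g' where g': "polynomial_function g'" "\<And>x. (g has_vector_derivative g' x) (at x)"
    using has_vector_derivative_polynomial_function[OF g(1)] by blast
  have "compact (g' ` {0..t})"
    using g'(1) by (intro compact_continuous_image continuous_on_polymonial_function) auto
  then obtain C where C: "\<And>x. x \<in> {0..t} \<Longrightarrow> norm (g' x) \<le> C"
    using compact_imp_bounded by (fastforce simp: bounded_iff)
  have C0: "0 \<le> C" using C[of 0] t order_trans[OF norm_ge_zero[of "g' 0"]] by simp
  define p' where "p' = mk_path t g"
  have on: "onorm (\<lambda>h. h *\<^sub>R g' x) \<le> C" if "x \<in> {0..t}" for x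
    using C[OF that] by (intro onorm_le) (simp add: mult.commute[of C] mult_left_mono)
  have lip: "norm (g x - g y) \<le> C * norm (x - y)" if "x \<in> {0..t}" "y \<in> {0..t}" for x y
    using g'(2) that
    by (intro differentiable_bound[of "{0..t}" g "\<lambda>x h. h *\<^sub>R g' x"] on)
      (auto simp: has_vector_derivative_def intro: has_derivative_at_withinI)
  have "norm (frozen p' l - frozen p' r) \<le> C * \<bar>l - r\<bar>" for l r
  proof -
    have "norm (g (max 0 (min l t)) - g (max 0 (min r t))) \<le> C * norm (max 0 (min l t) - max 0 (min r t))"
      using t by (intro lip) auto
    also have "\<dots> \<le> C * \<bar>l - r\<bar>" using C0 by (intro mult_left_mono) auto
    finally show ?thesis using t cg by (simp add: p'_def frozen_mk_path)
  qed
  moreover have "dist p' p \<le> 0 + e / 2"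
  proof (rule order_trans[OF dist_path_leI])
    fix r assume "0 \<le> r" "r \<le> max (final_time p') (final_time p)"
    then have "r \<in> {0..t}" using t cg by (auto simp: p'_def t_def)
    then show "norm (frozen p' r - frozen p r) \<le> e / 2"
      using g(2)[of r] t cg by (simp add: p'_def frozen_mk_path norm_minus_commute)
  qed (use t cg in \<open>simp add: p'_def t_def\<close>)
  moreover have "p' \<in> cont_paths T 0" "final_time p' = final_time p"
    using t cg by (auto simp: p'_def t_def[symmetric] intro!: mk_path_cont_paths)
  ultimately show ?thesis using that[of p' C] e by auto
qed

section \<open>Backward induction in time\<close>

theorem theorem5p1:
  fixes T K :: real
    and F :: "'n::finite cadlag_path \<Rightarrow> 'u::metric_space \<Rightarrow> real ^ 'n"
    and q :: "'n cadlag_path \<Rightarrow> 'u \<Rightarrow> real"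
    and \<phi> W1 W2 :: "'n cadlag_path \<Rightarrow> real"
  assumes "T > 0"
    and "hypothesis_H T F q \<phi>"
    and "viscosity_subsolution T (hamiltonian F q) \<phi> W1"
    and "viscosity_supersolution T (hamiltonian F q) \<phi> W2"
    and "K > 0"
    and "\<And>p. p \<in> cont_paths T 0 \<Longrightarrow> max \<bar>W1 p\<bar> \<bar>W2 p\<bar> \<le> K * (1 + path_norm p)"
    and "\<And>p p'. p \<in> cont_paths T 0 \<Longrightarrow> p' \<in> cont_paths T 0 \<Longrightarrow>
           max \<bar>W1 p - W1 p'\<bar> \<bar>W2 p - W2 p'\<bar>
             \<le> K * (1 + max (path_norm p) (path_norm p')) * dist p p'"
  shows "\<forall>p\<in>cont_paths T 0. W1 p \<le> W2 p"
proof -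
  obtain L where L: "L > 0" and
    H: "\<And>t p p' u. t \<in> {0..T} \<Longrightarrow> p \<in> cont_paths t t \<Longrightarrow> p' \<in> cont_paths t t \<Longrightarrow>
      max (norm (F p u - F p' u)) \<bar>q p u - q p' u\<bar> \<le> L * path_diff_norm p p' \<and>
      max (norm (F p u)) \<bar>q p u\<bar> \<le> L * (1 + path_norm p)"
    using assms(2) unfolding hypothesis_H_def by blast
  have self: "p \<in> cont_paths (final_time p) (final_time p)" "final_time p \<in> {0..T}" if "p \<in> cont_paths T 0" for p :: "'n cadlag_path"
    using that by (auto simp: cont_paths_def cadlag_paths_def)
  interpret control_data T L F q
  proof
    fix u :: 'u
    have pair: "continuous_on (cont_paths T 0 :: 'n cadlag_path set) (\<lambda>p. (p, u))" by (intro continuous_intros)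
    have "continuous_on (cont_paths T 0 \<times> UNIV) (\<lambda>(p, u). F p u)" "continuous_on (cont_paths T 0 \<times> UNIV) (\<lambda>(p, u). q p u)"
      using assms(2) by (simp_all add: hypothesis_H_def)
    from continuous_on_compose2[OF this(1)[unfolded case_prod_beta] pair]
      continuous_on_compose2[OF this(2)[unfolded case_prod_beta] pair]
    show "continuous_on (cont_paths T 0) (\<lambda>p. F p u)" "continuous_on (cont_paths T 0) (\<lambda>p. q p u)"
      by auto
  next
    fix p p' :: "'n cadlag_path" and u
    assume "p \<in> cont_paths T 0" "p' \<in> cont_paths T 0" "final_time p = final_time p'"
    then show "norm (F p u - F p' u) \<le> L * dist p p'" "\<bar>q p u - q p' u\<bar> \<le> L * dist p p'"
      using H[of "final_time p" p p' u] self[of p] self[of p'] by (auto simp: path_diff_norm_eq_dist)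
  next
    fix p :: "'n cadlag_path" and u
    assume "p \<in> cont_paths T 0"
    then show "norm (F p u) \<le> L * (1 + path_norm p)" "\<bar>q p u\<bar> \<le> L * (1 + path_norm p)"
      using H[of "final_time p" p p u] self[of p] by auto
  qed (use assms L in auto)
  obtain \<mu>1 where \<mu>1: "\<And>\<mu>. \<mu> \<ge> \<mu>1 \<Longrightarrow> viscosity_mu_subsolution T (hamiltonian F q) \<phi> \<mu> W1"
    using assms(3) unfolding viscosity_subsolution_def by blast
  obtain \<mu>2 where \<mu>2: "\<And>\<mu>. \<mu> \<ge> \<mu>2 \<Longrightarrow> viscosity_mu_supersolution T (hamiltonian F q) \<phi> \<mu> W2"
    using assms(4) unfolding viscosity_supersolution_def by blast
  have cW: "continuous_on (cont_paths T 0) W1" "continuous_on (cont_paths T 0) W2"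
    using \<mu>1[of \<mu>1] \<mu>2[of \<mu>2] by (simp_all add: viscosity_mu_subsolution_def viscosity_mu_supersolution_def)
  \<comment> \<open>The step length depends on L alone, although \<mu> and R vary from path to path;
    otherwise finitely many steps might not reach time 0.\<close>
  define \<tau> where "\<tau> = 1 / (16 * L)"
  have \<tau>: "\<tau> > 0" using L by (simp add: \<tau>_def)
  have base: "W1 p \<le> W2 p" if "p \<in> cont_paths T 0" "final_time p = T" for p
  proof -
    have "p \<in> cont_paths T T" using self[OF that(1)] that(2) by simp
    then show ?thesis
      using \<mu>1[of \<mu>1] \<mu>2[of \<mu>2]
      by (fastforce simp: viscosity_mu_subsolution_def viscosity_mu_supersolution_def intro: order_trans)
  qed
  have lipschitz_step: "W1 p \<le> W2 p"
    if p: "p \<in> cont_paths T 0" and lip: "\<And>l r. norm (frozen p l - frozen p r) \<le> C * \<bar>l - r\<bar>"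
      and t1: "final_time p < t1" "t1 \<le> T" "t1 - final_time p \<le> \<tau>"
      and terminal: "\<And>z. z \<in> cont_paths T 0 \<Longrightarrow> final_time z = t1 \<Longrightarrow> W1 z \<le> W2 z" for p C t1
  proof -
    define M where "M = path_norm p"
    define R where "R = 4 + 2 * M"
    \<comment> \<open>Being a solution for all large \<mu> is used here: the class must contain p
      itself, of slope C, and be invariant under the dynamics.\<close>
    define \<mu> where "\<mu> = max (max \<mu>1 \<mu>2) (max (max 1 L) C)"
    have M: "M \<ge> 0" by (simp add: M_def path_norm_nonneg)
    have \<mu>: "\<mu> \<ge> \<mu>1" "\<mu> \<ge> \<mu>2" "\<mu> \<ge> 1" "\<mu> \<ge> L" "\<mu> \<ge> C" by (auto simp: \<mu>_def)
    have W: "\<bar>W1 z - W1 z'\<bar> \<le> K * (1 + R) * dist z z'" "\<bar>W2 z - W2 z'\<bar> \<le> K * (1 + R) * dist z z'"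
      if z: "z \<in> lipschitz_paths T 0 \<mu> R" "z' \<in> lipschitz_paths T 0 \<mu> R" for z z'
    proof -
      have "K * (1 + max (path_norm z) (path_norm z')) \<le> K * (1 + R)"
        using assms(5) lipschitz_pathsD(3)[OF z(1)] lipschitz_pathsD(3)[OF z(2)] by (intro mult_left_mono) auto
      then have "K * (1 + max (path_norm z) (path_norm z')) * dist z z' \<le> K * (1 + R) * dist z z'"
        by (rule mult_right_mono) simp
      then show "\<bar>W1 z - W1 z'\<bar> \<le> K * (1 + R) * dist z z'" "\<bar>W2 z - W2 z'\<bar> \<le> K * (1 + R) * dist z z'"
        using assms(7)[OF lipschitz_pathsD(1)[OF z(1)] lipschitz_pathsD(1)[OF z(2)]] by auto
    qed
    have pL: "p \<in> lipschitz_paths T 0 \<mu> R"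
    proof (rule lipschitz_pathsI[OF p])
      fix l r
      show "norm (frozen p r) \<le> R" using norm_frozen_le[of p r] M by (simp add: R_def M_def)
      have "C * 1 \<le> \<mu> * (1 + R)" using \<mu> M by (intro mult_mono) (auto simp: R_def)
      then have "C * \<bar>l - r\<bar> \<le> \<mu> * (1 + R) * \<bar>l - r\<bar>" by (intro mult_right_mono) auto
      then show "norm (frozen p l - frozen p r) \<le> \<mu> * (1 + R) * \<bar>l - r\<bar>" using lip[of l r] by linarith
    qed
    have K1: "0 < K * (1 + R)" using assms(5) M by (simp add: R_def)
    show ?thesis
      using t1 by (intro comparison_step[OF \<mu>1[OF \<mu>(1)] \<mu>2[OF \<mu>(2)] K1 W \<mu>(3,4) M R_def pL refl _ _ _ _ terminal])
        (auto simp: M_def \<tau>_def norm_path_at_le)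
  qed
  have "\<forall>p\<in>cont_paths T 0. T - real n * \<tau> \<le> final_time p \<longrightarrow> W1 p \<le> W2 p" for n
  proof (induction n)
    case 0
    then show ?case using base cont_paths_final_time by fastforce
  next
    case (Suc n)
    show ?case
    proof (intro ballI impI)
      fix p :: "'n cadlag_path"
      assume p: "p \<in> cont_paths T 0" and tp: "T - real (Suc n) * \<tau> \<le> final_time p"
      show "W1 p \<le> W2 p"
      proof (cases "final_time p = T")
        case False
        \<comment> \<open>The truncation at T covers the last interval; in either case t1 is at
          least T - n \<tau>, so the induction hypothesis gives the terminal inequality.\<close>
        define t1 where "t1 = min T (final_time p + \<tau>)"
        have t1: "final_time p < t1" "t1 \<le> T" "t1 - final_time p \<le> \<tau>" "T - real n * \<tau> \<le> t1"
          using False \<tau> tp cont_paths_final_time[OF p] by (auto simp: t1_def algebra_simps)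
        \<comment> \<open>The slope C may blow up as e shrinks, but only the inequality at p' is
          needed; continuity of W1 - W2 then carries it to p.\<close>
        have "\<exists>p'\<in>cont_paths T 0. dist p' p < e \<and> W1 p' \<le> W2 p'" if e: "e > 0" for e
        proof -
          obtain p' C where p': "p' \<in> cont_paths T 0" "final_time p' = final_time p" "dist p' p < e"
            "\<And>l r. norm (frozen p' l - frozen p' r) \<le> C * \<bar>l - r\<bar>"
            by (rule lipschitz_path_approx[OF p e]) (rule that; blast)
          have "W1 p' \<le> W2 p'"
            using t1 Suc.IH p'(2) by (intro lipschitz_step[OF p'(1,4), of t1]) auto
          then show ?thesis using p' by blast
        qed
        note approx = this
        show ?thesis
        proof (rule ccontr)
          assume "\<not> W1 p \<le> W2 p"
          then have pos: "0 < W1 p - W2 p" by simp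
          have "continuous_on (cont_paths T 0) (\<lambda>p. W1 p - W2 p)" by (intro continuous_intros cW)
          then obtain d where "d > 0" "\<forall>p'\<in>cont_paths T 0. dist p' p < d \<longrightarrow> dist (W1 p' - W2 p') (W1 p - W2 p) < W1 p - W2 p"
            using p pos unfolding continuous_on_iff by blast
          then show False using approx[of d] by (fastforce simp: dist_real_def)
        qed
      qed (use base p in auto)
    qed
  qed
  moreover have "\<exists>n. T \<le> real n * \<tau>"
    using reals_Archimedean3[OF \<tau>] less_imp_le by blast
  ultimately show ?thesis
    using final_time_nonneg by (metis diff_le_0_iff_le order_trans)
qed

end
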